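(* Let $P\subset\mathbb{R}^3$ be a generic simple convex polytope with $\mathcal{N}(P)<10$. Then: (1) Each vertex of $P$ has exactly two incident acute dihedral angles (i.e. exactly two of the three edges at the vertex have acute dihedral angle). (2) Each vertex of $P$ has exactly one incident acute planar angle. This angle is not the angle between the two edges at that vertex having acute dihedral angles.
   Context: Polytopes are compact, convex, with non-empty interior. For $y\in\mathrm{Int}\,P$, a normal to $\partial P$ emanating from $y$ is a segment $yz$ such that some support plane $h$ of $P$ satisfies $z\in h\cap P$ and $yz\perp h$. $n(P,y)$ is the number of normals emanating from $y$, and $\mathcal{N}(P)=\max_{y\in\mathrm{Int}\,P}n(P,y)$. $P\subset\mathbb{R}^3$ is simple if each vertex has exactly three emanating edges. A planar angle at a vertex $V$ is the angle at $V$ of a facet containing $V$ (the angle between two edges of that facet at $V$). Active regions and sheets: for a face $F$ of $P$ (vertex, edge or facet), let $o$ be a point in the relative interior of $F$ and $\mathrm{Cone}(F)=\{x\in\mathbb{R}^3:\langle p-o,x\rangle\ge0\ \forall p\in P\}$ (independent of $o$). The active region of $F$ is $\mathcal{AR}(F)=(\mathrm{Cone}(F)+F)\cap P$. The bifurcation set $\mathcal{B}(P)$ is the union of the boundaries of all active regions. Its linear pieces not lying on $\partial P$ are called sheets: the blue sheets are the side walls of the active regions of facets (i.e. for an edge $E$ of a facet $F$, the set $(E+\mathrm{Cone}(F))\cap P$), and the red sheets are the walls of the active regions of vertices (i.e. for an endpoint $V$ of an edge $E$, the set $(V+\mathrm{Cone}(E))\cap P$). A simple polytope $P\subset\mathbb{R}^3$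 is generic if (i) no dihedral angle at an edge and no planar angle of a facet is right, and (ii) the sheets of $\mathcal{B}(P)$ intersect (pairwise) transversally. *)

theory Defs
  imports "HOL-Analysis.Analysis"
begin

section \<open>Normals\<close>

definition hyperplane :: "real^3 \<Rightarrow> real \<Rightarrow> (real^3) set" where
  "hyperplane a b = {x. a \<bullet> x = b}"

definition support_plane_of :: "(real^3) set \<Rightarrow> (real^3) set \<Rightarrow> bool"
    (infix \<open>support'_plane'_of\<close> 50) where
  "h support_plane_of P \<longleftrightarrow>
     (\<exists>a b. a \<noteq> 0 \<and> h = hyperplane a b \<and> P \<subseteq> {x. a \<bullet> x \<le> b} \<and> h \<inter> P \<noteq> {})"

text \<open>A normal emanating from \<open>y\<close> is a segment \<open>yz\<close>, and is represented by its foot \<open>z\<close>.\<close>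

definition normal_feet :: "(real^3) set \<Rightarrow> real^3 \<Rightarrow> (real^3) set" where
  "normal_feet P y =
     {z. \<exists>h. h support_plane_of P \<and> z \<in> h \<inter> P \<and> (\<forall>u\<in>h. \<forall>v\<in>h. (z - y) \<bullet> (u - v) = 0)}"

text \<open>
  For a polytope and an interior point \<open>y\<close>, a foot in the relative interior of a face \<open>F\<close>
  is the orthogonal projection of \<open>y\<close> to the affine hull of \<open>F\<close>. So there are at most as many
  normals as faces, and neither \<^const>\<open>card\<close> nor \<^const>\<open>Max\<close> below meets an infinite set.
\<close>

definition num_normals :: "(real^3) set \<Rightarrow> real^3 \<Rightarrow> nat" where
  "num_normals P y = card (normal_feet P y)"

definition max_normals :: "(real^3) set \<Rightarrow> nat" where
  "max_normals P = Max (num_normals P ` interior P)"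


section \<open>Simple polytopes and their angles\<close>

definition simple_polytope :: "(real^3) set \<Rightarrow> bool" where
  "simple_polytope P \<longleftrightarrow> polytope P \<and> interior P \<noteq> {} \<and>
     (\<forall>V. V extreme_point_of P \<longrightarrow> card {E. E edge_of P \<and> V \<in> E} = 3)"

definition vec_angle :: "real^3 \<Rightarrow> real^3 \<Rightarrow> real" where
  "vec_angle u v = arccos (u \<bullet> v / (norm u * norm v))"

text \<open>The angle of the polygon \<open>F\<close> at its vertex \<open>V\<close>.\<close>

definition planar_angle :: "(real^3) set \<Rightarrow> real^3 \<Rightarrow> real" where
  "planar_angle F V = (THE \<theta>. \<exists>W1 W2. W1 \<noteq> V \<and> W2 \<noteq> V \<and>
     closed_segment V W1 edge_of F \<and> closed_segment V W2 edge_of F \<and>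
     closed_segment V W1 \<noteq> closed_segment V W2 \<and>
     \<theta> = vec_angle (W1 - V) (W2 - V))"

text \<open>
  The component of \<open>p - e\<close> orthogonal to the edge \<open>E\<close> (for any \<open>e\<close> on \<open>E\<close>). For \<open>p\<close> in a facet
  \<open>F\<close> through \<open>E\<close>, but not on \<open>E\<close>, it is the inward direction of \<open>F\<close> orthogonal to \<open>E\<close>, up to
  a positive factor.
\<close>

definition orth_to_edge :: "(real^3) set \<Rightarrow> real^3 \<Rightarrow> real^3" where
  "orth_to_edge E p = p - closest_point (affine hull E) p"

text \<open>The interior dihedral angle of \<open>P\<close> at its edge \<open>E\<close>.\<close>

definition dihedral_angle :: "(real^3) set \<Rightarrow> (real^3) set \<Rightarrow> real" where
  "dihedral_angle P E = (THE \<theta>. \<exists>F G p q. F facet_of P \<and> G facet_of P \<and> F \<noteq> G \<and>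
     E \<subseteq> F \<and> E \<subseteq> G \<and> p \<in> F - E \<and> q \<in> G - E \<and>
     \<theta> = vec_angle (orth_to_edge E p) (orth_to_edge E q))"


section \<open>Sheets of the bifurcation set\<close>

definition face_cone :: "(real^3) set \<Rightarrow> (real^3) set \<Rightarrow> (real^3) set" where
  "face_cone P F = {x. \<forall>c\<in>rel_interior F. \<forall>p\<in>P. (p - c) \<bullet> x \<ge> 0}"

definition active_region :: "(real^3) set \<Rightarrow> (real^3) set \<Rightarrow> (real^3) set" where
  "active_region P F = {f + x |f x. f \<in> F \<and> x \<in> face_cone P F} \<inter> P"

text \<open>
  For a facet \<open>A\<close> of the face \<open>F\<close>, this is the common wall \<open>(A + Cone(F)) \<inter> P\<close> of the active
  regions of \<open>A\<close> and \<open>F\<close>.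
\<close>

definition wall :: "(real^3) set \<Rightarrow> (real^3) set \<times> (real^3) set \<Rightarrow> (real^3) set" where
  "wall P = (\<lambda>(A, F). {a + x |a x. a \<in> A \<and> x \<in> face_cone P F} \<inter> P)"

text \<open>
  Sheets are indexed by the pair of faces whose active regions they separate, so that two walls
  of different regions remain two sheets even if they coincide as sets (they are then not
  transversal). A wall inside the boundary of \<open>P\<close> is not a sheet; for instance, if the
  dihedral angle at \<open>E\<close> is acute, \<open>(E + Cone(F)) \<inter> P\<close> degenerates to \<open>E\<close>.
\<close>

definition blue_sheets :: "(real^3) set \<Rightarrow> ((real^3) set \<times> (real^3) set) set" where
  "blue_sheets P = {(E, F). F facet_of P \<and> E edge_of F \<and> \<not> wall P (E, F) \<subseteq> frontier P}"

definition red_sheets :: "(real^3) set \<Rightarrow> ((real^3) set \<times> (real^3) set) set" where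
  "red_sheets P = {({V}, E) |V E. E edge_of P \<and> V extreme_point_of E \<and>
     \<not> wall P ({V}, E) \<subseteq> frontier P}"

text \<open>
  A sheet is a planar convex set, so its tangent space at each of its points is spanned by the
  differences of its elements.
\<close>

definition directions :: "(real^3) set \<Rightarrow> (real^3) set" where
  "directions S = span {x - y |x y. x \<in> S \<and> y \<in> S}"

definition transversal :: "(real^3) set \<Rightarrow> (real^3) set \<Rightarrow> bool" where
  "transversal S T \<longleftrightarrow> S \<inter> T = {} \<or> span (directions S \<union> directions T) = UNIV"

definition generic_polytope :: "(real^3) set \<Rightarrow> bool" where
  "generic_polytope P \<longleftrightarrow>
     (\<forall>E. E edge_of P \<longrightarrow> dihedral_angle P E \<noteq> pi / 2) \<and>
     (\<forall>F V. F facet_of P \<and> V extreme_point_of F \<longrightarrow> planar_angle F V \<noteq> pi / 2) \<and>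
     (\<forall>s \<in> blue_sheets P \<union> red_sheets P. \<forall>t \<in> blue_sheets P \<union> red_sheets P.
        s \<noteq> t \<longrightarrow> transversal (wall P s) (wall P t))"


section \<open>Acute angles at a vertex\<close>

definition acute_edges :: "(real^3) set \<Rightarrow> real^3 \<Rightarrow> (real^3) set set" where
  "acute_edges P V = {E. E edge_of P \<and> V \<in> E \<and> dihedral_angle P E < pi / 2}"

definition acute_facets :: "(real^3) set \<Rightarrow> real^3 \<Rightarrow> (real^3) set set" where
  "acute_facets P V = {F. F facet_of P \<and> V \<in> F \<and> planar_angle F V < pi / 2}"

end

theory Submission
  imports Defs
begin

text \<open>
  A foot \<open>z\<close> of a normal from \<open>y\<close> is characterised by \<open>(p - z) \<bullet> (y - z) \<ge> 0\<close> for all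
  \<open>p \<in> P\<close>; each active region containing \<open>y\<close> contributes one foot. For generic \<open>y\<close> the
  activity of faces is governed by signs attached to the flags (vertex, edge) and (edge, facet),
  and a double count of these signs, together with Euler's relation (obtained from a sweep by a
  linear functional), shows that vertices minus edges plus facets among the active faces is \<open>2\<close>.
  So the number of active faces is even, and nine normals force ten.

  Suppose that a direction \<open>x\<close> at a vertex \<open>V\<close> points into the active regions of all seven faces
  at \<open>V\<close>. Follow the ray \<open>V + t x\<close> until it leaves one of these regions or \<open>P\<close>. The vertex \<open>W\<close>
  farthest from \<open>V\<close> stays active until then: otherwise the ray meets a sheet of \<open>W\<close>, where also an
  edge is active. At the exit another far face becomes active: the facet where the
  ray leaves \<open>P\<close>, an edge where the foot on a facet leaves this facet, or the other end \<open>U\<close> of an edge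
  at \<open>V\<close>. Here \<open>U \<noteq> W\<close>, because the exit point is farther from \<open>V\<close> than \<open>U\<close>. So there are nine
  normals. Linear algebra shows that such an \<open>x\<close> exists at every vertex whose angles are not as
  claimed.
\<close>

section \<open>Faces of polytopes\<close>

text \<open>The parity argument needs a generic point, but the exit point lies on a sheet. Hence
  every claim about the exit is made for times in a left neighbourhood of the exit time: flags are
  affine functions of time, those positive at the exit stay positive shortly before it, and the
  choice of \<open>x\<close> makes the points there generic. The double count is local. An inactive
  face is a polynomial in the indicators of its negative flags, split over its vertices. In each
  facet at a vertex the leftover is a product of two differences of indicators; it vanishes because
  the foot of the point on the facet differs from the vertex. The linear algebra depends on three
  numbers only, the cosines between the inner normals at \<open>V\<close>: as in the spherical law
  of cosines, they decide which dihedral and planar angles are acute. Three explicit directions (the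
  sum of the edge vectors, a vector leaning towards one edge, a vector above the bisector of a facet
  angle) cover all sign patterns except \<open>tame_type\<close>.\<close>

lemma polytope_exists_face_rel_interior:
  fixes S :: "'a::euclidean_space set"
  assumes S: "polytope S" and g: "g \<in> S"
  obtains F where "F face_of S" "g \<in> rel_interior F"
proof -
  \<comment> \<open>The shift by 1 absorbs \<open>aff_dim {} = -1\<close>. In a face of least
    dimension containing \<open>g\<close>, no proper facet contains \<open>g\<close>.\<close>
  define m where "m = (\<lambda>F::'a set. nat (aff_dim F + 1))"
  have "S face_of S \<and> g \<in> S"
    using S g face_of_refl polytope_imp_convex by blast
  then obtain F where F: "F face_of S" "g \<in> F"
    and min: "\<And>G. G face_of S \<Longrightarrow> g \<in> G \<Longrightarrow> m F \<le> m G"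
    using ex_has_least_nat[of "\<lambda>F. F face_of S \<and> g \<in> F" S m] by blast
  have pF: "polytope F"
    using F S face_of_polytope_polytope by blast
  have "g \<in> rel_interior F"
  proof (rule ccontr)
    assume "g \<notin> rel_interior F"
    then obtain G where G: "G facet_of F" "g \<in> G"
      using rel_interior_of_polyhedron[OF polytope_imp_polyhedron[OF pF]] F(2) by blast
    have "G face_of S" using G(1) F(1) face_of_trans facet_of_imp_face_of by blast
    then have "m F \<le> m G" using min G(2) by blast
    moreover have "aff_dim G = aff_dim F - 1" "aff_dim G \<ge> 0"
      using G aff_dim_negative_iff[of G] by (auto simp: facet_of_def not_less simp del: aff_dim_negative_iff)
    ultimately show False by (simp add: m_def)
  qed
  then show ?thesis using F that by blast
qed

lemma edge_of_polytope_segment: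
  fixes S :: "'a::euclidean_space set"
  assumes S: "polytope S" and E: "E edge_of S"
  obtains A B where "A \<noteq> B" "E = closed_segment A B" "A extreme_point_of S" "B extreme_point_of S"
proof -
  have f: "E face_of S" "aff_dim E = 1" using E by (auto simp: edge_of_def)
  then have pE: "polytope E" using S face_of_polytope_polytope by blast
  have "E \<noteq> {}" using f by auto
  moreover have "collinear E" using f by (simp add: collinear_aff_dim)
  ultimately obtain A B where AB: "E = closed_segment A B"
    using pE compact_convex_collinear_segment polytope_imp_compact polytope_imp_convex by metis
  have "A \<noteq> B" using f AB by auto
  moreover have "A extreme_point_of E" "B extreme_point_of E"
    by (simp_all add: AB extreme_point_of_segment)
  ultimately show ?thesis using that AB f(1) extreme_point_of_face by blast
qed

text \<open>If the face carrying \<open>g\<close> had dimension at least 2, its affine hull would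
  share a line through \<open>g\<close> with the hyperplane, and \<open>g\<close> would be the
  midpoint of a short segment of that line inside the section.\<close>

lemma extreme_point_of_hyperplane_section:
  fixes S :: "'a::euclidean_space set"
  assumes S: "polytope S" and g: "g extreme_point_of (S \<inter> {x. a \<bullet> x = b})"
  obtains F where "F face_of S" "g \<in> rel_interior F" "aff_dim F \<le> 1"
proof -
  have gS: "g \<in> S" "a \<bullet> g = b" using g by (auto simp: extreme_point_of_def)
  obtain F where F: "F face_of S" "g \<in> rel_interior F"
    using polytope_exists_face_rel_interior[OF S gS(1)] by blast
  have "aff_dim F \<le> 1"
  proof (rule ccontr)
    assume d: "\<not> aff_dim F \<le> 1"
    let ?H = "affine hull F \<inter> {x. a \<bullet> x = b}"
    have gH: "g \<in> ?H" using F gS rel_interior_subset[of F] hull_subset[of F affine] by auto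
    have "aff_dim ?H \<ge> 1"
      using aff_dim_affine_Int_hyperplane[of "affine hull F" a b] d gH by (auto simp: aff_dim_affine_hull)
    have "\<not> ?H \<subseteq> {g}"
    proof
      assume "?H \<subseteq> {g}"
      from aff_dim_subset[OF this] show False using \<open>aff_dim ?H \<ge> 1\<close> by simp
    qed
    then obtain h where h: "h \<in> ?H" "h \<noteq> g" by blast
    obtain e where e: "e > 0" "ball g e \<inter> affine hull F \<subseteq> F"
      using F(2) by (auto simp: mem_rel_interior_ball)
    define s where "s = e / (2 * norm (h - g))"
    have s: "s > 0" "norm (s *\<^sub>R (h - g)) < e"
      using e h by (auto simp: s_def)
    have aff: "g + t *\<^sub>R (h - g) \<in> affine hull F" for t
    proof -
      have "(1 - t) *\<^sub>R g + t *\<^sub>R h \<in> affine hull F"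
        using h gH mem_affine[OF affine_affine_hull, of g F h "1 - t" t] by auto
      then show ?thesis by (simp add: algebra_simps)
    qed
    have "g + t *\<^sub>R (h - g) \<in> S \<inter> {x. a \<bullet> x = b}" if "\<bar>t\<bar> = s" for t
    proof -
      have "norm (t *\<^sub>R (h - g)) < e" using s that by auto
      then have "g + t *\<^sub>R (h - g) \<in> ball g e" by (simp add: dist_norm)
      then have "g + t *\<^sub>R (h - g) \<in> F" using e aff by blast
      then show ?thesis using h gS F(1) face_of_imp_subset by (auto simp: inner_add_right inner_diff_right)
    qed
    then have "g + s *\<^sub>R (h - g) \<in> S \<inter> {x. a \<bullet> x = b}" "g + (-s) *\<^sub>R (h - g) \<in> S \<inter> {x. a \<bullet> x = b}"
      using s by (force, metis abs_minus_cancel abs_of_pos)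
    moreover have "g \<in> open_segment (g + (-s) *\<^sub>R (h - g)) (g + s *\<^sub>R (h - g))"
    proof -
      have "g = midpoint (g + (-s) *\<^sub>R (h - g)) (g + s *\<^sub>R (h - g))"
        by (simp add: midpoint_def scaleR_2[symmetric])
      moreover have "g + (-s) *\<^sub>R (h - g) \<noteq> g + s *\<^sub>R (h - g)"
        using s h by (simp add: algebra_simps flip: scaleR_add_left)
      ultimately show ?thesis by (metis midpoint_in_open_segment)
    qed
    ultimately show False using g by (auto simp: extreme_point_of_def)
  qed
  then show ?thesis using F that by blast
qed

text \<open>The vertex figure: a hyperplane cuts off \<open>V\<close> from the other vertices, and the vertices of the
  section lie on the edges at \<open>V\<close>.\<close>

lemma polytope_subset_vertex_cone:
  fixes S :: "'a::euclidean_space set"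
  assumes S: "polytope S" and V: "V extreme_point_of S"
    and K: "convex K" "0 \<in> K" "\<And>c k. c \<ge> 0 \<Longrightarrow> k \<in> K \<Longrightarrow> c *\<^sub>R k \<in> K"
    and edges: "\<And>W. W \<noteq> V \<Longrightarrow> closed_segment V W edge_of S \<Longrightarrow> W - V \<in> K"
    and p: "p \<in> S"
  shows "p - V \<in> K"
proof (cases "p = V")
  case True then show ?thesis using K by simp
next
  case False
  define X where "X = {x. x extreme_point_of S}"
  have finX: "finite X" unfolding X_def
    using S finite_polyhedron_extreme_points polytope_imp_polyhedron by blast
  have SX: "S = convex hull X" unfolding X_def
    using S Krein_Milman_Minkowski polytope_imp_compact polytope_imp_convex by blast
  define Q where "Q = convex hull (X - {V})"
  have VX: "V \<in> X" using V by (simp add: X_def)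
  have Qne: "Q \<noteq> {}"
  proof
    assume "Q = {}"
    then have "X = {V}" using VX by (auto simp: Q_def)
    then show False using SX p False by simp
  qed
  have QS: "Q \<subseteq> S" unfolding SX Q_def by (rule hull_mono) auto
  have "V \<notin> Q"
  proof
    assume "V \<in> Q"
    have "V extreme_point_of Q"
      using V QS \<open>V \<in> Q\<close> by (auto simp: extreme_point_of_def)
    then have "V \<in> X - {V}" unfolding Q_def using extreme_point_of_convex_hull by blast
    then show False by simp
  qed
  moreover have "compact Q" "convex Q" unfolding Q_def
    using finX by (auto intro!: finite_imp_compact_convex_hull)
  ultimately obtain a b where ab: "a \<bullet> V < b" "\<And>q. q \<in> Q \<Longrightarrow> b < a \<bullet> q"
  proof -
    have "\<exists>a b. (\<forall>x\<in>{V}. a \<bullet> x < b) \<and> (\<forall>x\<in>Q. b < a \<bullet> x)"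
      using \<open>V \<notin> Q\<close> \<open>compact Q\<close> \<open>convex Q\<close>
      by (intro separating_hyperplane_compact_closed) (auto intro: compact_imp_closed)
    then show ?thesis using that by auto
  qed
  let ?H = "{x. a \<bullet> x = b}"
  have gK: "g - V \<in> K" if g: "g extreme_point_of (S \<inter> ?H)" for g
  proof -
    obtain F where F: "F face_of S" "g \<in> rel_interior F" "aff_dim F \<le> 1"
      using extreme_point_of_hyperplane_section[OF S g] by blast
    have gF: "g \<in> F" "a \<bullet> g = b" using F rel_interior_subset g by (auto simp: extreme_point_of_def)
    have ext: "v = V \<or> b < a \<bullet> v" if "v extreme_point_of S" for v
      using that ab(2) by (auto simp: Q_def X_def intro: hull_inc)
    have "aff_dim F \<noteq> 0"
    proof
      assume "aff_dim F = 0"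
      then have "F = {g}" using gF by (metis aff_dim_eq_0 singletonD)
      then have "g extreme_point_of S" using F face_of_singleton by auto
      then show False using ext gF ab by auto
    qed
    moreover have "aff_dim F \<ge> 0" using gF aff_dim_negative_iff[of F]
      by (auto simp: not_less simp del: aff_dim_negative_iff)
    ultimately have edge: "F edge_of S" using F by (simp add: edge_of_def)
    then obtain A B where AB: "A \<noteq> B" "F = closed_segment A B"
      "A extreme_point_of S" "B extreme_point_of S"
      using edge_of_polytope_segment[OF S] by blast
    have VAB: "A = V \<or> B = V"
    proof (rule ccontr)
      assume "\<not> ?thesis"
      then have "b < a \<bullet> A" "b < a \<bullet> B" using ext AB by blast+
      then have "closed_segment A B \<subseteq> {x. a \<bullet> x > b}"
        by (intro closed_segment_subset convex_halfspace_gt) auto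
      then show False using gF AB by auto
    qed
    then obtain W where W: "W \<noteq> V" "F = closed_segment V W"
      using AB closed_segment_commute by metis
    then obtain u where u: "0 \<le> u" "g = (1 - u) *\<^sub>R V + u *\<^sub>R W"
      using gF by (auto simp: in_segment)
    have "W - V \<in> K" using edges W edge by blast
    moreover have "g - V = u *\<^sub>R (W - V)" using u by (simp add: algebra_simps)
    ultimately show ?thesis using K(3) u(1) by simp
  qed
  have sec: "r - V \<in> K" if "r \<in> S \<inter> ?H" for r
  proof -
    have pt: "polytope (S \<inter> ?H)"
      using S polytope_Int_polyhedron polyhedron_hyperplane by blast
    have "S \<inter> ?H = convex hull {x. x extreme_point_of (S \<inter> ?H)}"
      using pt Krein_Milman_Minkowski polytope_imp_compact polytope_imp_convex by blast
    also have "\<dots> \<subseteq> (\<lambda>k. V + k) ` K"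
    proof (rule hull_minimal)
      show "{x. x extreme_point_of (S \<inter> ?H)} \<subseteq> (+) V ` K"
        using gK by (force simp: image_iff intro: exI[where x="_ - V"])
      show "convex ((+) V ` K)" using K(1) by (rule convex_translation)
    qed
    finally show ?thesis using that by auto
  qed
  have ne: "X - {V} \<noteq> {}" using Qne by (auto simp: Q_def)
  have "insert V (X - {V}) = X" using VX by blast
  then have "p \<in> convex hull (insert V (X - {V}))" using p SX by simp
  then obtain u v q where uv: "u \<ge> 0" "v \<ge> 0" "u + v = 1" "q \<in> Q" "p = u *\<^sub>R V + v *\<^sub>R q"
    unfolding Q_def convex_hull_insert[OF ne] by auto
  have aq: "a \<bullet> V < a \<bullet> q" "b < a \<bullet> q" using ab uv by force+
  \<comment> \<open>The segment from \<open>V\<close> to \<open>q\<close> crosses the hyperplane at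
    \<open>r\<close>. Since \<open>p - V\<close> is a non-negative multiple of \<open>r - V\<close>,
    the section decides membership in \<open>K\<close>.\<close>
  define s where "s = (b - a \<bullet> V) / (a \<bullet> q - a \<bullet> V)"
  have s: "0 < s" "s \<le> 1" using aq ab by (auto simp: s_def)
  define r where "r = V + s *\<^sub>R (q - V)"
  have "a \<bullet> r = b" using aq by (simp add: r_def inner_add_right inner_diff_right s_def)
  moreover have "r \<in> S"
  proof -
    have "(1 - s) *\<^sub>R V + s *\<^sub>R q \<in> S"
      using s VX uv QS S polytope_imp_convex V
      by (intro convexD_alt) (auto simp: extreme_point_of_def)
    then show ?thesis by (simp add: r_def algebra_simps)
  qed
  ultimately have "r - V \<in> K" using sec by blast
  moreover have "p - V = (v / s) *\<^sub>R (r - V)"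
  proof -
    have "p - V = v *\<^sub>R (q - V)" using uv(3,5) by (simp add: algebra_simps flip: scaleR_add_left)
    then show ?thesis using s by (simp add: r_def)
  qed
  ultimately show ?thesis using K(3)[of "v / s"] uv s by simp
qed

section \<open>Linear algebra in space\<close>

lemma normal_to_two:
  fixes a b c :: "real^3"
  assumes indep: "\<And>x y z. x *\<^sub>R a + y *\<^sub>R b + z *\<^sub>R c = 0 \<Longrightarrow> x = 0 \<and> y = 0 \<and> z = 0"
  obtains n where "n \<bullet> a > 0" "n \<bullet> b = 0" "n \<bullet> c = 0"
proof -
  have "a \<notin> span {b, c}"
  proof
    assume "a \<in> span {b, c}"
    then obtain k l where "a - k *\<^sub>R b = l *\<^sub>R c" by (auto simp: span_insert span_singleton)
    then have "1 *\<^sub>R a + (-k) *\<^sub>R b + (-l) *\<^sub>R c = 0" by (simp add: algebra_simps)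
    from indep[OF this] show False by simp
  qed
  obtain y z where yz: "y \<in> span {b, c}" "\<And>w. w \<in> span {b, c} \<Longrightarrow> orthogonal z w" "a = y + z"
    using orthogonal_subspace_decomp_exists[of "{b, c}" a] by metis
  have "z \<noteq> 0" using yz \<open>a \<notin> span {b, c}\<close> by auto
  moreover have "z \<bullet> y = 0" "z \<bullet> b = 0" "z \<bullet> c = 0"
    using yz by (auto simp: orthogonal_def span_base)
  ultimately show ?thesis using that[of z] yz by (simp add: inner_add_right)
qed

lemma common_orthogonal_vector:
  fixes a b :: "real^3"
  obtains n where "n \<noteq> 0" "n \<bullet> a = 0" "n \<bullet> b = 0"
proof -
  have "card {a, b} \<le> 2" by (simp add: card_insert_if)
  then have "dim {a, b} < DIM(real^3)"
    using dim_le_card'[of "{a, b}"] by simp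
  then obtain n where "n \<noteq> 0" "\<And>w. w \<in> span {a, b} \<Longrightarrow> orthogonal n w"
    using orthogonal_to_subspace_exists[of "{a, b}"] by blast
  then show ?thesis using that[of n] by (auto simp: orthogonal_def span_base)
qed

text \<open>Used at a vertex in both directions: to expand in the edge vectors with the normals as
  functionals, and the other way round.\<close>

lemma dual_basis_decomposition:
  fixes d1 d2 d3 n1 n2 n3 x :: "real^3"
  assumes "n1 \<bullet> d1 \<noteq> 0" "n1 \<bullet> d2 = 0" "n1 \<bullet> d3 = 0"
    and "n2 \<bullet> d1 = 0" "n2 \<bullet> d2 \<noteq> 0" "n2 \<bullet> d3 = 0"
    and "n3 \<bullet> d1 = 0" "n3 \<bullet> d2 = 0" "n3 \<bullet> d3 \<noteq> 0"
  shows "x = (n1 \<bullet> x / (n1 \<bullet> d1)) *\<^sub>R d1 + (n2 \<bullet> x / (n2 \<bullet> d2)) *\<^sub>R d2 + (n3 \<bullet> x / (n3 \<bullet> d3)) *\<^sub>R d3"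
proof -
  let ?S = "{d1, d2, d3}"
  have ne: "d1 \<noteq> d2" "d1 \<noteq> d3" "d2 \<noteq> d3" "d3 \<noteq> 0" using assms by auto
  have sp: "v \<in> span {a, b} \<Longrightarrow> n \<bullet> a = 0 \<Longrightarrow> n \<bullet> b = 0 \<Longrightarrow> n \<bullet> v = 0" for n v a b :: "real^3"
    by (auto simp: span_insert span_singleton inner_diff_right algebra_simps)
  have "d2 \<notin> span {d3}" using sp[of d2 d3 d3 n2] assms by auto
  moreover have "d1 \<notin> span {d2, d3}" using sp[of d1 d2 d3 n1] assms by auto
  ultimately have "independent ?S"
    using ne by (simp add: independent_insert)
  moreover have "card ?S = 3" using ne by simp
  ultimately have "UNIV \<subseteq> span ?S"
    by (intro card_ge_dim_independent) auto
  then have "x \<in> span {d1, d2, d3}" by blast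
  then obtain k1 k2 k3 where "x - k1 *\<^sub>R d1 - k2 *\<^sub>R d2 = k3 *\<^sub>R d3"
    by (auto simp: span_insert span_singleton)
  then have x: "x = k1 *\<^sub>R d1 + k2 *\<^sub>R d2 + k3 *\<^sub>R d3" by (simp add: algebra_simps)
  have "n1 \<bullet> x = k1 * (n1 \<bullet> d1)" "n2 \<bullet> x = k2 * (n2 \<bullet> d2)" "n3 \<bullet> x = k3 * (n3 \<bullet> d3)"
    using assms by (simp_all add: x inner_add_right)
  then show ?thesis using assms x by simp
qed

lemma open_avoids_hyperplanes:
  fixes D :: "'a::euclidean_space set"
  assumes "open D" "D \<noteq> {}" "finite S" "0 \<notin> S"
  obtains x where "x \<in> D" "\<And>q. q \<in> S \<Longrightarrow> q \<bullet> x \<noteq> 0"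
proof -
  have "negligible (\<Union>q\<in>S. {x. q \<bullet> x = 0})"
    using assms by (intro negligible_Union) (auto intro!: negligible_hyperplane)
  moreover have "\<not> negligible D" using assms open_not_negligible by blast
  ultimately have "\<not> D \<subseteq> (\<Union>q\<in>S. {x. q \<bullet> x = 0})" using negligible_subset by blast
  then show ?thesis using that by blast
qed

text \<open>The simplex method: as \<open>X\<close> lies in the cone spanned by the neighbours of \<open>V\<close>, a local
  maximum of \<open>\<theta>\<close> is global. The hypothesis on signs covers quotients of affine functions.\<close>

lemma unique_top:
  fixes X :: "'a::euclidean_space set" and \<theta> :: "'a \<Rightarrow> real" and l :: "'a \<Rightarrow> 'a"
  assumes fin: "finite X" "X \<noteq> {}" and Nb: "\<And>V. V \<in> X \<Longrightarrow> Nb V \<subseteq> X" 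
    and cone: "\<And>V q. V \<in> X \<Longrightarrow> q \<in> X \<Longrightarrow> \<exists>c. (\<forall>p\<in>Nb V. c p \<ge> 0) \<and> q - V = (\<Sum>p\<in>Nb V. c p *\<^sub>R (p - V))"
    and sgn: "\<And>V q. V \<in> X \<Longrightarrow> q \<in> X \<Longrightarrow> sgn (\<theta> q - \<theta> V) = sgn (l V \<bullet> (q - V))"
    and ne: "\<And>V p. V \<in> X \<Longrightarrow> p \<in> Nb V \<Longrightarrow> l V \<bullet> (p - V) \<noteq> 0"
  shows "\<exists>!V. V \<in> X \<and> (\<forall>p\<in>Nb V. l V \<bullet> (p - V) < 0)"
proof -
  have finN: "finite (Nb V)" if "V \<in> X" for V using Nb[OF that] fin finite_subset by blast
  have "Max (\<theta> ` X) \<in> \<theta> ` X" using fin by (intro Max_in) auto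
  then obtain V where V: "V \<in> X" "\<theta> V = Max (\<theta> ` X)" by auto
  have top: "l V \<bullet> (p - V) < 0" if p: "p \<in> Nb V" for p
  proof -
    have "p \<in> X" using Nb V p by blast
    then have "\<theta> p \<le> \<theta> V" using V fin by simp
    then have "sgn (\<theta> p - \<theta> V) \<le> 0" by (auto simp: sgn_if)
    then have "sgn (l V \<bullet> (p - V)) \<le> 0" using sgn[OF V(1) \<open>p \<in> X\<close>] by simp
    then show ?thesis using ne[OF V(1) p] by (auto simp: sgn_if split: if_splits)
  qed
  have uniq: "U = V" if U: "U \<in> X" "\<forall>p\<in>Nb U. l U \<bullet> (p - U) < 0" and V: "V \<in> X" "\<forall>p\<in>Nb V. l V \<bullet> (p - V) < 0" for U V
  proof -
    have le: "\<theta> q \<le> \<theta> A \<and> (\<theta> q = \<theta> A \<longrightarrow> q = A)"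
      if A: "A \<in> X" "\<forall>p\<in>Nb A. l A \<bullet> (p - A) < 0" and q: "q \<in> X" for A q
    proof -
      obtain c where c: "\<forall>p\<in>Nb A. c p \<ge> 0" "q - A = (\<Sum>p\<in>Nb A. c p *\<^sub>R (p - A))"
        using cone[OF A(1) q] by blast
      have s: "l A \<bullet> (q - A) = (\<Sum>p\<in>Nb A. c p * (l A \<bullet> (p - A)))"
        by (simp add: c(2) inner_sum_right)
      have np: "c p * (l A \<bullet> (p - A)) \<le> 0" if "p \<in> Nb A" for p
        using c(1) A(2) that by (simp add: less_imp_le mult_nonneg_nonpos)
      then have "l A \<bullet> (q - A) \<le> 0" unfolding s by (intro sum_nonpos) auto
      then have "sgn (\<theta> q - \<theta> A) \<le> 0" unfolding sgn[OF A(1) q] by (auto simp: sgn_if)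
      then have 1: "\<theta> q \<le> \<theta> A" by (auto simp: sgn_if split: if_splits)
      have 2: "q = A" if "\<theta> q = \<theta> A"
      proof -
        have "sgn (l A \<bullet> (q - A)) = 0" using sgn[OF A(1) q] that by simp
        then have "(\<Sum>p\<in>Nb A. - (c p * (l A \<bullet> (p - A)))) = 0" using s by (simp add: sum_negf sgn_if split: if_splits)
        then have "\<forall>p\<in>Nb A. - (c p * (l A \<bullet> (p - A))) = 0"
          using np by (subst (asm) sum_nonneg_eq_0_iff) (auto intro: finN A)
        then have "\<forall>p\<in>Nb A. c p = 0" using A(2) by fastforce
        then have "q - A = 0" unfolding c(2) by (intro sum.neutral) simp
        then show ?thesis by simp
      qed
      show ?thesis using 1 2 by blast
    qed
    show "U = V" using le[OF U V(1)] le[OF V U(1)] by (metis order_antisym)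
  qed
  show ?thesis using V(1) top uniq by blast
qed

text \<open>With A, B, L, M the indicators of negative \<open>a\<close>, \<open>b\<close>,
  \<open>l\<close>, \<open>m\<close>, the equation says (A - L) * (B - M) = 0: either
  \<open>a\<close> and \<open>l\<close>, or \<open>b\<close> and \<open>m\<close>, agree in sign. A
  positive \<open>l * a + m * b\<close> has a positive summand, which gives this.\<close>

lemma planar_flags:
  fixes l m a b :: real
  assumes "l * a + m * b > 0" "l \<noteq> 0" "m \<noteq> 0" "a \<noteq> 0" "b \<noteq> 0"
  shows "of_bool (\<not> a > 0) * of_bool (\<not> b > 0) + of_bool (\<not> m > 0) * of_bool (\<not> l > 0)
    = of_bool (\<not> a > 0) * of_bool (\<not> m > 0) + (of_bool (\<not> b > 0) * of_bool (\<not> l > 0) :: real)"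
proof -
  have 1: "l * a > 0 \<or> m * b > 0" using assms(1) by linarith
  show ?thesis
    using 1 assms(2-) by (cases "l > 0"; cases "m > 0"; cases "a > 0"; cases "b > 0")
      (auto simp: zero_less_mult_iff)
qed

lemma sum_of_bool_ex1:
  assumes "finite X" "\<exists>!x. x \<in> X \<and> Q x"
  shows "(\<Sum>x\<in>X. of_bool (Q x)) = (1::real)"
proof -
  obtain t where t: "t \<in> X" "\<And>x. x \<in> X \<Longrightarrow> Q x \<longleftrightarrow> x = t" using assms(2) by (elim ex1E) blast
  then have "(\<Sum>x\<in>X. of_bool (Q x)) = (\<Sum>x\<in>X. if x = t then 1 else (0::real))"
    by (intro sum.cong) auto
  then show ?thesis using t assms(1) by simp
qed

lemma sum_of_bool_card: "finite X \<Longrightarrow> (\<Sum>x\<in>X. of_bool (Q x)) = real (card {x \<in> X. Q x})"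
  by (simp add: of_bool_def sum.If_cases Int_def)

text \<open>A pair codes the affine function \<open>fst z + t * snd z\<close> of the time
  \<open>t\<close>; \<open>T\<close> is the least zero among the decreasing ones.\<close>

lemma first_exit:
  fixes Z :: "(real \<times> real) set"
  assumes fin: "finite Z" and pos: "\<And>z. z \<in> Z \<Longrightarrow> fst z > 0" and ex: "z0 \<in> Z" "snd z0 < 0"
  obtains T z where "T > 0" "\<And>z t. z \<in> Z \<Longrightarrow> 0 \<le> t \<Longrightarrow> t < T \<Longrightarrow> fst z + t * snd z > 0"
    "z \<in> Z" "fst z + T * snd z = 0"
proof -
  let ?N = "{z \<in> Z. snd z < 0}"
  let ?f = "\<lambda>z. fst z / (- snd z)"
  have "z0 \<in> ?N" using ex by simp
  then have "?N \<noteq> {}" by blast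
  moreover have "finite ?N" using fin by simp
  ultimately have N: "finite ?N" "?N \<noteq> {}" by simp_all
  define T where "T = Min (?f ` ?N)"
  have "T \<in> ?f ` ?N" unfolding T_def using N by (intro Min_in) auto
  then obtain z where z: "z \<in> Z" "snd z < 0" "T = fst z / (- snd z)" by auto
  have T: "T > 0" using z pos by (simp add: divide_pos_neg)
  have "fst z + t * snd z > 0" if zZ: "z \<in> Z" and t: "0 \<le> t" "t < T" for z t
  proof (cases "snd z < 0")
    case True
    then have "T \<le> fst z / (- snd z)" unfolding T_def using N zZ by (intro Min_le) auto
    then have "t < fst z / (- snd z)" using t by simp
    then show ?thesis using True by (simp add: field_simps)
  next
    case False
    then have "t * snd z \<ge> 0" using t by simp
    then show ?thesis using pos[OF zZ] by linarith
  qed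
  moreover have "fst z + T * snd z = 0" using z by simp
  ultimately show ?thesis by (rule that[OF T _ z(1)])
qed

lemma eventually_at_left_affine_pos:
  fixes a b T :: real
  assumes "a + T * b > 0"
  shows "eventually (\<lambda>t. a + t * b > 0) (at_left T)"
proof -
  have "((\<lambda>t. a + t * b) \<longlongrightarrow> a + T * b) (at_left T)" by (intro tendsto_intros)
  then show ?thesis using assms by (rule order_tendstoD)
qed

text \<open>A root at \<open>T\<close> itself does no harm, as a nonconstant affine function has no
  second one.\<close>

lemma eventually_at_left_affine_nonzero:
  fixes a b T :: real
  assumes "b \<noteq> 0"
  shows "eventually (\<lambda>t. a + t * b \<noteq> 0) (at_left T)"
proof (cases "a + T * b = 0")
  case True
  have "a + t * b \<noteq> 0" if "t < T" for t
  proof -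
    have "a + t * b = (t - T) * b" using True by (simp add: algebra_simps)
    then show ?thesis using that assms by simp
  qed
  then show ?thesis by (auto simp: eventually_at_filter)
next
  case False
  have "((\<lambda>t. a + t * b) \<longlongrightarrow> a + T * b) (at_left T)" by (intro tendsto_intros)
  then show ?thesis using False by (rule tendsto_imp_eventually_ne)
qed

lemma eventually_at_left_range:
  fixes T :: real
  assumes "T > 0" "\<And>t. 0 < t \<Longrightarrow> t < T \<Longrightarrow> Q t"
  shows "eventually Q (at_left T)"
  using eventually_at_left_real[OF assms(1)] by (rule eventually_mono) (use assms(2) in auto)

lemma affine_nonneg_at_end:
  fixes a b T :: real
  assumes "T > 0" "\<And>t. 0 < t \<Longrightarrow> t < T \<Longrightarrow> a + t * b > 0"
  shows "a + T * b \<ge> 0"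
proof (rule tendsto_lowerbound)
  show "((\<lambda>t. a + t * b) \<longlongrightarrow> a + T * b) (at_left T)" by (intro tendsto_intros)
  show "eventually (\<lambda>t. 0 \<le> a + t * b) (at_left T)"
    by (rule eventually_at_left_range[OF assms(1)]) (use assms(2) in force)
qed simp

section \<open>The type of a trihedral angle\<close>

definition dual_frame :: "real^3 \<Rightarrow> real^3 \<Rightarrow> real^3 \<Rightarrow> real^3 \<Rightarrow> real^3 \<Rightarrow> real^3 \<Rightarrow> bool" where
  "dual_frame n1 n2 n3 d1 d2 d3 \<longleftrightarrow> n1 \<bullet> n1 = 1 \<and> n2 \<bullet> n2 = 1 \<and> n3 \<bullet> n3 = 1 \<and>
     n1 \<bullet> d1 > 0 \<and> n1 \<bullet> d2 = 0 \<and> n1 \<bullet> d3 = 0 \<and> n2 \<bullet> d1 = 0 \<and> n2 \<bullet> d2 > 0 \<and> n2 \<bullet> d3 = 0 \<and>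
     n3 \<bullet> d1 = 0 \<and> n3 \<bullet> d2 = 0 \<and> n3 \<bullet> d3 > 0"

text \<open>The unit vectors \<open>n1, n2, n3\<close> are inner normals of the facets of a trihedral cone with edge
  directions \<open>d1, d2, d3\<close>. The first group of conditions puts \<open>x\<close> in the interior of the cone, the
  other ones make all flags of faces through the apex positive.\<close>

definition all_active :: "real^3 \<Rightarrow> real^3 \<Rightarrow> real^3 \<Rightarrow> real^3 \<Rightarrow> real^3 \<Rightarrow> real^3 \<Rightarrow> real^3 \<Rightarrow> bool" where
  "all_active n1 n2 n3 d1 d2 d3 x \<longleftrightarrow>
     (n1 \<bullet> x > 0 \<and> n2 \<bullet> x > 0 \<and> n3 \<bullet> x > 0) \<and> (x \<bullet> d1 > 0 \<and> x \<bullet> d2 > 0 \<and> x \<bullet> d3 > 0) \<and>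
     (n1 \<bullet> x - (n2 \<bullet> x) * (n1 \<bullet> n2) > 0 \<and> n1 \<bullet> x - (n3 \<bullet> x) * (n1 \<bullet> n3) > 0 \<and>
      n2 \<bullet> x - (n1 \<bullet> x) * (n2 \<bullet> n1) > 0 \<and> n2 \<bullet> x - (n3 \<bullet> x) * (n2 \<bullet> n3) > 0 \<and>
      n3 \<bullet> x - (n1 \<bullet> x) * (n3 \<bullet> n1) > 0 \<and> n3 \<bullet> x - (n2 \<bullet> x) * (n3 \<bullet> n2) > 0)"

lemma dual_frame_rot: "dual_frame n1 n2 n3 d1 d2 d3 \<Longrightarrow> dual_frame n2 n3 n1 d2 d3 d1"
  unfolding dual_frame_def by simp

lemma all_active_rot: "all_active n2 n3 n1 d2 d3 d1 x \<longleftrightarrow> all_active n1 n2 n3 d1 d2 d3 x"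
  unfolding all_active_def by auto

lemma open_all_active: "open {x. all_active n1 n2 n3 d1 d2 d3 x}"
  unfolding all_active_def by (intro open_Collect_conj open_Collect_less continuous_intros)

text \<open>The vector \<open>d1\<close> tells \<open>n1\<close> from every multiple of
  \<open>n2\<close>, so Cauchy-Schwarz is strict.\<close>

lemma dual_frame_cos:
  assumes "dual_frame n1 n2 n3 d1 d2 d3"
  shows "(n1 \<bullet> n2)\<^sup>2 < 1"
proof -
  define c where "c = n1 \<bullet> n2"
  have "(n1 - c *\<^sub>R n2) \<bullet> d1 \<noteq> 0" using assms by (simp add: dual_frame_def inner_diff_left)
  then have "n1 - c *\<^sub>R n2 \<noteq> 0" by auto
  then have "(n1 - c *\<^sub>R n2) \<bullet> (n1 - c *\<^sub>R n2) > 0" by simp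
  also have "(n1 - c *\<^sub>R n2) \<bullet> (n1 - c *\<^sub>R n2) = 1 - c\<^sup>2"
    using assms by (simp add: dual_frame_def c_def inner_diff_left inner_diff_right inner_commute power2_eq_square)
  finally show ?thesis by (simp add: c_def)
qed

text \<open>The projections \<open>r\<close>, \<open>s\<close> of \<open>n2\<close>, \<open>n3\<close> to the plane of \<open>d2\<close> and \<open>d3\<close> are orthogonal to \<open>d3\<close>, \<open>d2\<close>.\<close>

lemma dual_frame_edges:
  assumes df: "dual_frame n1 n2 n3 d1 d2 d3"
  obtains k where "k > 0" "d2 \<bullet> d3 = k * ((n1 \<bullet> n2) * (n1 \<bullet> n3) - n2 \<bullet> n3)"
    "((n1 \<bullet> n2) * (n1 \<bullet> n3) - n2 \<bullet> n3)\<^sup>2 < (1 - (n1 \<bullet> n2)\<^sup>2) * (1 - (n1 \<bullet> n3)\<^sup>2)"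
proof -
  define b c where "b = n1 \<bullet> n2" and "c = n1 \<bullet> n3"
  note d = df[unfolded dual_frame_def]
  have b1: "1 - b\<^sup>2 > 0" using dual_frame_cos[OF df] by (simp add: b_def)
  have c1: "1 - c\<^sup>2 > 0" using dual_frame_cos[OF dual_frame_rot[OF dual_frame_rot[OF df]]]
    by (simp add: c_def inner_commute)
  define r s where "r = n2 - b *\<^sub>R n1" and "s = n3 - c *\<^sub>R n1"
  define a where "a = b * c - n2 \<bullet> n3"
  have rr: "r \<bullet> r = 1 - b\<^sup>2" "s \<bullet> s = 1 - c\<^sup>2" "r \<bullet> s = - a"
    using d by (simp_all add: r_def s_def a_def b_def c_def inner_diff_left inner_diff_right
        inner_commute[of n2 n1] inner_commute[of n3 n1] power2_eq_square)
  have n1r: "n1 \<bullet> r = 0" "n2 \<bullet> r = 1 - b\<^sup>2" "n3 \<bullet> r = - a"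
    using d by (simp_all add: r_def a_def b_def c_def inner_diff_right inner_commute[of n3 n1] inner_commute[of n3 n2] inner_commute[of n2 n1] power2_eq_square)
  have rd: "r \<bullet> d3 = 0" "s \<bullet> d2 = 0" "r \<bullet> d2 = n2 \<bullet> d2" using d by (simp_all add: r_def s_def inner_diff_left)
  \<comment> \<open>Expanding \<open>r\<close> in the edge vectors and pairing with
    \<open>d3\<close>, to which \<open>r\<close> is orthogonal, ties \<open>d2 \<bullet> d3\<close>
    to \<open>d3 \<bullet> d3\<close>; the factor \<open>k\<close> comes from here.\<close>
  have "r = (n1 \<bullet> r / (n1 \<bullet> d1)) *\<^sub>R d1 + (n2 \<bullet> r / (n2 \<bullet> d2)) *\<^sub>R d2 + (n3 \<bullet> r / (n3 \<bullet> d3)) *\<^sub>R d3"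
    by (rule dual_basis_decomposition) (use d in simp_all)
  then have "r = ((1 - b\<^sup>2) / (n2 \<bullet> d2)) *\<^sub>R d2 + (- a / (n3 \<bullet> d3)) *\<^sub>R d3" unfolding n1r by simp
  then have "r \<bullet> d3 = (((1 - b\<^sup>2) / (n2 \<bullet> d2)) *\<^sub>R d2 + (- a / (n3 \<bullet> d3)) *\<^sub>R d3) \<bullet> d3"
    by (rule arg_cong[where f = "\<lambda>v. v \<bullet> d3"])
  then have "(1 - b\<^sup>2) / (n2 \<bullet> d2) * (d2 \<bullet> d3) = a / (n3 \<bullet> d3) * (d3 \<bullet> d3)"
    unfolding rd by (simp add: inner_diff_left)
  then have e: "d2 \<bullet> d3 = ((d3 \<bullet> d3) * (n2 \<bullet> d2) / ((n3 \<bullet> d3) * (1 - b\<^sup>2))) * a"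
    using b1 d by (simp add: field_simps)
  have "d3 \<noteq> 0" using d by auto
  then have k: "(d3 \<bullet> d3) * (n2 \<bullet> d2) / ((n3 \<bullet> d3) * (1 - b\<^sup>2)) > 0" using b1 d by simp
  \<comment> \<open>Strict Cauchy-Schwarz for \<open>r\<close> and \<open>s\<close>: up to the
    factor \<open>s \<bullet> s\<close>, \<open>v\<close> is the part of \<open>r\<close> orthogonal
    to \<open>s\<close>, and \<open>v \<bullet> d2 > 0\<close> shows that it is not zero.\<close>
  define v where "v = (s \<bullet> s) *\<^sub>R r - (r \<bullet> s) *\<^sub>R s"
  have "v \<bullet> d2 = (s \<bullet> s) * (n2 \<bullet> d2)" unfolding v_def inner_diff_left inner_scaleR_left rd by simp
  then have "v \<bullet> d2 > 0" using c1 d rr by simp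
  then have "v \<noteq> 0" by auto
  then have "v \<bullet> v > 0" by simp
  also have "v \<bullet> v = (s \<bullet> s) * ((r \<bullet> r) * (s \<bullet> s) - (r \<bullet> s)\<^sup>2)"
    by (simp add: v_def inner_diff_left inner_diff_right inner_commute[of s r] power2_eq_square algebra_simps)
  finally have "(r \<bullet> r) * (s \<bullet> s) - (r \<bullet> s)\<^sup>2 > 0" using c1 rr by (simp add: zero_less_mult_iff)
  then have "a\<^sup>2 < (1 - b\<^sup>2) * (1 - c\<^sup>2)" unfolding rr by simp
  then show ?thesis using that[OF k] e unfolding a_def b_def c_def by blast
qed

text \<open>A negative cosine between two normals makes their flag conditions automatic inside the
  cone. With all planar angles acute, the sum of the edge vectors has a positive product with each
  of them.\<close>

lemma active_direction_acute3:
  assumes df: "dual_frame n1 n2 n3 d1 d2 d3"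
    and "n1 \<bullet> n2 < 0" "n1 \<bullet> n3 < 0" "n2 \<bullet> n3 < 0" "d1 \<bullet> d2 > 0" "d1 \<bullet> d3 > 0" "d2 \<bullet> d3 > 0"
  shows "all_active n1 n2 n3 d1 d2 d3 (d1 + d2 + d3)"
proof -
  note d = df[unfolded dual_frame_def]
  have u: "n1 \<bullet> (d1 + d2 + d3) > 0" "n2 \<bullet> (d1 + d2 + d3) > 0" "n3 \<bullet> (d1 + d2 + d3) > 0"
    using d by (simp_all add: inner_add_right)
  have sq: "d1 \<bullet> d1 \<ge> 0" "d2 \<bullet> d2 \<ge> 0" "d3 \<bullet> d3 \<ge> 0" by simp_all
  have w: "(d1 + d2 + d3) \<bullet> d1 > 0" "(d1 + d2 + d3) \<bullet> d2 > 0" "(d1 + d2 + d3) \<bullet> d3 > 0"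
    unfolding inner_add_left inner_commute[of d2 d1] inner_commute[of d3 d1] inner_commute[of d3 d2]
    using assms(5-7) sq by linarith+
  have neg: "p - q * c > 0" if "p > 0" "q > 0" "c < 0" for p q c :: real
    using that mult_pos_neg[of q c] by linarith
  show ?thesis unfolding all_active_def
    using u w neg assms(2-4) by (simp add: inner_commute[of n2 n1] inner_commute[of n3 n1] inner_commute[of n3 n2])
qed

text \<open>The direction has heights \<open>M\<close>, 1, 1 over the three facets and so leans
  towards \<open>d1\<close>. Equal heights over the last two facets reduce their mutual flags to
  \<open>n2 \<bullet> n3 < 1\<close>; the other facet flags follow from the negative
  cosines.\<close>

lemma active_direction_acute2:
  assumes df: "dual_frame n1 n2 n3 d1 d2 d3"
    and c: "n1 \<bullet> n2 < 0" "n1 \<bullet> n3 < 0" and a: "d1 \<bullet> d2 > 0" "d1 \<bullet> d3 > 0"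
  obtains x where "all_active n1 n2 n3 d1 d2 d3 x"
proof -
  note d = df[unfolded dual_frame_def]
  have "(n2 \<bullet> n3)\<^sup>2 < 1" using dual_frame_cos[OF dual_frame_rot[OF df]] .
  then have c23: "n2 \<bullet> n3 < 1" by (metis less_eq_real_def linorder_not_less one_le_power)
  define p1 p2 p3 where "p1 = n1 \<bullet> d1" and "p2 = n2 \<bullet> d2" and "p3 = n3 \<bullet> d3"
  have p: "p1 > 0" "p2 > 0" "p3 > 0" using d by (simp_all add: p1_def p2_def p3_def)
  \<comment> \<open>Beyond these two quotients, \<open>M * (d1 \<bullet> d2 / p1)\<close> and
    \<open>M * (d1 \<bullet> d3 / p1)\<close> outweigh the terms with
    \<open>d2 \<bullet> d3\<close>, whose sign is unknown.\<close>
  define M where "M = 1 + \<bar>d2 \<bullet> d3\<bar> / p3 / (d1 \<bullet> d2 / p1) + \<bar>d2 \<bullet> d3\<bar> / p2 / (d1 \<bullet> d3 / p1)"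
  have q: "d1 \<bullet> d2 / p1 > 0" "d1 \<bullet> d3 / p1 > 0" using a p by simp_all
  have nn: "\<bar>d2 \<bullet> d3\<bar> / p3 / (d1 \<bullet> d2 / p1) \<ge> 0" "\<bar>d2 \<bullet> d3\<bar> / p2 / (d1 \<bullet> d3 / p1) \<ge> 0"
    using q p by (simp_all only: divide_nonneg_pos abs_ge_zero)
  have M: "M > 0" "M > \<bar>d2 \<bullet> d3\<bar> / p3 / (d1 \<bullet> d2 / p1)" "M > \<bar>d2 \<bullet> d3\<bar> / p2 / (d1 \<bullet> d3 / p1)"
    using nn unfolding M_def by linarith+
  have M2: "\<bar>d2 \<bullet> d3\<bar> / p3 < M * (d1 \<bullet> d2 / p1)" "\<bar>d2 \<bullet> d3\<bar> / p2 < M * (d1 \<bullet> d3 / p1)"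
    using M(2,3) unfolding pos_divide_less_eq[OF q(1)] pos_divide_less_eq[OF q(2)] by simp_all
  define x where "x = (M / p1) *\<^sub>R d1 + (1 / p2) *\<^sub>R d2 + (1 / p3) *\<^sub>R d3"
  have u: "n1 \<bullet> x = M" "n2 \<bullet> x = 1" "n3 \<bullet> x = 1"
    using d p by (simp_all add: x_def inner_add_right p1_def p2_def p3_def)
  have sq: "d1 \<bullet> d1 \<ge> 0" "d2 \<bullet> d2 / p2 \<ge> 0" "d3 \<bullet> d3 / p3 \<ge> 0" using p by simp_all
  have ab: "- (\<bar>d2 \<bullet> d3\<bar> / p3) \<le> (d2 \<bullet> d3) / p3" "- (\<bar>d2 \<bullet> d3\<bar> / p2) \<le> (d2 \<bullet> d3) / p2"
    using p by (simp_all add: field_simps abs_le_iff)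
  have "x \<bullet> d1 = M / p1 * (d1 \<bullet> d1) + (d1 \<bullet> d2) / p2 + (d1 \<bullet> d3) / p3"
    by (simp add: x_def inner_add_left inner_commute[of d2 d1] inner_commute[of d3 d1])
  moreover have "M / p1 * (d1 \<bullet> d1) \<ge> 0" "(d1 \<bullet> d2) / p2 > 0" "(d1 \<bullet> d3) / p3 > 0" using M p a by simp_all
  ultimately have w1: "x \<bullet> d1 > 0" by linarith
  have "x \<bullet> d2 = M * (d1 \<bullet> d2 / p1) + (d2 \<bullet> d2) / p2 + (d2 \<bullet> d3) / p3"
    by (simp add: x_def inner_add_left inner_commute[of d3 d2])
  then have w2: "x \<bullet> d2 > 0" using M2(1) sq(2) ab(1) by linarith
  have "x \<bullet> d3 = M * (d1 \<bullet> d3 / p1) + (d2 \<bullet> d3) / p2 + (d3 \<bullet> d3) / p3"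
    by (simp add: x_def inner_add_left)
  then have w3: "x \<bullet> d3 > 0" using M2(2) sq(3) ab(2) by linarith
  have Mc: "M * (n1 \<bullet> n2) < 0" "M * (n1 \<bullet> n3) < 0" using M(1) c by (simp_all add: mult_pos_neg)
  have "all_active n1 n2 n3 d1 d2 d3 x"
    unfolding all_active_def u inner_commute[of n2 n1] inner_commute[of n3 n1] inner_commute[of n3 n2]
    using w1 w2 w3 M(1) c c23 Mc by simp
  then show ?thesis by (rule that)
qed

text \<open>Here \<open>n1\<close> plays the role of the only facet whose planar angle may be acute; the weights
  \<open>\<alpha>\<close> bisect the angle of that facet.\<close>

lemma active_direction_obtuse:
  assumes df: "dual_frame n1 n2 n3 d1 d2 d3"
    and c: "n1 \<bullet> n2 > 0" "n1 \<bullet> n3 > 0"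
    and a: "(n1 \<bullet> n2) * (n2 \<bullet> n3) - n1 \<bullet> n3 < 0" "(n1 \<bullet> n3) * (n2 \<bullet> n3) - n1 \<bullet> n2 < 0"
  obtains x where "all_active n1 n2 n3 d1 d2 d3 x"
proof -
  note d = df[unfolded dual_frame_def]
  define b g e where "b = n1 \<bullet> n2" and "g = n1 \<bullet> n3" and "e = n2 \<bullet> n3"
  have b1: "1 - b\<^sup>2 > 0" using dual_frame_cos[OF df] by (simp add: b_def)
  have g1: "1 - g\<^sup>2 > 0" using dual_frame_cos[OF dual_frame_rot[OF dual_frame_rot[OF df]]]
    by (simp add: g_def inner_commute)
  have e1: "1 - e\<^sup>2 > 0" using dual_frame_cos[OF dual_frame_rot[OF df]] by (simp add: e_def)
  obtain k where "(b * g - e)\<^sup>2 < (1 - b\<^sup>2) * (1 - g\<^sup>2)"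
    using dual_frame_edges[OF df] unfolding b_def g_def e_def by metis
  then have "sqrt ((b * g - e)\<^sup>2) < sqrt ((1 - b\<^sup>2) * (1 - g\<^sup>2))" by (rule real_sqrt_less_mono)
  \<comment> \<open>These are the lengths of the projections of \<open>n3\<close> and
    \<open>n2\<close> to the plane orthogonal to \<open>n1\<close>. With each projection weighted by
    the length of the other one, the part of \<open>x\<close> in that plane bisects their angle, and
    \<open>21\<close> and \<open>31\<close> both reduce to \<open>lt\<close>.\<close>
  define \<alpha> \<beta> where "\<alpha> = sqrt (1 - g\<^sup>2)" and "\<beta> = sqrt (1 - b\<^sup>2)"
  have ab: "\<alpha> > 0" "\<beta> > 0" "\<alpha> * \<alpha> = 1 - g\<^sup>2" "\<beta> * \<beta> = 1 - b\<^sup>2" using b1 g1 by (simp_all add: \<alpha>_def \<beta>_def)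
  have lt: "b * g - e < \<beta> * \<alpha>"
    using \<open>sqrt ((b * g - e)\<^sup>2) < _\<close> by (simp add: real_sqrt_mult \<alpha>_def \<beta>_def)
  define x where "x = n1 + \<alpha> *\<^sub>R n2 + \<beta> *\<^sub>R n3"
  have u: "n1 \<bullet> x = 1 + \<alpha> * b + \<beta> * g" "n2 \<bullet> x = b + \<alpha> + \<beta> * e" "n3 \<bullet> x = g + \<alpha> * e + \<beta>"
    using d by (simp_all add: x_def b_def g_def e_def inner_add_right inner_commute)
  have w: "x \<bullet> d1 > 0" "x \<bullet> d2 > 0" "x \<bullet> d3 > 0"
    using d ab by (simp_all add: x_def inner_add_left)
  have pos: "b > 0" "g > 0" "b * e - g < 0" "g * e - b < 0" using c a by (simp_all add: b_def g_def e_def)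
  have "n1 \<bullet> x - (n2 \<bullet> x) * b = (1 - b\<^sup>2) - \<beta> * (b * e - g)"
    by (simp add: u algebra_simps power2_eq_square)
  then have 12: "n1 \<bullet> x - (n2 \<bullet> x) * b > 0" using b1 mult_pos_neg[OF ab(2) pos(3)] by linarith
  have "n1 \<bullet> x - (n3 \<bullet> x) * g = (1 - g\<^sup>2) - \<alpha> * (g * e - b)"
    by (simp add: u algebra_simps power2_eq_square)
  then have 13: "n1 \<bullet> x - (n3 \<bullet> x) * g > 0" using g1 mult_pos_neg[OF ab(1) pos(4)] by linarith
  have "n2 \<bullet> x - (n1 \<bullet> x) * b = \<alpha> * (1 - b\<^sup>2) - \<beta> * (b * g - e)"
    by (simp add: u algebra_simps power2_eq_square)
  also have "\<dots> = \<beta> * (\<beta> * \<alpha> - (b * g - e))" unfolding ab(4)[symmetric] by (simp add: algebra_simps)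
  also have "\<dots> > 0" using ab lt by simp
  finally have 21: "n2 \<bullet> x - (n1 \<bullet> x) * b > 0" .
  have "n3 \<bullet> x - (n1 \<bullet> x) * g = \<beta> * (1 - g\<^sup>2) - \<alpha> * (b * g - e)"
    by (simp add: u algebra_simps power2_eq_square)
  also have "\<dots> = \<alpha> * (\<beta> * \<alpha> - (b * g - e))" unfolding ab(3)[symmetric] by (simp add: algebra_simps)
  also have "\<dots> > 0" using ab lt by simp
  finally have 31: "n3 \<bullet> x - (n1 \<bullet> x) * g > 0" .
  have "n2 \<bullet> x - (n3 \<bullet> x) * e = \<alpha> * (1 - e\<^sup>2) - (g * e - b)"
    by (simp add: u algebra_simps power2_eq_square)
  then have 23: "n2 \<bullet> x - (n3 \<bullet> x) * e > 0" using pos(4) mult_pos_pos[OF ab(1) e1] by linarith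
  have "n3 \<bullet> x - (n2 \<bullet> x) * e = \<beta> * (1 - e\<^sup>2) - (b * e - g)"
    by (simp add: u algebra_simps power2_eq_square)
  then have 32: "n3 \<bullet> x - (n2 \<bullet> x) * e > 0" using pos(3) mult_pos_pos[OF ab(2) e1] by linarith
  have u1: "n1 \<bullet> x > 0" using ab pos by (simp add: u add_pos_pos)
  have "(n1 \<bullet> x) * b > 0" "(n1 \<bullet> x) * g > 0" using u1 pos by simp_all
  then have u23: "n2 \<bullet> x > 0" "n3 \<bullet> x > 0" using 21 31 by linarith+
  have "all_active n1 n2 n3 d1 d2 d3 x"
    unfolding all_active_def inner_commute[of n2 n1] inner_commute[of n3 n1] inner_commute[of n3 n2]
      b_def[symmetric] g_def[symmetric] e_def[symmetric]
    using u1 u23 w 12 13 21 31 23 32 by simp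
  then show ?thesis by (rule that)
qed

text \<open>The type of a vertex with no direction of full activity: the dihedral angle is obtuse only
  between the facets with normals \<open>n2\<close> and \<open>n3\<close>.\<close>

definition tame_type where
  "tame_type n1 n2 n3 d1 d2 d3 \<longleftrightarrow> n1 \<bullet> n2 < 0 \<and> n1 \<bullet> n3 < 0 \<and> n2 \<bullet> n3 > 0 \<and> d2 \<bullet> d3 < 0 \<and>
     (d1 \<bullet> d3 > 0 \<and> d1 \<bullet> d2 < 0 \<or> d1 \<bullet> d3 < 0 \<and> d1 \<bullet> d2 > (0::real))"

text \<open>By \<open>dual_frame_edges\<close>, the product of two edge vectors has the sign of an
  expression such as \<open>b * g - e\<close> in the cosines between the normals, so the proof is a
  discussion of the signs of \<open>b\<close>, \<open>g\<close>, \<open>e\<close>. A negative cosine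
  means an acute dihedral angle.\<close>

lemma tame_type_or_active:
  assumes df: "dual_frame n1 n2 n3 d1 d2 d3"
    and c: "n1 \<bullet> n2 \<noteq> 0" "n1 \<bullet> n3 \<noteq> 0" "n2 \<bullet> n3 \<noteq> 0"
    and a: "d1 \<bullet> d2 \<noteq> 0" "d1 \<bullet> d3 \<noteq> 0" "d2 \<bullet> d3 \<noteq> 0"
    and no: "\<And>x. \<not> all_active n1 n2 n3 d1 d2 d3 x"
  shows "tame_type n1 n2 n3 d1 d2 d3 \<or> tame_type n2 n3 n1 d2 d3 d1 \<or> tame_type n3 n1 n2 d3 d1 d2"
proof -
  note df2 = dual_frame_rot[OF df] and df3 = dual_frame_rot[OF dual_frame_rot[OF df]]
  have no2: "\<not> all_active n2 n3 n1 d2 d3 d1 x" and no3: "\<not> all_active n3 n1 n2 d3 d1 d2 x" for x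
    using no[of x] all_active_rot by blast+
  define b g e where "b = n1 \<bullet> n2" and "g = n1 \<bullet> n3" and "e = n2 \<bullet> n3"
  note ic = inner_commute[of n2 n1] inner_commute[of n3 n1] inner_commute[of n3 n2]
    inner_commute[of d2 d1] inner_commute[of d3 d1] inner_commute[of d3 d2]
  note fold = b_def[symmetric] g_def[symmetric] e_def[symmetric]
  obtain k1 where k1: "k1 > 0" "d2 \<bullet> d3 = k1 * (b * g - e)"
    using dual_frame_edges[OF df, unfolded ic fold] by metis
  obtain k2 where k2: "k2 > 0" "d1 \<bullet> d3 = k2 * (e * b - g)"
    using dual_frame_edges[OF df2, unfolded ic fold] by metis
  obtain k3 where k3: "k3 > 0" "d1 \<bullet> d2 = k3 * (g * e - b)"
    using dual_frame_edges[OF df3, unfolded ic fold] by metis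
  have sg: "d2 \<bullet> d3 > 0 \<longleftrightarrow> b * g - e > 0" "d1 \<bullet> d3 > 0 \<longleftrightarrow> e * b - g > 0" "d1 \<bullet> d2 > 0 \<longleftrightarrow> g * e - b > 0"
    unfolding k1(2) k2(2) k3(2) using k1(1) k2(1) k3(1) by (simp_all add: zero_less_mult_iff)
  have sgn: "d2 \<bullet> d3 < 0 \<longleftrightarrow> b * g - e < 0" "d1 \<bullet> d3 < 0 \<longleftrightarrow> e * b - g < 0" "d1 \<bullet> d2 < 0 \<longleftrightarrow> g * e - b < 0"
    unfolding k1(2) k2(2) k3(2) using k1(1) k2(1) k3(1) by (simp_all add: mult_less_0_iff)
  have nz: "b * g - e \<noteq> 0" "e * b - g \<noteq> 0" "g * e - b \<noteq> 0"
    using a k1 k2 k3 by auto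
  have sq: "b\<^sup>2 < 1" "g\<^sup>2 < 1" "e\<^sup>2 < 1"
    using dual_frame_cos[OF df] dual_frame_cos[OF df2] dual_frame_cos[OF df3]
    by (simp_all add: b_def g_def e_def inner_commute)
  have ne: "b \<noteq> 0" "g \<noteq> 0" "e \<noteq> 0" using c by (simp_all add: b_def g_def e_def)
  have no_obtuse: "\<not> (b > 0 \<and> g > 0 \<and> b * e - g < 0 \<and> g * e - b < 0)"
    "\<not> (e > 0 \<and> b > 0 \<and> e * g - b < 0 \<and> b * g - e < 0)"
    "\<not> (g > 0 \<and> e > 0 \<and> g * b - e < 0 \<and> e * b - g < 0)"
    using active_direction_obtuse[OF df, unfolded ic fold] active_direction_obtuse[OF df2, unfolded ic fold]
      active_direction_obtuse[OF df3, unfolded ic fold] no no2 no3 by metis+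
  note no_obtuse' = no_obtuse[unfolded mult.commute[of b e] mult.commute[of e g] mult.commute[of g b]]
  have no2': "\<not> (b < 0 \<and> g < 0 \<and> g * e - b > 0 \<and> e * b - g > 0)"
    "\<not> (e < 0 \<and> b < 0 \<and> b * g - e > 0 \<and> g * e - b > 0)"
    "\<not> (g < 0 \<and> e < 0 \<and> e * b - g > 0 \<and> b * g - e > 0)"
    using active_direction_acute2[OF df, unfolded ic fold sg] active_direction_acute2[OF df2, unfolded ic fold sg]
      active_direction_acute2[OF df3, unfolded ic fold sg] no no2 no3 by metis+
  have no3': "\<not> (b < 0 \<and> g < 0 \<and> e < 0)"
  proof
    assume n: "b < 0 \<and> g < 0 \<and> e < 0"
    then have "b * g > 0" "e * b > 0" "g * e > 0" by (simp_all add: mult_neg_neg)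
    then have "b * g - e > 0" "e * b - g > 0" "g * e - b > 0" using n by linarith+
    then show False using active_direction_acute3[OF df, unfolded fold sg] n no by blast
  qed
  \<comment> \<open>For positive cosines no two planar angles are acute, so two are obtuse and some
    rotation meets the hypotheses of \<open>active_direction_obtuse\<close>.\<close>
  have key: "x * y - z > 0 \<Longrightarrow> z * x - y > 0 \<Longrightarrow> x\<^sup>2 < 1 \<Longrightarrow> x > 0 \<Longrightarrow> y > 0 \<Longrightarrow> False" for x y z :: real
  proof -
    assume h: "x * y - z > 0" "z * x - y > 0" "x\<^sup>2 < 1" "x > 0" "y > 0"
    have "z * x < (x * y) * x" using h(1,4) by (intro mult_strict_right_mono) auto
    also have "\<dots> = x\<^sup>2 * y" by (simp add: power2_eq_square)
    also have "\<dots> < 1 * y" using h(3,5) by (intro mult_strict_right_mono) auto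
    finally show False using h(2) by simp
  qed
  \<comment> \<open>Two acute dihedral angles: the planar angle between their edges is then obtuse.
    Of the other two planar angles, both acute is what \<open>active_direction_acute2\<close>
    excludes, and both obtuse contradicts \<open>z\<^sup>2 < 1\<close>.\<close>
  have two: "x * y - z < 0 \<and> (z * x - y > 0 \<and> y * z - x < 0 \<or> z * x - y < 0 \<and> y * z - x > 0)"
    if h: "x < 0" "y < 0" "z > 0" "x\<^sup>2 < 1" "y\<^sup>2 < 1" "z\<^sup>2 < 1" "x * y - z \<noteq> 0" "z * x - y \<noteq> 0" "y * z - x \<noteq> 0"
      "\<not> (y * z - x > 0 \<and> z * x - y > 0)" for x y z :: real
  proof -
    define p q where "p = - x" and "q = - y"
    have pq: "p > 0" "q > 0" "p\<^sup>2 < 1" "q\<^sup>2 < 1" using h by (simp_all add: p_def q_def)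
    have 1: False if "p * q - z > 0"
    proof -
      have "z * p < (p * q) * p" using that pq by (intro mult_strict_right_mono) auto
      also have "\<dots> = p\<^sup>2 * q" by (simp add: power2_eq_square)
      also have "\<dots> < 1 * q" using pq by (intro mult_strict_right_mono) auto
      finally have zp: "z * p < q" by simp
      have "z * q < (p * q) * q" using that pq by (intro mult_strict_right_mono) auto
      also have "\<dots> = q\<^sup>2 * p" by (simp add: power2_eq_square)
      also have "\<dots> < 1 * p" using pq by (intro mult_strict_right_mono) auto
      finally have zq: "z * q < p" by simp
      show False using h(10) zp zq by (simp add: p_def q_def mult.commute)
    qed
    have 2: False if "q < z * p" "p < z * q"
    proof -
      have "z * p < z * (z * q)" using that(2) h(3) by simp
      also have "\<dots> = z\<^sup>2 * q" by (simp add: power2_eq_square)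
      also have "\<dots> < 1 * q" using pq h(6) by (intro mult_strict_right_mono) auto
      finally show False using that(1) by simp
    qed
    have "x * y - z < 0" using 1 h(7) by (force simp: p_def q_def)
    moreover have "\<not> (z * x - y < 0 \<and> y * z - x < 0)" using 2 by (auto simp: p_def q_def mult.commute)
    ultimately show ?thesis using h(8-10) by (auto simp: neq_iff)
  qed
  \<comment> \<open>With at most one acute dihedral angle (the first four cases)
    \<open>no_obtuse\<close> gives a contradiction; with exactly two (the last three) the type is
    tame; three are excluded by \<open>no3'\<close>.\<close>
  consider "b > 0" "g > 0" "e > 0" | "b < 0" "g > 0" "e > 0" | "b > 0" "g < 0" "e > 0" | "b > 0" "g > 0" "e < 0"
    | "b < 0" "g < 0" "e > 0" | "b < 0" "g > 0" "e < 0" | "b > 0" "g < 0" "e < 0"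
    using ne no3' unfolding neq_iff by blast
  then show ?thesis
  proof cases
    case 1
    then have "\<not> (b * g - e > 0 \<and> e * b - g > 0)" "\<not> (e * b - g > 0 \<and> g * e - b > 0)"
      "\<not> (g * e - b > 0 \<and> b * g - e > 0)"
      using key[of b g e] key[of e b g] key[of g e b] sq by blast+
    then show ?thesis using no_obtuse' nz 1 unfolding neq_iff by blast
  next
    case 2
    then have "b * g < 0" "e * b < 0" by (simp_all add: mult_neg_pos mult_pos_neg)
    then have "b * g - e < 0" "e * b - g < 0" using 2 by linarith+
    then show ?thesis using no_obtuse'(3) 2 by blast
  next
    case 3
    then have "b * g < 0" "g * e < 0" by (simp_all add: mult_neg_pos mult_pos_neg)
    then have "b * g - e < 0" "g * e - b < 0" using 3 by linarith+
    then show ?thesis using no_obtuse'(2) 3 by blast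
  next
    case 4
    then have "e * b < 0" "g * e < 0" by (simp_all add: mult_neg_pos mult_pos_neg)
    then have "e * b - g < 0" "g * e - b < 0" using 4 by linarith+
    then show ?thesis using no_obtuse'(1) 4 by blast
  next
    case 5
    then have "tame_type n1 n2 n3 d1 d2 d3" unfolding tame_type_def fold sg sgn
      using two[of b g e] sq nz no2'(1) by blast
    then show ?thesis by blast
  next
    case 6
    then have "tame_type n2 n3 n1 d2 d3 d1" unfolding tame_type_def ic fold sg sgn
      using two[of e b g] sq nz no2'(2) by blast
    then show ?thesis by blast
  next
    case 7
    then have "tame_type n3 n1 n2 d3 d1 d2" unfolding tame_type_def ic fold sg sgn
      using two[of g e b] sq nz no2'(3) by blast
    then show ?thesis by blast
  qed
qed

section \<open>Angles\<close>

lemma vec_angle_right: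
  assumes "u \<noteq> 0" "v \<noteq> 0"
  shows "vec_angle u v < pi / 2 \<longleftrightarrow> u \<bullet> v > 0" "vec_angle u v = pi / 2 \<longleftrightarrow> u \<bullet> v = 0"
proof -
  define t where "t = u \<bullet> v / (norm u * norm v)"
  have p: "norm u * norm v > 0" using assms by simp
  have "\<bar>u \<bullet> v\<bar> \<le> norm u * norm v" by (rule Cauchy_Schwarz_ineq2)
  then have t: "\<bar>t\<bar> \<le> 1" using p by (simp add: t_def abs_divide)
  have "arccos t < arccos 0 \<longleftrightarrow> 0 < t" using t by (intro arccos_less_mono) auto
  moreover have "arccos t = arccos 0 \<longleftrightarrow> t = 0" using t by (intro arccos_eq_iff) auto
  moreover have "0 < t \<longleftrightarrow> u \<bullet> v > 0" unfolding t_def pos_less_divide_eq[OF p] by simp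
  moreover have "t = 0 \<longleftrightarrow> u \<bullet> v = 0" using assms by (simp add: t_def)
  ultimately show "vec_angle u v < pi / 2 \<longleftrightarrow> u \<bullet> v > 0" "vec_angle u v = pi / 2 \<longleftrightarrow> u \<bullet> v = 0"
    by (simp_all add: vec_angle_def t_def)
qed

lemma vec_angle_scale: "a > 0 \<Longrightarrow> b > 0 \<Longrightarrow> vec_angle (a *\<^sub>R u) (b *\<^sub>R v) = vec_angle u v"
  by (simp add: vec_angle_def field_simps)

lemma vec_angle_commute: "vec_angle u v = vec_angle v u"
  by (simp add: vec_angle_def inner_commute mult.commute)

lemma orth_to_edge_segment:
  assumes "d \<noteq> 0"
  shows "orth_to_edge (closed_segment A (A + d)) p = (p - A) - ((p - A) \<bullet> d / (d \<bullet> d)) *\<^sub>R d"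
proof -
  define k where "k = (p - A) \<bullet> d / (d \<bullet> d)"
  define z where "z = A + k *\<^sub>R d"
  have hull: "affine hull (closed_segment A (A + d)) = affine hull {A, A + d}"
    unfolding segment_convex_hull by (rule affine_hull_convex_hull)
  have mem: "A + m *\<^sub>R d \<in> affine hull {A, A + d}" for m
    unfolding affine_hull_2 by (rule CollectI, rule exI[of _ "1 - m"], rule exI[of _ m]) (simp add: algebra_simps)
  have o: "(p - z) \<bullet> d = 0"
    using assms by (simp add: z_def k_def inner_diff_left inner_add_left)
  have "z = closest_point (affine hull {A, A + d}) p"
  proof (rule closest_point_unique)
    show "z \<in> affine hull {A, A + d}" unfolding z_def by (rule mem)
    show "\<forall>w\<in>affine hull {A, A + d}. dist p z \<le> dist p w"
    proof
      fix w assume "w \<in> affine hull {A, A + d}"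
      then obtain u v where uv: "u + v = 1" "w = u *\<^sub>R A + v *\<^sub>R (A + d)" unfolding affine_hull_2 by blast
      have "u *\<^sub>R A + v *\<^sub>R (A + d) = (u + v) *\<^sub>R A + v *\<^sub>R d" by (simp add: algebra_simps)
      then have w: "w = A + v *\<^sub>R d" using uv by simp
      have "p - w = (p - z) + (k - v) *\<^sub>R d" by (simp add: w z_def algebra_simps)
      then have "(norm (p - w))\<^sup>2 = (norm (p - z))\<^sup>2 + (norm ((k - v) *\<^sub>R d))\<^sup>2"
        using o by (simp only: power2_norm_eq_inner inner_add_left inner_add_right inner_scaleR_left
            inner_scaleR_right inner_commute[of d "p - z"]) simp
      then have "(norm (p - z))\<^sup>2 \<le> (norm (p - w))\<^sup>2" by simp
      then have "norm (p - z) \<le> norm (p - w)" by (simp add: power2_le_iff_abs_le)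
      then show "dist p z \<le> dist p w" by (simp add: dist_norm)
    qed
  qed (simp_all add: affine_imp_convex)
  then have "orth_to_edge (closed_segment A (A + d)) p = p - z" unfolding orth_to_edge_def hull by simp
  then show ?thesis by (simp add: z_def k_def)
qed

section \<open>Simple polytopes in space\<close>

locale simple3 =
  fixes P :: "(real^3) set"
  assumes simple: "simple_polytope P"
begin

definition Vs where "Vs = {V. V extreme_point_of P}"
definition Es where "Es = {E. E edge_of P}"
definition Fs where "Fs = {F. F facet_of P}"

abbreviation "edges_at V \<equiv> {E \<in> Es. V \<in> E}"
abbreviation "facets_at V \<equiv> {F \<in> Fs. V \<in> F}"
abbreviation "facet_edges_at F V \<equiv> {E \<in> Es. V \<in> E \<and> E \<subseteq> F}"
abbreviation "vertices_in X \<equiv> {V \<in> Vs. V \<in> X}"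
abbreviation "facets_over E \<equiv> {F \<in> Fs. E \<subseteq> F}"


lemma polytope: "polytope P" and int_ne: "interior P \<noteq> {}"
  using simple by (auto simp: simple_polytope_def)

lemma compact: "compact P" and convex: "convex P"
  using polytope polytope_imp_compact polytope_imp_convex by auto

lemma aff_dim_P: "aff_dim P = 3"
  using int_ne aff_dim_nonempty_interior[of P] by simp

lemma finite_faces: "finite {F. F face_of P}"
  using polytope finite_polytope_faces by blast

lemma finite_Vs: "finite Vs"
  unfolding Vs_def using finite_polyhedron_extreme_points polytope polytope_imp_polyhedron by blast

lemma finite_Es: "finite Es"
  unfolding Es_def by (rule finite_subset[OF _ finite_faces]) (auto simp: edge_of_def)

lemma finite_Fs: "finite Fs"
  unfolding Fs_def by (rule finite_subset[OF _ finite_faces]) (auto simp: facet_of_def)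

lemma facet_dim: "F \<in> Fs \<Longrightarrow> aff_dim F = 2"
  by (simp add: Fs_def facet_of_def aff_dim_P)

lemma facet_face: "F \<in> Fs \<Longrightarrow> F face_of P"
  by (simp add: Fs_def facet_of_def)

lemma facet_subset: "F \<in> Fs \<Longrightarrow> F \<subseteq> P"
  using facet_face face_of_imp_subset by blast

lemma facet_iff: "F \<in> Fs \<longleftrightarrow> F face_of P \<and> aff_dim F = 2"
  by (auto simp: Fs_def facet_of_def aff_dim_P)

text \<open>\<open>hgt F y\<close> is the signed distance of \<open>y\<close> to the plane of \<open>F\<close>, whichever point \<open>p\<close> of \<open>F\<close> is chosen.\<close>

definition nrm :: "(real^3) set \<Rightarrow> real^3" where
  "nrm F = (SOME n. norm n = 1 \<and> (\<exists>b. P \<subseteq> {x. n \<bullet> x \<ge> b} \<and> F = P \<inter> {x. n \<bullet> x = b}))"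

definition hgt :: "(real^3) set \<Rightarrow> real^3 \<Rightarrow> real" where
  "hgt F y = nrm F \<bullet> (y - (SOME p. p \<in> F))"

lemma nrm_aux:
  assumes "F \<in> Fs"
  shows "norm (nrm F) = 1" "\<exists>b. P \<subseteq> {x. nrm F \<bullet> x \<ge> b} \<and> F = P \<inter> {x. nrm F \<bullet> x = b}"
proof -
  obtain a b where ab: "a \<noteq> 0" "P \<subseteq> {x. a \<bullet> x \<le> b}" "F = P \<inter> {x. a \<bullet> x = b}"
    using facet_of_polyhedron[of P F] assms polytope polytope_imp_polyhedron by (auto simp: Fs_def)
  define n where "n = (- 1 / norm a) *\<^sub>R a"
  have n: "norm n = 1" using ab by (simp add: n_def)
  have na: "n \<bullet> x = - (a \<bullet> x) / norm a" for x by (simp add: n_def)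
  have 2: "P \<subseteq> {x. n \<bullet> x \<ge> - b / norm a}" using ab by (auto simp: na divide_right_mono)
  have 3: "F = P \<inter> {x. n \<bullet> x = - b / norm a}" using ab by (auto simp: na)
  have "\<exists>n. norm n = 1 \<and> (\<exists>b. P \<subseteq> {x. n \<bullet> x \<ge> b} \<and> F = P \<inter> {x. n \<bullet> x = b})"
    using n 2 3 by blast
  from someI_ex[OF this, folded nrm_def]
  show "norm (nrm F) = 1" "\<exists>b. P \<subseteq> {x. nrm F \<bullet> x \<ge> b} \<and> F = P \<inter> {x. nrm F \<bullet> x = b}"
    by auto
qed

lemma facet_ne: "F \<in> Fs \<Longrightarrow> F \<noteq> {}"
  using facet_dim by fastforce

lemma nrm_ne: "F \<in> Fs \<Longrightarrow> nrm F \<noteq> 0"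
  using nrm_aux(1) by fastforce

lemma nrm_sq: "F \<in> Fs \<Longrightarrow> nrm F \<bullet> nrm F = 1"
  using nrm_aux(1)[of F] by (simp add: dot_square_norm)

lemma
  assumes "F \<in> Fs"
  shows hgt_nonneg: "p \<in> P \<Longrightarrow> hgt F p \<ge> 0"
    and mem_facet_iff: "p \<in> F \<longleftrightarrow> p \<in> P \<and> hgt F p = 0"
proof -
  obtain b where b: "P \<subseteq> {x. nrm F \<bullet> x \<ge> b}" "F = P \<inter> {x. nrm F \<bullet> x = b}"
    using nrm_aux[OF assms] by blast
  have "(SOME p. p \<in> F) \<in> F" using facet_ne[OF assms] by (simp add: some_in_eq)
  then have "nrm F \<bullet> (SOME p. p \<in> F) = b" using b by blast
  then have "hgt F y = nrm F \<bullet> y - b" for y by (simp add: hgt_def inner_diff_right)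
  then show "p \<in> P \<Longrightarrow> hgt F p \<ge> 0" "p \<in> F \<longleftrightarrow> p \<in> P \<and> hgt F p = 0" using b by auto
qed

lemma hgt_diff: "hgt F x - hgt F y = nrm F \<bullet> (x - y)"
  by (simp add: hgt_def inner_diff_right)

lemma hgt_eq: "F \<in> Fs \<Longrightarrow> p \<in> F \<Longrightarrow> hgt F x = nrm F \<bullet> (x - p)"
  using hgt_diff[of F x p] mem_facet_iff[of F p] by simp

lemma hgt_add: "hgt F (x + v) = hgt F x + nrm F \<bullet> v"
  by (simp add: hgt_def inner_diff_right inner_add_right)

lemma hgt_pos:
  assumes "F \<in> Fs" "y \<in> interior P"
  shows "hgt F y > 0"
proof -
  have "y \<in> P" using assms interior_subset by blast
  moreover have "y \<notin> F"
    using face_of_disjoint_interior[OF facet_face[OF assms(1)]] assms facet_dim aff_dim_P by fastforce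
  ultimately show ?thesis using hgt_nonneg[OF assms(1)] mem_facet_iff[OF assms(1)] by fastforce
qed

lemma interior_iff: "y \<in> interior P \<longleftrightarrow> y \<in> P \<and> (\<forall>F\<in>Fs. y \<notin> F)"
proof -
  have "interior P = rel_interior P"
    using int_ne by (simp add: interior_rel_interior_gen rel_interior_nonempty_interior)
  then show ?thesis
    using rel_interior_of_polyhedron[of P] polytope polytope_imp_polyhedron by (auto simp: Fs_def)
qed

text \<open>A segment from an interior point to a point outside crosses the frontier in some facet,
  where the height is 0. But heights are affine, positive at the start and non-negative at the
  end.\<close>

lemma mem_P_iff: "y \<in> P \<longleftrightarrow> (\<forall>F\<in>Fs. hgt F y \<ge> 0)"
proof
  assume y: "\<forall>F\<in>Fs. hgt F y \<ge> 0"
  obtain q where q: "q \<in> interior P" using int_ne by blast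
  show "y \<in> P"
  proof (rule ccontr)
    assume "y \<notin> P"
    then have "closed_segment q y \<inter> frontier P \<noteq> {}"
      using q interior_subset by (intro connected_Int_frontier) auto
    then obtain z where z: "z \<in> closed_segment q y" "z \<in> frontier P" by blast
    have zP: "z \<in> P" "z \<notin> interior P"
      using z compact_imp_closed[OF compact] by (auto simp: frontier_def)
    then obtain F where F: "F \<in> Fs" "z \<in> F" using interior_iff by blast
    obtain t where t: "0 \<le> t" "t \<le> 1" "z = (1 - t) *\<^sub>R q + t *\<^sub>R y"
      using z by (auto simp: in_segment)
    have "t \<noteq> 1" using t zP \<open>y \<notin> P\<close> by auto
    have z': "z = q + t *\<^sub>R (y - q)" using t by (simp add: algebra_simps)
    have "hgt F z = hgt F q + t * (hgt F y - hgt F q)"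
      by (simp add: z' hgt_add hgt_diff)
    also have "\<dots> = (1 - t) * hgt F q + t * hgt F y" by (simp add: algebra_simps)
    finally have "hgt F z = (1 - t) * hgt F q + t * hgt F y" .
    moreover have "(1 - t) * hgt F q > 0" using t \<open>t \<noteq> 1\<close> hgt_pos F q by simp
    moreover have "t * hgt F y \<ge> 0" using t y F by simp
    ultimately show False using mem_facet_iff[OF F(1)] F(2) by simp
  qed
qed (auto simp: hgt_nonneg)

lemma mem_interior_iff: "y \<in> interior P \<longleftrightarrow> (\<forall>F\<in>Fs. hgt F y > 0)"
  using interior_iff mem_P_iff mem_facet_iff hgt_pos by (metis less_eq_real_def order_less_irrefl)

text \<open>A frame at \<open>V\<close>: the other ends \<open>W\<^sub>i\<close> of the three edges at \<open>V\<close>, and the three facets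
  at \<open>V\<close>, where \<open>F\<^sub>i\<close> is opposite to \<open>W\<^sub>i\<close>.\<close>

definition frame where
  "frame V W1 W2 W3 F1 F2 F3 \<longleftrightarrow> V \<in> Vs \<and>
     edges_at V = {closed_segment V W1, closed_segment V W2, closed_segment V W3} \<and>
     facets_at V = {F1, F2, F3} \<and>
     nrm F1 \<bullet> (W1 - V) > 0 \<and> nrm F1 \<bullet> (W2 - V) = 0 \<and> nrm F1 \<bullet> (W3 - V) = 0 \<and>
     nrm F2 \<bullet> (W1 - V) = 0 \<and> nrm F2 \<bullet> (W2 - V) > 0 \<and> nrm F2 \<bullet> (W3 - V) = 0 \<and>
     nrm F3 \<bullet> (W1 - V) = 0 \<and> nrm F3 \<bullet> (W2 - V) = 0 \<and> nrm F3 \<bullet> (W3 - V) > 0"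

lemma frame_rot: "frame V W1 W2 W3 F1 F2 F3 \<Longrightarrow> frame V W2 W3 W1 F2 F3 F1"
  unfolding frame_def by auto

lemma frame_swap: "frame V W1 W2 W3 F1 F2 F3 \<Longrightarrow> frame V W1 W3 W2 F1 F3 F2"
  unfolding frame_def by auto

section \<open>Edges and facets at a vertex\<close>

lemma edge_face: "E \<in> Es \<Longrightarrow> E face_of P"
  by (simp add: Es_def edge_of_def)

lemma edge_subset: "E \<in> Es \<Longrightarrow> E \<subseteq> P"
  using edge_face face_of_imp_subset by blast

lemma vertex_mem: "V \<in> Vs \<Longrightarrow> V \<in> P"
  by (simp add: Vs_def extreme_point_of_def)

lemma edge_segment:
  assumes "E \<in> Es" "V \<in> Vs" "V \<in> E"
  obtains W where "W \<noteq> V" "E = closed_segment V W" "W \<in> Vs"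
proof -
  obtain A B where AB: "A \<noteq> B" "E = closed_segment A B" "A \<in> Vs" "B \<in> Vs"
    using edge_of_polytope_segment[OF polytope, of E] assms(1) by (auto simp: Es_def Vs_def)
  have "V extreme_point_of E"
    using extreme_point_of_face[OF edge_face[OF assms(1)]] assms by (simp add: Vs_def)
  then have "V = A \<or> V = B" by (simp add: AB extreme_point_of_segment)
  then show ?thesis using AB that closed_segment_commute by metis
qed

text \<open>A provisional frame: the cone of the three edges contains \<open>P\<close>, while the
  facets at \<open>V\<close> are still to be constructed from it.\<close>

definition cone3 where
  "cone3 V W1 W2 W3 \<longleftrightarrow> V \<in> Vs \<and> W1 \<in> P \<and> W2 \<in> P \<and> W3 \<in> P \<and>
     edges_at V = {closed_segment V W1, closed_segment V W2, closed_segment V W3} \<and>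
     (\<forall>p\<in>P. \<exists>c1 c2 c3. c1 \<ge> 0 \<and> c2 \<ge> 0 \<and> c3 \<ge> 0 \<and>
        p - V = c1 *\<^sub>R (W1 - V) + c2 *\<^sub>R (W2 - V) + c3 *\<^sub>R (W3 - V))"

lemma cone3D:
  assumes "cone3 V W1 W2 W3" "p \<in> P"
  obtains c1 c2 c3 where "c1 \<ge> 0" "c2 \<ge> 0" "c3 \<ge> 0"
    "p - V = c1 *\<^sub>R (W1 - V) + c2 *\<^sub>R (W2 - V) + c3 *\<^sub>R (W3 - V)"
  using assms unfolding cone3_def by meson

lemma cone3_rot: "cone3 V W1 W2 W3 \<Longrightarrow> cone3 V W2 W3 W1"
proof -
  assume *: "cone3 V W1 W2 W3"
  have "\<exists>c1 c2 c3. c1 \<ge> 0 \<and> c2 \<ge> 0 \<and> c3 \<ge> 0 \<and>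
        p - V = c1 *\<^sub>R (W2 - V) + c2 *\<^sub>R (W3 - V) + c3 *\<^sub>R (W1 - V)" if "p \<in> P" for p
  proof -
    obtain c1 c2 c3 where "c1 \<ge> 0" "c2 \<ge> 0" "c3 \<ge> 0"
        "p - V = c1 *\<^sub>R (W1 - V) + c2 *\<^sub>R (W2 - V) + c3 *\<^sub>R (W3 - V)"
      using cone3D[OF * \<open>p \<in> P\<close>] by metis
    then show ?thesis by (intro exI[of _ c2] exI[of _ c3] exI[of _ c1]) (simp add: algebra_simps)
  qed
  then show ?thesis using * unfolding cone3_def by auto
qed

lemma cone3_exists:
  assumes V: "V \<in> Vs"
  obtains W1 W2 W3 where "cone3 V W1 W2 W3"
proof -
  have "card (edges_at V) = 3"
    using simple V by (simp add: simple_polytope_def Vs_def Es_def)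
  then obtain E1 E2 E3 where E: "edges_at V = {E1, E2, E3}"
    by (auto simp: card_Suc_eq numeral_3_eq_3)
  then have m: "E1 \<in> Es" "V \<in> E1" "E2 \<in> Es" "V \<in> E2" "E3 \<in> Es" "V \<in> E3" by auto
  obtain W1 where W1: "W1 \<noteq> V" "E1 = closed_segment V W1" "W1 \<in> Vs"
    using edge_segment[OF m(1) V m(2)] by blast
  obtain W2 where W2: "W2 \<noteq> V" "E2 = closed_segment V W2" "W2 \<in> Vs"
    using edge_segment[OF m(3) V m(4)] by blast
  obtain W3 where W3: "W3 \<noteq> V" "E3 = closed_segment V W3" "W3 \<in> Vs"
    using edge_segment[OF m(5) V m(6)] by blast
  define K where "K = {c1 *\<^sub>R (W1 - V) + c2 *\<^sub>R (W2 - V) + c3 *\<^sub>R (W3 - V) |c1 c2 c3.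
      c1 \<ge> 0 \<and> c2 \<ge> 0 \<and> c3 \<ge> (0::real)}"
  have KI: "c1 *\<^sub>R (W1 - V) + c2 *\<^sub>R (W2 - V) + c3 *\<^sub>R (W3 - V) \<in> K"
    if "c1 \<ge> 0" "c2 \<ge> 0" "c3 \<ge> 0" for c1 c2 c3
    using that unfolding K_def by blast
  have d: "W1 - V \<in> K" "W2 - V \<in> K" "W3 - V \<in> K" "0 \<in> K"
    using KI[of 1 0 0] KI[of 0 1 0] KI[of 0 0 1] KI[of 0 0 0] by auto
  have scale: "c *\<^sub>R k \<in> K" if c: "c \<ge> 0" and k: "k \<in> K" for c k
  proof -
    obtain c1 c2 c3 where "c1 \<ge> 0" "c2 \<ge> 0" "c3 \<ge> 0"
      "k = c1 *\<^sub>R (W1 - V) + c2 *\<^sub>R (W2 - V) + c3 *\<^sub>R (W3 - V)"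
      using k unfolding K_def by blast
    then show ?thesis using c KI[of "c * c1" "c * c2" "c * c3"] by (simp add: scaleR_add_right)
  qed
  have add: "k + l \<in> K" if k: "k \<in> K" and l: "l \<in> K" for k l
  proof -
    obtain c1 c2 c3 where 1: "c1 \<ge> 0" "c2 \<ge> 0" "c3 \<ge> 0"
      "k = c1 *\<^sub>R (W1 - V) + c2 *\<^sub>R (W2 - V) + c3 *\<^sub>R (W3 - V)"
      using k unfolding K_def by blast
    obtain b1 b2 b3 where 2: "b1 \<ge> 0" "b2 \<ge> 0" "b3 \<ge> 0"
      "l = b1 *\<^sub>R (W1 - V) + b2 *\<^sub>R (W2 - V) + b3 *\<^sub>R (W3 - V)"
      using l unfolding K_def by blast
    have "k + l = (c1 + b1) *\<^sub>R (W1 - V) + (c2 + b2) *\<^sub>R (W2 - V) + (c3 + b3) *\<^sub>R (W3 - V)"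
      by (simp only: 1 2 scaleR_add_left) simp
    then show ?thesis using KI 1 2 by simp
  qed
  have "convex K" unfolding convex_def using scale add by auto
  have "W - V \<in> K" if W: "W \<noteq> V" "closed_segment V W edge_of P" for W
  proof -
    have "closed_segment V W \<in> {E1, E2, E3}" using E that by (auto simp: Es_def)
    then have "W = W1 \<or> W = W2 \<or> W = W3"
      using W1 W2 W3 W by (auto simp: doubleton_eq_iff)
    then show ?thesis using d by auto
  qed
  then have pK: "p - V \<in> K" if "p \<in> P" for p
    using polytope_subset_vertex_cone[OF polytope _ \<open>convex K\<close> d(4) scale _ that] V
    by (auto simp: Vs_def)
  then have "cone3 V W1 W2 W3"
    unfolding cone3_def
  proof (intro conjI ballI)
    fix p assume "p \<in> P"
    then show "\<exists>c1 c2 c3. c1 \<ge> 0 \<and> c2 \<ge> 0 \<and> c3 \<ge> 0 \<and>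
        p - V = c1 *\<^sub>R (W1 - V) + c2 *\<^sub>R (W2 - V) + c3 *\<^sub>R (W3 - V)"
      using pK[of p] unfolding K_def mem_Collect_eq by metis
  qed (use V E W1 W2 W3 vertex_mem in simp_all)
  then show ?thesis using that by blast
qed

lemma cone3_no_orthogonal:
  assumes "cone3 V W1 W2 W3" "a \<bullet> (W1 - V) = 0" "a \<bullet> (W2 - V) = 0" "a \<bullet> (W3 - V) = 0"
  shows "a = 0"
proof (rule ccontr)
  assume "a \<noteq> 0"
  have "P \<subseteq> {x. a \<bullet> x = a \<bullet> V}"
  proof
    fix p assume "p \<in> P"
    then obtain c1 c2 c3 where "p - V = c1 *\<^sub>R (W1 - V) + c2 *\<^sub>R (W2 - V) + c3 *\<^sub>R (W3 - V)"
      using cone3D[OF assms(1) \<open>p \<in> P\<close>] by metis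
    then have "a \<bullet> (p - V) = 0" using assms by (simp add: inner_add_right)
    then show "p \<in> {x. a \<bullet> x = a \<bullet> V}" by (simp add: inner_diff_right)
  qed
  then have "aff_dim P \<le> aff_dim {x. a \<bullet> x = a \<bullet> V}" by (rule aff_dim_subset)
  then show False using aff_dim_P \<open>a \<noteq> 0\<close> by simp
qed

lemma cone3_independent:
  assumes c: "cone3 V W1 W2 W3"
    and z: "x *\<^sub>R (W1 - V) + y *\<^sub>R (W2 - V) + z *\<^sub>R (W3 - V) = 0"
  shows "x = 0"
proof (rule ccontr)
  assume "x \<noteq> 0"
  obtain n where n: "n \<noteq> 0" "n \<bullet> (W2 - V) = 0" "n \<bullet> (W3 - V) = 0"
    using common_orthogonal_vector by blast
  have "n \<bullet> (x *\<^sub>R (W1 - V) + y *\<^sub>R (W2 - V) + z *\<^sub>R (W3 - V)) = 0" using z by simp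
  then have "n \<bullet> (W1 - V) = 0" using n \<open>x \<noteq> 0\<close> by (simp only: inner_add_right inner_scaleR_right) simp
  then show False using cone3_no_orthogonal[OF c] n by blast
qed

text \<open>A vector orthogonal to two edges and positive on the third supports \<open>P\<close>,
  because \<open>P\<close> lies in the cone of the edges. The face it cuts out contains the
  non-collinear points \<open>V\<close>, \<open>W2\<close>, \<open>W3\<close> but not
  \<open>W1\<close>, hence is a facet.\<close>

lemma opposite_facet:
  assumes c: "cone3 V W1 W2 W3"
  obtains G where "G \<in> Fs" "V \<in> G" "nrm G \<bullet> (W1 - V) > 0" "nrm G \<bullet> (W2 - V) = 0" "nrm G \<bullet> (W3 - V) = 0"
proof -
  have VP: "V \<in> P" "W1 \<in> P" "W2 \<in> P" "W3 \<in> P" using c vertex_mem by (auto simp: cone3_def)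
  have ind: "x = 0 \<and> y = 0 \<and> z = 0"
    if "x *\<^sub>R (W1 - V) + y *\<^sub>R (W2 - V) + z *\<^sub>R (W3 - V) = 0" for x y z
    using cone3_independent[OF c, of x y z] cone3_independent[OF cone3_rot[OF c], of y z x]
      cone3_independent[OF cone3_rot[OF cone3_rot[OF c]], of z x y] that
    by (auto simp: algebra_simps)
  obtain N where N: "N \<bullet> (W1 - V) > 0" "N \<bullet> (W2 - V) = 0" "N \<bullet> (W3 - V) = 0"
    using normal_to_two[OF ind] by blast
  define G where "G = P \<inter> {x. N \<bullet> x = N \<bullet> V}"
  have ge: "N \<bullet> p \<ge> N \<bullet> V" if "p \<in> P" for p
  proof -
    obtain c1 c2 c3 where "c1 \<ge> 0" "p - V = c1 *\<^sub>R (W1 - V) + c2 *\<^sub>R (W2 - V) + c3 *\<^sub>R (W3 - V)"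
      using cone3D[OF c \<open>p \<in> P\<close>] by metis
    then have "N \<bullet> (p - V) \<ge> 0" using N by (simp add: inner_add_right)
    then show ?thesis by (simp add: inner_diff_right)
  qed
  have face: "G face_of P" unfolding G_def
    using face_of_Int_supporting_hyperplane_ge[OF convex] ge by blast
  have mem: "V \<in> G" "W2 \<in> G" "W3 \<in> G" "W1 \<notin> G"
    using VP N by (auto simp: G_def inner_diff_right)
  have "aff_dim G < 3"
    using face_of_aff_dim_lt[OF convex face] VP mem aff_dim_P by auto
  moreover have "\<not> collinear {W2, V, W3}"
  proof
    assume "collinear {W2, V, W3}"
    then consider "W2 - V = 0" | "W3 - V = 0" | k where "W3 - V = k *\<^sub>R (W2 - V)"
      using collinear_3[of W2 V W3] collinear_lemma[of "W2 - V" "W3 - V"] by auto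
    then show False
    proof cases
      case 1 then show False using ind[of 0 1 0] by simp
    next
      case 2 then show False using ind[of 0 0 1] by simp
    next
      case 3 then show False using ind[of 0 k "-1"] by simp
    qed
  qed
  then have "aff_dim {W2, V, W3} > 1" by (simp add: collinear_aff_dim)
  moreover have "aff_dim {W2, V, W3} \<le> aff_dim G" using mem by (intro aff_dim_subset) auto
  ultimately have GF: "G \<in> Fs" using face by (simp add: facet_iff)
  have "nrm G \<bullet> (p - V) = hgt G p" for p using hgt_eq[OF GF mem(1)] by simp
  then show ?thesis using that[OF GF mem(1)] mem mem_facet_iff[OF GF] hgt_nonneg[OF GF] VP
    by (metis less_eq_real_def)
qed

text \<open>A facet whose normal is positive on two edge vectors would lie on the line of the third
  edge, which is too small for a facet.\<close>

lemma facet_at_vertex_signs: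
  assumes c: "cone3 V W1 W2 W3" and F: "F \<in> Fs" "V \<in> F"
  shows "nrm F \<bullet> (W1 - V) \<ge> 0" "nrm F \<bullet> (W1 - V) > 0 \<Longrightarrow> nrm F \<bullet> (W2 - V) = 0"
    "nrm F \<bullet> (W1 - V) > 0 \<Longrightarrow> nrm F \<bullet> (W3 - V) = 0"
proof -
  have P: "V \<in> P" "W1 \<in> P" "W2 \<in> P" "W3 \<in> P" using c vertex_mem by (auto simp: cone3_def)
  have h: "nrm F \<bullet> (p - V) = hgt F p" for p using hgt_eq[OF F] by simp
  show 1: "nrm F \<bullet> (W1 - V) \<ge> 0" using h hgt_nonneg[OF F(1)] P by metis
  have nn: "nrm F \<bullet> (W2 - V) \<ge> 0" "nrm F \<bullet> (W3 - V) \<ge> 0" using h hgt_nonneg[OF F(1)] P by metis+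
  have no: False if pos: "nrm F \<bullet> (A - V) > 0" "nrm F \<bullet> (B - V) > 0"
    and nn: "nrm F \<bullet> (C - V) \<ge> 0" and K: "cone3 V A B C" for A B C
  proof -
    have "F \<subseteq> affine hull {V, C}"
    proof
      fix p assume p: "p \<in> F"
      then have "p \<in> P" using facet_subset F by blast
      then obtain c1 c2 c3 where c: "c1 \<ge> 0" "c2 \<ge> 0" "c3 \<ge> 0"
        "p - V = c1 *\<^sub>R (A - V) + c2 *\<^sub>R (B - V) + c3 *\<^sub>R (C - V)"
        using cone3D[OF K \<open>p \<in> P\<close>] by metis
      have "0 = nrm F \<bullet> (p - V)" using h p mem_facet_iff[OF F(1)] by simp
      also have "\<dots> = c1 * (nrm F \<bullet> (A - V)) + c2 * (nrm F \<bullet> (B - V)) + c3 * (nrm F \<bullet> (C - V))"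
        by (simp only: c(4) inner_add_right inner_scaleR_right)
      finally have s: "c1 * (nrm F \<bullet> (A - V)) + c2 * (nrm F \<bullet> (B - V)) + c3 * (nrm F \<bullet> (C - V)) = 0"
        by simp
      have "c1 * (nrm F \<bullet> (A - V)) \<ge> 0" "c2 * (nrm F \<bullet> (B - V)) \<ge> 0" "c3 * (nrm F \<bullet> (C - V)) \<ge> 0"
        using c pos nn by simp_all
      then have "c1 * (nrm F \<bullet> (A - V)) = 0" "c2 * (nrm F \<bullet> (B - V)) = 0" using s by linarith+
      then have "c1 = 0" "c2 = 0" using pos by auto
      then have "p = (1 - c3) *\<^sub>R V + c3 *\<^sub>R C" using c(4) by (simp add: algebra_simps)
      then show "p \<in> affine hull {V, C}" unfolding affine_hull_2 by fastforce
    qed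
    then have "aff_dim F \<le> aff_dim {V, C}" using aff_dim_subset aff_dim_affine_hull by metis
    also have "\<dots> \<le> 1" using collinear_aff_dim collinear_2 by blast
    finally show False using facet_dim F by fastforce
  qed
  have K2: "cone3 V W2 W3 W1" and K3: "cone3 V W3 W1 W2" using c cone3_rot by blast+
  show "nrm F \<bullet> (W2 - V) = 0" if "nrm F \<bullet> (W1 - V) > 0"
    using no[OF that _ _ c] nn by fastforce
  show "nrm F \<bullet> (W3 - V) = 0" if "nrm F \<bullet> (W1 - V) > 0"
    using no[OF _ that _ K3] nn by fastforce
qed

text \<open>Whether a point of \<open>P\<close> lies on such a facet depends only on its coefficient
  at \<open>W1 - V\<close>.\<close>

lemma facet_at_vertex_unique:
  assumes c: "cone3 V W1 W2 W3" and F: "F \<in> Fs" "V \<in> F" and G: "G \<in> Fs" "V \<in> G"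
    and pos: "nrm F \<bullet> (W1 - V) > 0" "nrm G \<bullet> (W1 - V) > 0"
  shows "F = G"
proof -
  have *: "p \<in> F \<longleftrightarrow> c1 = 0" if F: "F \<in> Fs" "V \<in> F" and pos: "nrm F \<bullet> (W1 - V) > 0" and p: "p \<in> P"
    "p - V = c1 *\<^sub>R (W1 - V) + c2 *\<^sub>R (W2 - V) + c3 *\<^sub>R (W3 - V)" for F p c1 c2 c3
  proof -
    have "hgt F p = nrm F \<bullet> (p - V)" using hgt_eq[OF F] by simp
    also have "\<dots> = c1 * (nrm F \<bullet> (W1 - V))"
      using facet_at_vertex_signs(2,3)[OF c F pos] by (simp add: p(2) inner_add_right)
    finally show ?thesis using mem_facet_iff[OF F(1)] p pos by auto
  qed
  have "p \<in> F \<longleftrightarrow> p \<in> G" if "p \<in> P" for p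
  proof -
    obtain c1 c2 c3 where c': "p - V = c1 *\<^sub>R (W1 - V) + c2 *\<^sub>R (W2 - V) + c3 *\<^sub>R (W3 - V)"
      using cone3D[OF c \<open>p \<in> P\<close>] by metis
    show ?thesis using *[OF F pos(1) that c'] *[OF G pos(2) that c'] by simp
  qed
  then show ?thesis using facet_subset F G by blast
qed

lemma frame_exists:
  assumes "V \<in> Vs"
  obtains W1 W2 W3 F1 F2 F3 where "frame V W1 W2 W3 F1 F2 F3"
proof -
  obtain W1 W2 W3 where c: "cone3 V W1 W2 W3" using cone3_exists[OF assms] by blast
  have c2: "cone3 V W2 W3 W1" and c3: "cone3 V W3 W1 W2" using c cone3_rot by blast+
  obtain F1 where F1: "F1 \<in> Fs" "V \<in> F1" "nrm F1 \<bullet> (W1 - V) > 0" "nrm F1 \<bullet> (W2 - V) = 0" "nrm F1 \<bullet> (W3 - V) = 0"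
    using opposite_facet[OF c] by blast
  obtain F2 where F2: "F2 \<in> Fs" "V \<in> F2" "nrm F2 \<bullet> (W2 - V) > 0" "nrm F2 \<bullet> (W3 - V) = 0" "nrm F2 \<bullet> (W1 - V) = 0"
    using opposite_facet[OF c2] by blast
  obtain F3 where F3: "F3 \<in> Fs" "V \<in> F3" "nrm F3 \<bullet> (W3 - V) > 0" "nrm F3 \<bullet> (W1 - V) = 0" "nrm F3 \<bullet> (W2 - V) = 0"
    using opposite_facet[OF c3] by blast
  have "F = F1 \<or> F = F2 \<or> F = F3" if F: "F \<in> Fs" "V \<in> F" for F
  proof -
    have "nrm F \<bullet> (W1 - V) \<noteq> 0 \<or> nrm F \<bullet> (W2 - V) \<noteq> 0 \<or> nrm F \<bullet> (W3 - V) \<noteq> 0"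
      using cone3_no_orthogonal[OF c] nrm_ne F by blast
    then have "nrm F \<bullet> (W1 - V) > 0 \<or> nrm F \<bullet> (W2 - V) > 0 \<or> nrm F \<bullet> (W3 - V) > 0"
      using facet_at_vertex_signs(1)[OF c F] facet_at_vertex_signs(1)[OF c2 F] facet_at_vertex_signs(1)[OF c3 F]
      by linarith
    then show ?thesis
      using facet_at_vertex_unique[OF c F F1(1,2)] facet_at_vertex_unique[OF c2 F F2(1,2)]
        facet_at_vertex_unique[OF c3 F F3(1,2)] F1(3) F2(3) F3(3) by blast
  qed
  then have "facets_at V = {F1, F2, F3}" using F1 F2 F3 by blast
  then have "frame V W1 W2 W3 F1 F2 F3"
    using c F1 F2 F3 unfolding frame_def cone3_def by simp
  then show ?thesis using that by blast
qed

section \<open>Feet on facet planes and signs of flags\<close>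

definition foot :: "(real^3) set \<Rightarrow> real^3 \<Rightarrow> real^3" where
  "foot F y = y - hgt F y *\<^sub>R nrm F"

definition oth :: "real^3 \<Rightarrow> (real^3) set \<Rightarrow> real^3" where
  "oth V E = (THE W. W \<noteq> V \<and> E = closed_segment V W)"

text \<open>The sign of the flag \<open>V \<in> E\<close> tells on which side of the red sheet \<open>V + Cone(E)\<close> the point \<open>y\<close> lies,
  and the sign of \<open>E \<subseteq> F\<close> tells the side of the blue sheet \<open>E + Cone(F)\<close>. Below, a face is active
  if the signs of all its flags are positive.\<close>

definition vpos :: "real^3 \<Rightarrow> (real^3) set \<Rightarrow> real^3 \<Rightarrow> bool" where
  "vpos V E y \<longleftrightarrow> (y - V) \<bullet> (oth V E - V) > 0"

definition fpos :: "(real^3) set \<Rightarrow> (real^3) set \<Rightarrow> real^3 \<Rightarrow> bool" where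
  "fpos E F y \<longleftrightarrow> (\<forall>G\<in>Fs. G \<noteq> F \<longrightarrow> E \<subseteq> G \<longrightarrow> hgt G (foot F y) > 0)"

lemma hgt_foot: "hgt G (foot F y) = hgt G y - hgt F y * (nrm G \<bullet> nrm F)"
  using hgt_add[of G y "- (hgt F y *\<^sub>R nrm F)"] by (simp add: foot_def)

lemma oth_segment: "W \<noteq> V \<Longrightarrow> oth V (closed_segment V W) = W"
  unfolding oth_def by (rule the_equality) (auto simp: doubleton_eq_iff)

lemma vertices_of_edge:
  assumes "closed_segment V W \<in> Es"
  shows "vertices_in (closed_segment V W) = {V, W}"
proof -
  have "U \<in> Vs \<and> U \<in> closed_segment V W \<longleftrightarrow> U extreme_point_of closed_segment V W" for U
    using extreme_point_of_face[OF edge_face[OF assms]] by (auto simp: Vs_def)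
  then show ?thesis by (auto simp: extreme_point_of_segment)
qed

lemma frameD:
  assumes fr: "frame V W1 W2 W3 F1 F2 F3"
  shows "V \<in> Vs" "F1 \<in> Fs" "F2 \<in> Fs" "F3 \<in> Fs" "V \<in> F1" "V \<in> F2" "V \<in> F3"
    "nrm F1 \<bullet> (W1 - V) > 0" "nrm F1 \<bullet> (W2 - V) = 0" "nrm F1 \<bullet> (W3 - V) = 0"
    "nrm F2 \<bullet> (W1 - V) = 0" "nrm F2 \<bullet> (W2 - V) > 0" "nrm F2 \<bullet> (W3 - V) = 0"
    "nrm F3 \<bullet> (W1 - V) = 0" "nrm F3 \<bullet> (W2 - V) = 0" "nrm F3 \<bullet> (W3 - V) > 0"
    "edges_at V = {closed_segment V W1, closed_segment V W2, closed_segment V W3}"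
    "facets_at V = {F1, F2, F3}"
proof -
  note f = fr[unfolded frame_def]
  show "V \<in> Vs" using f by (elim conjE) assumption
  show s: "facets_at V = {F1, F2, F3}" using f by (elim conjE) assumption
  have "F \<in> Fs \<and> V \<in> F" if "F \<in> {F1, F2, F3}" for F
    using that unfolding s[symmetric] by simp
  then show "F1 \<in> Fs" "F2 \<in> Fs" "F3 \<in> Fs" "V \<in> F1" "V \<in> F2" "V \<in> F3" by simp_all
  show "nrm F1 \<bullet> (W1 - V) > 0" "nrm F1 \<bullet> (W2 - V) = 0" "nrm F1 \<bullet> (W3 - V) = 0"
    "nrm F2 \<bullet> (W1 - V) = 0" "nrm F2 \<bullet> (W2 - V) > 0" "nrm F2 \<bullet> (W3 - V) = 0"
    "nrm F3 \<bullet> (W1 - V) = 0" "nrm F3 \<bullet> (W2 - V) = 0" "nrm F3 \<bullet> (W3 - V) > 0"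
    "edges_at V = {closed_segment V W1, closed_segment V W2, closed_segment V W3}"
    using f by - (elim conjE, assumption)+
qed

lemma frame_distinct:
  assumes fr: "frame V W1 W2 W3 F1 F2 F3"
  shows "F1 \<noteq> F2" "F1 \<noteq> F3" "F2 \<noteq> F3" "W1 \<noteq> W2" "W1 \<noteq> W3" "W2 \<noteq> W3" "W1 \<noteq> V" "W2 \<noteq> V" "W3 \<noteq> V"
  using frameD(8-16)[OF fr] by auto

lemma frame_edge:
  assumes fr: "frame V W1 W2 W3 F1 F2 F3"
  shows "closed_segment V W1 \<in> Es" "W1 \<in> Vs" "W1 \<in> P"
proof -
  show E: "closed_segment V W1 \<in> Es" using frameD(17)[OF fr] by blast
  then show "W1 \<in> Vs" using vertices_of_edge by blast
  then show "W1 \<in> P" by (rule vertex_mem)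
qed

lemma frame_edges_distinct:
  assumes fr: "frame V W1 W2 W3 F1 F2 F3"
  shows "closed_segment V W1 \<noteq> closed_segment V W2"
    "closed_segment V W1 \<noteq> closed_segment V W3"
    "closed_segment V W2 \<noteq> closed_segment V W3"
  using frame_distinct[OF fr] by (auto simp: doubleton_eq_iff)

lemma frame_hgt:
  assumes fr: "frame V W1 W2 W3 F1 F2 F3"
  shows "hgt F1 y = nrm F1 \<bullet> (y - V)"
  by (rule hgt_eq[OF frameD(2)[OF fr] frameD(5)[OF fr]])

lemma segment_subset_facet_iff:
  assumes F: "F \<in> Fs"
  shows "closed_segment A B \<subseteq> F \<longleftrightarrow> A \<in> F \<and> B \<in> F"
proof -
  have "convex F" using F facet_face face_of_imp_convex by blast
  then show ?thesis using closed_segment_subset[of A F B] by auto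
qed

lemma frame_incidence:
  assumes fr: "frame V W1 W2 W3 F1 F2 F3"
  shows "W1 \<notin> F1" "W1 \<in> F2" "W1 \<in> F3"
proof -
  have h: "hgt F W1 = nrm F \<bullet> (W1 - V)" if "F \<in> {F1, F2, F3}" for F
    using hgt_eq[of F V W1] frameD(2-7)[OF fr] that by auto
  note m = mem_facet_iff[OF frameD(2)[OF fr], of W1] mem_facet_iff[OF frameD(3)[OF fr], of W1]
     mem_facet_iff[OF frameD(4)[OF fr], of W1]
  show "W1 \<notin> F1" "W1 \<in> F2" "W1 \<in> F3"
    using h frameD(8,11,14)[OF fr] m frame_edge(3)[OF fr] by auto
qed

lemma facets_of_edge:
  assumes fr: "frame V W1 W2 W3 F1 F2 F3"
  shows "facets_over (closed_segment V W1) = {F2, F3}"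
proof (rule set_eqI)
  fix G
  have "G \<in> Fs \<and> V \<in> G \<longleftrightarrow> G = F1 \<or> G = F2 \<or> G = F3"
    using arg_cong[OF frameD(18)[OF fr], of "\<lambda>A. G \<in> A"] by simp
  moreover have "G \<in> facets_over (closed_segment V W1) \<longleftrightarrow> (G \<in> Fs \<and> V \<in> G) \<and> W1 \<in> G"
    using segment_subset_facet_iff by auto
  ultimately show "G \<in> facets_over (closed_segment V W1) \<longleftrightarrow> G \<in> {F2, F3}"
    using frame_incidence[OF fr] by auto
qed

lemma edges_of_facet_at_vertex:
  assumes fr: "frame V W1 W2 W3 F1 F2 F3"
  shows "facet_edges_at F1 V = {closed_segment V W2, closed_segment V W3}"
proof -
  have "W2 \<in> F1" "W3 \<in> F1"
    using frame_incidence[OF frame_rot[OF fr]] frame_incidence[OF frame_rot[OF frame_rot[OF fr]]] by auto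
  then have "closed_segment V W1 \<subseteq> F1 \<longleftrightarrow> False" "closed_segment V W2 \<subseteq> F1" "closed_segment V W3 \<subseteq> F1"
    using frame_incidence[OF fr] frameD(2,5)[OF fr] by (auto simp: segment_subset_facet_iff)
  note sub = this
  have "facet_edges_at F1 V = {E \<in> edges_at V. E \<subseteq> F1}" by blast
  also have "\<dots> = {closed_segment V W2, closed_segment V W3}"
    unfolding frameD(17)[OF fr] using sub by auto
  finally show ?thesis .
qed

lemma frame_vpos:
  assumes fr: "frame V W1 W2 W3 F1 F2 F3"
  shows "vpos V (closed_segment V W1) y \<longleftrightarrow> (y - V) \<bullet> (W1 - V) > 0"
  using frame_distinct(7)[OF fr] by (simp add: vpos_def oth_segment)

text \<open>An edge lies in just two facets, so the quantifier in \<open>fpos\<close> ranges over a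
  single one.\<close>

lemma frame_fpos:
  assumes fr: "frame V W1 W2 W3 F1 F2 F3"
  shows "fpos (closed_segment V W1) F2 y \<longleftrightarrow> hgt F3 (foot F2 y) > 0"
    "fpos (closed_segment V W1) F3 y \<longleftrightarrow> hgt F2 (foot F3 y) > 0"
proof -
  have *: "G \<in> Fs \<and> closed_segment V W1 \<subseteq> G \<longleftrightarrow> G = F2 \<or> G = F3" for G
    using arg_cong[OF facets_of_edge[OF fr], of "\<lambda>A. G \<in> A"] by simp
  have "fpos (closed_segment V W1) F y \<longleftrightarrow>
      (\<forall>G. G \<in> Fs \<and> closed_segment V W1 \<subseteq> G \<longrightarrow> G \<noteq> F \<longrightarrow> hgt G (foot F y) > 0)" for F
    unfolding fpos_def by blast
  then have "fpos (closed_segment V W1) F y \<longleftrightarrow>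
      (F2 \<noteq> F \<longrightarrow> hgt F2 (foot F y) > 0) \<and> (F3 \<noteq> F \<longrightarrow> hgt F3 (foot F y) > 0)" for F
    unfolding * by blast
  then show "fpos (closed_segment V W1) F2 y \<longleftrightarrow> hgt F3 (foot F2 y) > 0"
    "fpos (closed_segment V W1) F3 y \<longleftrightarrow> hgt F2 (foot F3 y) > 0"
    using frame_distinct(3)[OF fr] by auto
qed

lemma frame_decomp:
  assumes fr: "frame V W1 W2 W3 F1 F2 F3"
  shows "x = (nrm F1 \<bullet> x / (nrm F1 \<bullet> (W1 - V))) *\<^sub>R (W1 - V) +
     (nrm F2 \<bullet> x / (nrm F2 \<bullet> (W2 - V))) *\<^sub>R (W2 - V) + (nrm F3 \<bullet> x / (nrm F3 \<bullet> (W3 - V))) *\<^sub>R (W3 - V)"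
proof -
  note f = frameD(8-16)[OF fr]
  show ?thesis by (rule dual_basis_decomposition) (use f in simp_all)
qed

lemma frame_decomp_nrm:
  assumes fr: "frame V W1 W2 W3 F1 F2 F3"
  shows "x = ((W1 - V) \<bullet> x / ((W1 - V) \<bullet> nrm F1)) *\<^sub>R nrm F1 +
     ((W2 - V) \<bullet> x / ((W2 - V) \<bullet> nrm F2)) *\<^sub>R nrm F2 + ((W3 - V) \<bullet> x / ((W3 - V) \<bullet> nrm F3)) *\<^sub>R nrm F3"
proof -
  note f = frameD(8-16)[OF fr]
  have "(W1 - V) \<bullet> nrm F1 > 0" "(W2 - V) \<bullet> nrm F1 = 0" "(W3 - V) \<bullet> nrm F1 = 0"
    "(W1 - V) \<bullet> nrm F2 = 0" "(W2 - V) \<bullet> nrm F2 > 0" "(W3 - V) \<bullet> nrm F2 = 0"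
    "(W1 - V) \<bullet> nrm F3 = 0" "(W2 - V) \<bullet> nrm F3 = 0" "(W3 - V) \<bullet> nrm F3 > 0"
    using f by (simp_all only: inner_commute[of "W1 - V"] inner_commute[of "W2 - V"] inner_commute[of "W3 - V"])
  note g = this
  show ?thesis by (rule dual_basis_decomposition) (use g in simp_all)
qed

lemma frame_on_edge:
  assumes fr: "frame V W1 W2 W3 F1 F2 F3" and z: "nrm F2 \<bullet> x = 0" "nrm F3 \<bullet> x = 0"
  shows "\<exists>c. x = c *\<^sub>R (W1 - V)"
proof
  note frame_decomp[OF fr, of x]
  also have "(nrm F1 \<bullet> x / (nrm F1 \<bullet> (W1 - V))) *\<^sub>R (W1 - V) +
     (nrm F2 \<bullet> x / (nrm F2 \<bullet> (W2 - V))) *\<^sub>R (W2 - V) + (nrm F3 \<bullet> x / (nrm F3 \<bullet> (W3 - V))) *\<^sub>R (W3 - V)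
     = (nrm F1 \<bullet> x / (nrm F1 \<bullet> (W1 - V))) *\<^sub>R (W1 - V)"
    by (simp add: z)
  finally show "x = (nrm F1 \<bullet> x / (nrm F1 \<bullet> (W1 - V))) *\<^sub>R (W1 - V)" .
qed

lemma frame_dual:
  assumes fr: "frame V W1 W2 W3 F1 F2 F3"
  shows "dual_frame (nrm F1) (nrm F2) (nrm F3) (W1 - V) (W2 - V) (W3 - V)"
  unfolding dual_frame_def using nrm_sq[OF frameD(2)[OF fr]] nrm_sq[OF frameD(3)[OF fr]]
    nrm_sq[OF frameD(4)[OF fr]] frameD(8-16)[OF fr] by simp

lemma frame_cos:
  assumes fr: "frame V W1 W2 W3 F1 F2 F3"
  shows "(nrm F1 \<bullet> nrm F2)\<^sup>2 < 1"
  by (rule dual_frame_cos[OF frame_dual[OF fr]])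

lemma edge_frame:
  assumes "E \<in> Es" "V \<in> Vs" "V \<in> E"
  obtains W1 W2 W3 F1 F2 F3 where "frame V W1 W2 W3 F1 F2 F3" "E = closed_segment V W1"
proof -
  obtain W1 W2 W3 F1 F2 F3 where fr: "frame V W1 W2 W3 F1 F2 F3" using frame_exists[OF assms(2)] by blast
  have "E \<in> {closed_segment V W1, closed_segment V W2, closed_segment V W3}"
    unfolding frameD(17)[OF fr, symmetric] using assms by simp
  then show ?thesis using that[OF fr] that[OF frame_rot[OF fr]] that[OF frame_rot[OF frame_rot[OF fr]]]
    by auto
qed

lemma facet_frame:
  assumes "F \<in> Fs" "V \<in> Vs" "V \<in> F"
  obtains W1 W2 W3 F2 F3 where "frame V W1 W2 W3 F F2 F3"
proof -
  obtain W1 W2 W3 F1 F2 F3 where fr: "frame V W1 W2 W3 F1 F2 F3" using frame_exists[OF assms(2)] by blast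
  have "F \<in> {F1, F2, F3}" unfolding frameD(18)[OF fr, symmetric] using assms by simp
  then show ?thesis using that fr frame_rot[OF fr] frame_rot[OF frame_rot[OF fr]] by auto
qed

lemma edge_vertex:
  assumes "E \<in> Es" obtains V where "V \<in> Vs" "V \<in> E"
  using edge_of_polytope_segment[OF polytope, of E] assms by (auto simp: Es_def Vs_def)

lemma facet_edge_other:
  assumes F: "F \<in> Fs" and E: "E \<in> Es" "E \<subseteq> F"
  obtains V W W2 W3 F3 G where "frame V W W2 W3 F3 F G" "E = closed_segment V W"
proof -
  obtain V where V: "V \<in> Vs" "V \<in> E" using edge_vertex E by blast
  obtain W1 W2 W3 F1 F2 F3 where fr: "frame V W1 W2 W3 F1 F2 F3" "E = closed_segment V W1"
    using edge_frame[OF E(1) V] by blast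
  have "F \<in> {F2, F3}" unfolding facets_of_edge[OF fr(1), symmetric] using fr(2) F E by simp
  then show ?thesis using that[of V W1 W2 W3 F1 F3] that[of V W1 W3 W2 F1 F2] fr frame_swap[OF fr(1)] by auto
qed

text \<open>The intersection is a face inside the line through \<open>V\<close> and
  \<open>W1\<close> that contains their segment, hence an edge at \<open>V\<close>; each of the
  other two edges at \<open>V\<close> leaves one of the two facets.\<close>

lemma frame_facet_Int:
  assumes fr: "frame V W1 W2 W3 F1 F2 F3"
  shows "F2 \<inter> F3 = closed_segment V W1"
proof -
  have sub: "closed_segment V W1 \<subseteq> F2 \<inter> F3"
    using frame_incidence(2,3)[OF fr] frameD(3,4,6,7)[OF fr] by (simp add: segment_subset_facet_iff)
  have face: "F2 \<inter> F3 face_of P" by (intro face_of_Int facet_face frameD[OF fr])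
  have "F2 \<inter> F3 \<subseteq> affine hull {V, W1}"
  proof
    fix p assume p: "p \<in> F2 \<inter> F3"
    have z: "nrm F2 \<bullet> (p - V) = 0" "nrm F3 \<bullet> (p - V) = 0"
      using p hgt_eq[OF frameD(3)[OF fr] frameD(6)[OF fr], of p] hgt_eq[OF frameD(4)[OF fr] frameD(7)[OF fr], of p]
      mem_facet_iff[OF frameD(3)[OF fr], of p] mem_facet_iff[OF frameD(4)[OF fr], of p] by auto
    then obtain c where "p - V = c *\<^sub>R (W1 - V)" using frame_on_edge[OF fr] by blast
    then have "p = (1 - c) *\<^sub>R V + c *\<^sub>R W1" by (simp add: algebra_simps)
    then show "p \<in> affine hull {V, W1}" unfolding affine_hull_2 by fastforce
  qed
  then have "aff_dim (F2 \<inter> F3) \<le> aff_dim {V, W1}" using aff_dim_subset aff_dim_affine_hull by metis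
  also have "\<dots> \<le> 1" using collinear_aff_dim collinear_2 by blast
  finally have le: "aff_dim (F2 \<inter> F3) \<le> 1" .
  have "aff_dim (closed_segment V W1) = 1"
    using frame_edge(1)[OF fr] by (simp add: Es_def edge_of_def)
  then have "aff_dim (F2 \<inter> F3) \<ge> 1" using aff_dim_subset[OF sub] by simp
  then have "F2 \<inter> F3 \<in> Es" using le face by (simp add: Es_def edge_of_def)
  then have "F2 \<inter> F3 \<in> {closed_segment V W1, closed_segment V W2, closed_segment V W3}"
    unfolding frameD(17)[OF fr, symmetric] using frameD(6,7)[OF fr] by simp
  moreover have "W2 \<notin> F2" "W3 \<notin> F3"
    using frame_incidence[OF frame_rot[OF fr]] frame_incidence[OF frame_rot[OF frame_rot[OF fr]]] by auto
  ultimately show ?thesis by auto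
qed

lemma inner_eq_zero_frame:
  assumes fr: "frame V W1 W2 W3 F1 F2 F3"
    and "r \<bullet> (W1 - V) = 0" "nrm F2 \<bullet> r = 0" "nrm F3 \<bullet> r = 0"
  shows "r = 0"
proof -
  have "\<exists>c. r = c *\<^sub>R (W1 - V)" by (rule frame_on_edge[OF fr assms(3,4)])
  then have "r \<bullet> r = 0"
  proof (rule exE)
    fix c assume c: "r = c *\<^sub>R (W1 - V)"
    show "r \<bullet> r = 0" by (subst (2) c) (simp add: assms(2))
  qed
  then show ?thesis by simp
qed

lemma sum_edges_at_vertex:
  fixes f :: "(real^3) set \<Rightarrow> real"
  assumes fr: "frame V W1 W2 W3 F1 F2 F3"
  shows "(\<Sum>E\<in>{E\<in>Es. V \<in> E}. f E) =
    f (closed_segment V W1) + f (closed_segment V W2) + f (closed_segment V W3)"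
    and "(\<Prod>E\<in>{E\<in>Es. V \<in> E}. f E) =
    f (closed_segment V W1) * f (closed_segment V W2) * f (closed_segment V W3)"
  unfolding frameD(17)[OF fr] using frame_edges_distinct[OF fr] by simp_all

lemma sum_facets_at_vertex:
  fixes f :: "(real^3) set \<Rightarrow> real"
  assumes fr: "frame V W1 W2 W3 F1 F2 F3"
  shows "(\<Sum>F\<in>{F\<in>Fs. V \<in> F}. f F) = f F1 + f F2 + f F3"
  unfolding frameD(18)[OF fr] using frame_distinct[OF fr] by simp

lemma sum_edges_of_facet_at_vertex:
  fixes f :: "(real^3) set \<Rightarrow> real"
  assumes fr: "frame V W1 W2 W3 F1 F2 F3"
  shows "(\<Sum>E\<in>{E\<in>Es. V \<in> E \<and> E \<subseteq> F1}. f E) = f (closed_segment V W2) + f (closed_segment V W3)"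
    "(\<Prod>E\<in>{E\<in>Es. V \<in> E \<and> E \<subseteq> F1}. f E) = f (closed_segment V W2) * f (closed_segment V W3)"
  unfolding edges_of_facet_at_vertex[OF fr] using frame_edges_distinct[OF fr] by simp_all

lemma sum_facets_of_edge:
  fixes f :: "(real^3) set \<Rightarrow> real"
  assumes fr: "frame V W1 W2 W3 F1 F2 F3"
  shows "(\<Sum>F\<in>{F\<in>Fs. closed_segment V W1 \<subseteq> F}. f F) = f F2 + f F3"
  unfolding facets_of_edge[OF fr] using frame_distinct[OF fr] by simp

lemma frame_cone:
  assumes fr: "frame V W1 W2 W3 F1 F2 F3" and q: "q \<in> P"
  obtains c1 c2 c3 where "c1 \<ge> 0" "c2 \<ge> 0" "c3 \<ge> 0"
    "q - V = c1 *\<^sub>R (W1 - V) + c2 *\<^sub>R (W2 - V) + c3 *\<^sub>R (W3 - V)" "q \<in> F1 \<longrightarrow> c1 = 0"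
proof -
  have h: "nrm F1 \<bullet> (q - V) = hgt F1 q" "nrm F2 \<bullet> (q - V) = hgt F2 q" "nrm F3 \<bullet> (q - V) = hgt F3 q"
    using frame_hgt[OF fr, of q] frame_hgt[OF frame_rot[OF fr], of q]
      frame_hgt[OF frame_rot[OF frame_rot[OF fr]], of q]
    by simp_all
  note p = hgt_nonneg[OF frameD(2)[OF fr] q] hgt_nonneg[OF frameD(3)[OF fr] q] hgt_nonneg[OF frameD(4)[OF fr] q]
  note d = frame_decomp[OF fr, of "q - V", unfolded h]
  have 1: "hgt F1 q / (nrm F1 \<bullet> (W1 - V)) \<ge> 0" "hgt F2 q / (nrm F2 \<bullet> (W2 - V)) \<ge> 0"
    "hgt F3 q / (nrm F3 \<bullet> (W3 - V)) \<ge> 0"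
    using p frameD(8,12,16)[OF fr] by simp_all
  have 2: "q \<in> F1 \<longrightarrow> hgt F1 q / (nrm F1 \<bullet> (W1 - V)) = 0"
    using mem_facet_iff[OF frameD(2)[OF fr], of q] by simp
  show ?thesis by (rule that[OF 1 d 2])
qed

section \<open>Neighbours of a vertex and unique top vertices\<close>

definition nbs where "nbs V = oth V ` (edges_at V)"
definition fnbs where "fnbs F V = oth V ` (facet_edges_at F V)"

lemma frame_nbs:
  assumes fr: "frame V W1 W2 W3 F1 F2 F3"
  shows "nbs V = {W1, W2, W3}" "fnbs F1 V = {W2, W3}"
  unfolding nbs_def fnbs_def frameD(17)[OF fr] edges_of_facet_at_vertex[OF fr]
  using frame_distinct(7-9)[OF fr] by (simp_all add: oth_segment)

lemma Vs_ne: "Vs \<noteq> {}"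
proof -
  have "P \<noteq> {}" using int_ne by auto
  obtain V where "V extreme_point_of P" by (rule extreme_point_exists_convex[OF compact convex \<open>P \<noteq> {}\<close>])
  then show ?thesis by (auto simp: Vs_def)
qed

lemma facet_vertex_ne:
  assumes "F \<in> Fs" shows "vertices_in F \<noteq> {}"
proof -
  note f = facet_face[OF assms]
  obtain V where "V extreme_point_of F"
    by (rule extreme_point_exists_convex[OF face_of_imp_compact[OF convex compact f]
      face_of_imp_convex[OF f] facet_ne[OF assms]])
  then have "V \<in> vertices_in F" using extreme_point_of_face[OF f, of V] by (simp add: Vs_def)
  then show ?thesis by blast
qed

lemma nbs_cone:
  assumes V: "V \<in> Vs" and q: "q \<in> Vs"
  shows "\<exists>c. (\<forall>p\<in>nbs V. c p \<ge> 0) \<and> q - V = (\<Sum>p\<in>nbs V. c p *\<^sub>R (p - V))"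
proof -
  obtain W1 W2 W3 F1 F2 F3 where fr: "frame V W1 W2 W3 F1 F2 F3" using frame_exists[OF V] by blast
  obtain c1 c2 c3 where c: "c1 \<ge> 0" "c2 \<ge> 0" "c3 \<ge> 0"
    "q - V = c1 *\<^sub>R (W1 - V) + c2 *\<^sub>R (W2 - V) + c3 *\<^sub>R (W3 - V)"
    by (rule frame_cone[OF fr vertex_mem[OF q]])
  define c where "c p = (if p = W1 then c1 else if p = W2 then c2 else c3)" for p
  have "(\<forall>p\<in>nbs V. c p \<ge> 0) \<and> q - V = (\<Sum>p\<in>nbs V. c p *\<^sub>R (p - V))"
    unfolding frame_nbs[OF fr] c_def using c(1-3) frame_distinct[OF fr] by (simp add: c(4))
  then show ?thesis by (rule exI[of _ c])
qed

lemma fnbs_cone: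
  assumes F: "F \<in> Fs" and V: "V \<in> Vs" "V \<in> F" and q: "q \<in> Vs" "q \<in> F"
  shows "\<exists>c. (\<forall>p\<in>fnbs F V. c p \<ge> 0) \<and> q - V = (\<Sum>p\<in>fnbs F V. c p *\<^sub>R (p - V))"
proof -
  obtain W1 W2 W3 F2 F3 where fr: "frame V W1 W2 W3 F F2 F3" using facet_frame[OF F V] by blast
  obtain c1 c2 c3 where c: "c1 \<ge> 0" "c2 \<ge> 0" "c3 \<ge> 0"
    "q - V = c1 *\<^sub>R (W1 - V) + c2 *\<^sub>R (W2 - V) + c3 *\<^sub>R (W3 - V)" "q \<in> F \<longrightarrow> c1 = 0"
    by (rule frame_cone[OF fr vertex_mem[OF q(1)]])
  define c where "c p = (if p = W2 then c2 else c3)" for p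
  have "(\<forall>p\<in>fnbs F V. c p \<ge> 0) \<and> q - V = (\<Sum>p\<in>fnbs F V. c p *\<^sub>R (p - V))"
    unfolding frame_nbs[OF fr] c_def using c(1-3,5) q(2) frame_distinct[OF fr] by (simp add: c(4))
  then show ?thesis by (rule exI[of _ c])
qed

lemma nbs_subset:
  assumes V: "V \<in> Vs" shows "nbs V \<subseteq> Vs"
proof -
  obtain W1 W2 W3 F1 F2 F3 where fr: "frame V W1 W2 W3 F1 F2 F3" using frame_exists[OF V] by blast
  show ?thesis unfolding frame_nbs[OF fr]
    using frame_edge(2)[OF fr] frame_edge(2)[OF frame_rot[OF fr]] frame_edge(2)[OF frame_rot[OF frame_rot[OF fr]]]
    by simp
qed

lemma fnbs_subset:
  assumes F: "F \<in> Fs" and V: "V \<in> Vs" "V \<in> F" shows "fnbs F V \<subseteq> vertices_in F"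
proof -
  obtain W1 W2 W3 F2 F3 where fr: "frame V W1 W2 W3 F F2 F3" using facet_frame[OF F V] by blast
  note r = frame_rot[OF fr] frame_rot[OF frame_rot[OF fr]]
  show ?thesis unfolding frame_nbs[OF fr]
    using frame_edge(2)[OF r(1)] frame_edge(2)[OF r(2)] frame_incidence[OF r(1)] frame_incidence[OF r(2)]
    by simp
qed

lemma unique_top_vertex:
  assumes "\<And>V p. V \<in> Vs \<Longrightarrow> p \<in> nbs V \<Longrightarrow> a \<bullet> (p - V) \<noteq> 0"
  shows "\<exists>!V. V \<in> Vs \<and> (\<forall>p\<in>nbs V. a \<bullet> (p - V) < 0)"
  using unique_top[of Vs nbs "\<lambda>p. a \<bullet> p" "\<lambda>V. a"] finite_Vs Vs_ne nbs_subset nbs_cone assms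
  by (simp add: inner_diff_right)

text \<open>The functional may vary with \<open>V\<close>, so that \<open>\<theta>\<close> can be a
  slope seen from a point: a quotient of affine functions, whose comparison with its value at
  \<open>V\<close> is linear.\<close>

lemma unique_top_facet:
  assumes F: "F \<in> Fs"
    and "\<And>V q. V \<in> Vs \<Longrightarrow> V \<in> F \<Longrightarrow> q \<in> Vs \<Longrightarrow> q \<in> F \<Longrightarrow> sgn (\<theta> q - \<theta> V) = sgn (l V \<bullet> (q - V))"
    and "\<And>V p. V \<in> Vs \<Longrightarrow> V \<in> F \<Longrightarrow> p \<in> fnbs F V \<Longrightarrow> l V \<bullet> (p - V) \<noteq> 0"
  shows "\<exists>!V. V \<in> vertices_in F \<and> (\<forall>p\<in>fnbs F V. l V \<bullet> (p - V) < 0)"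
  using assms(2,3) facet_vertex_ne[OF F] finite_Vs fnbs_subset[OF F] fnbs_cone[OF F]
  by (intro unique_top[of _ "fnbs F" \<theta>]) auto

subsection \<open>Active faces\<close>

text \<open>No flag function vanishes at \<open>y\<close>, so a flag that is not positive is
  strictly negative.\<close>

definition generic :: "real^3 \<Rightarrow> bool" where
  "generic y \<longleftrightarrow> y \<in> interior P \<and>
     (\<forall>V\<in>Vs. \<forall>E\<in>Es. V \<in> E \<longrightarrow> (y - V) \<bullet> (oth V E - V) \<noteq> 0) \<and>
     (\<forall>F\<in>Fs. \<forall>G\<in>Fs. F \<noteq> G \<longrightarrow> hgt G (foot F y) \<noteq> 0)"

definition actV where "actV y V \<longleftrightarrow> (\<forall>E\<in>edges_at V. vpos V E y)"
definition actE where
  "actE y E \<longleftrightarrow> (\<forall>V\<in>vertices_in E. vpos V E y) \<and> (\<forall>F\<in>facets_over E. fpos E F y)"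
definition actF where "actF y F \<longleftrightarrow> (\<forall>E\<in>{E \<in> Es. E \<subseteq> F}. fpos E F y)"

text \<open>Indicators of the negative flags. The lemmas on inactive vertices, edges and facets below
  distribute every inactive face over its flags, so that the contributions at each vertex cancel.\<close>

definition av :: "real^3 \<Rightarrow> real^3 \<Rightarrow> (real^3) set \<Rightarrow> real" where
  "av y V E = of_bool (\<not> vpos V E y)"
definition bv :: "real^3 \<Rightarrow> (real^3) set \<Rightarrow> (real^3) set \<Rightarrow> real" where
  "bv y E F = of_bool (\<not> fpos E F y)"

lemma foot_on_plane: "F \<in> Fs \<Longrightarrow> hgt F (foot F y) = 0"
  by (simp add: hgt_foot nrm_sq)

lemma generic_interior: "generic y \<Longrightarrow> y \<in> interior P"
  by (simp add: generic_def)

lemma vertex_not_interior: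
  assumes "V \<in> Vs" shows "V \<notin> interior P"
proof
  assume i: "V \<in> interior P"
  obtain W1 W2 W3 F1 F2 F3 where fr: "frame V W1 W2 W3 F1 F2 F3" using frame_exists[OF assms] by blast
  show False using hgt_pos[OF frameD(2)[OF fr] i] mem_facet_iff[OF frameD(2)[OF fr], of V] frameD(5)[OF fr] by simp
qed

text \<open>Inclusion-exclusion for 1 - (1 - A1) * (1 - A2) * (1 - A3): pairs of edges at
  \<open>V\<close> are facets at \<open>V\<close>, and the triple product is 0. Indeed
  \<open>y - V\<close> lies in the cone of the edge vectors, so if its products with all three were
  non-positive, its own square would be too.\<close>

lemma vertex_inactive:
  assumes g: "generic y" and V: "V \<in> Vs"
  shows "1 - of_bool (actV y V) = (\<Sum>E\<in>edges_at V. av y V E)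
    - (\<Sum>F\<in>facets_at V. \<Prod>E\<in>facet_edges_at F V. av y V E)"
proof -
  obtain W1 W2 W3 F1 F2 F3 where fr: "frame V W1 W2 W3 F1 F2 F3" using frame_exists[OF V] by blast
  note fr2 = frame_rot[OF fr] and fr3 = frame_rot[OF frame_rot[OF fr]]
  let ?E1 = "closed_segment V W1" and ?E2 = "closed_segment V W2" and ?E3 = "closed_segment V W3"
  have act: "actV y V \<longleftrightarrow> vpos V ?E1 y \<and> vpos V ?E2 y \<and> vpos V ?E3 y"
    unfolding actV_def frameD(17)[OF fr] by simp
  have yi: "y \<in> interior P" using g generic_interior by blast
  then have yP: "y \<in> P" using interior_subset by blast
  have "vpos V ?E1 y \<or> vpos V ?E2 y \<or> vpos V ?E3 y"
  proof (rule ccontr)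
    assume "\<not> ?thesis"
    then have neg: "(y - V) \<bullet> (W1 - V) \<le> 0" "(y - V) \<bullet> (W2 - V) \<le> 0" "(y - V) \<bullet> (W3 - V) \<le> 0"
      using frame_vpos[OF fr] frame_vpos[OF fr2] frame_vpos[OF fr3] by (auto simp: not_less)
    obtain c1 c2 c3 where c: "c1 \<ge> 0" "c2 \<ge> 0" "c3 \<ge> 0"
      "y - V = c1 *\<^sub>R (W1 - V) + c2 *\<^sub>R (W2 - V) + c3 *\<^sub>R (W3 - V)"
      by (rule frame_cone[OF fr yP])
    have "(y - V) \<bullet> (y - V) = c1 * ((y - V) \<bullet> (W1 - V)) + c2 * ((y - V) \<bullet> (W2 - V)) + c3 * ((y - V) \<bullet> (W3 - V))"
      by (subst (2) c(4)) (simp only: inner_add_right inner_scaleR_right)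
    also have "\<dots> \<le> 0" using c(1-3) neg by (simp add: add_nonpos_nonpos mult_nonneg_nonpos)
    finally have "(y - V) \<bullet> (y - V) \<le> 0" .
    then have "y = V" by (simp add: dot_square_norm)
    then show False using yi vertex_not_interior[OF V] by simp
  qed
  then show ?thesis
    unfolding sum_edges_at_vertex[OF fr] sum_facets_at_vertex[OF fr]
      sum_edges_of_facet_at_vertex[OF fr] sum_edges_of_facet_at_vertex[OF fr2] sum_edges_of_facet_at_vertex[OF fr3]
      act av_def by auto
qed

text \<open>Adding the two negated inequalities bounds the sum of the two heights by itself times a
  cosine below 1.\<close>

lemma fpos_either:
  assumes fr: "frame V W1 W2 W3 F1 F2 F3" and yi: "y \<in> interior P"
  shows "hgt F3 (foot F2 y) > 0 \<or> hgt F2 (foot F3 y) > 0"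
proof (rule ccontr)
  define c where "c = nrm F2 \<bullet> nrm F3"
  define u v where "u = hgt F2 y" and "v = hgt F3 y"
  have uv: "u > 0" "v > 0" using hgt_pos[OF _ yi] frameD(3,4)[OF fr] by (auto simp: u_def v_def)
  have "c\<^sup>2 < 1" using frame_cos[OF frame_rot[OF fr]] by (simp add: c_def)
  then have c1: "c < 1" by (metis less_eq_real_def linorder_not_less one_le_power)
  assume "\<not> ?thesis"
  then have "v - u * c \<le> 0" "u - v * c \<le> 0"
    by (auto simp: hgt_foot u_def v_def c_def inner_commute)
  then have "v + u \<le> c * (u + v)" by (simp add: algebra_simps)
  moreover have "c * (u + v) < 1 * (u + v)" using c1 uv by (intro mult_strict_right_mono) auto
  ultimately show False by simp
qed

text \<open>At most one of the end indicators A, A' and at most one of the facet indicators B, B' is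
  1, so activity is (1 - A - A') * (1 - B - B'). The fraction 1/2 shares the facet flags equally
  between the two ends.\<close>

lemma edge_inactive:
  assumes g: "generic y" and E: "E \<in> Es"
  shows "1 - of_bool (actE y E) =
    (\<Sum>V\<in>vertices_in E. av y V E + (1 / 2 - av y V E) * (\<Sum>F\<in>facets_over E. bv y E F))"
proof -
  obtain V where V: "V \<in> Vs" "V \<in> E" using edge_vertex[OF E] by blast
  obtain W1 W2 W3 F1 F2 F3 where fr: "frame V W1 W2 W3 F1 F2 F3" and Eq: "E = closed_segment V W1"
    using edge_frame[OF E V] by blast
  have ne: "W1 \<noteq> V" using frame_distinct[OF fr] by simp
  have VE: "vertices_in E = {V, W1}" unfolding Eq using vertices_of_edge frame_edge(1)[OF fr] by blast
  have FE: "facets_over E = {F2, F3}" unfolding Eq using facets_of_edge[OF fr] .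
  have o: "oth V E = W1" "oth W1 E = V"
    using oth_segment[OF ne] oth_segment[of V W1] ne by (simp_all add: Eq closed_segment_commute)
  have "(y - V) \<bullet> (W1 - V) + (y - W1) \<bullet> (V - W1) = (W1 - V) \<bullet> (W1 - V)"
    by (simp add: inner_diff_left inner_diff_right inner_commute)
  moreover have "(W1 - V) \<bullet> (W1 - V) > 0" using ne by simp
  ultimately have 1: "vpos V E y \<or> vpos W1 E y" unfolding vpos_def o by linarith
  have 2: "fpos E F2 y \<or> fpos E F3 y"
    unfolding Eq frame_fpos[OF fr] by (rule fpos_either[OF fr generic_interior[OF g]])
  have act: "actE y E \<longleftrightarrow> vpos V E y \<and> vpos W1 E y \<and> fpos E F2 y \<and> fpos E F3 y"
    unfolding actE_def VE FE by simp
  show ?thesis unfolding VE FE act av_def bv_def using 1 2 ne frame_distinct(3)[OF fr] by auto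
qed

text \<open>The indices cross over: the coordinate along \<open>W2 - V\<close> is proportional to
  the height over \<open>F2\<close>, which is the facet across the edge to
  \<open>W3\<close>.\<close>

lemma frame_foot:
  assumes fr: "frame V W1 W2 W3 F1 F2 F3" and g: "generic y"
  obtains l m where "foot F1 y - V = l *\<^sub>R (W2 - V) + m *\<^sub>R (W3 - V)" "l \<noteq> 0" "m \<noteq> 0"
    "fpos (closed_segment V W2) F1 y \<longleftrightarrow> m > 0" "fpos (closed_segment V W3) F1 y \<longleftrightarrow> l > 0"
proof -
  note fr2 = frame_rot[OF fr] and fr3 = frame_rot[OF frame_rot[OF fr]]
  define w where "w = foot F1 y - V"
  have h: "nrm F1 \<bullet> w = hgt F1 (foot F1 y)" "nrm F2 \<bullet> w = hgt F2 (foot F1 y)" "nrm F3 \<bullet> w = hgt F3 (foot F1 y)"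
    unfolding w_def frame_hgt[OF fr] frame_hgt[OF fr2] frame_hgt[OF fr3] by simp_all
  have h1: "nrm F1 \<bullet> w = 0" unfolding h foot_on_plane[OF frameD(2)[OF fr]] ..
  define l where "l = nrm F2 \<bullet> w / (nrm F2 \<bullet> (W2 - V))"
  define m where "m = nrm F3 \<bullet> w / (nrm F3 \<bullet> (W3 - V))"
  have "w = (nrm F1 \<bullet> w / (nrm F1 \<bullet> (W1 - V))) *\<^sub>R (W1 - V) + l *\<^sub>R (W2 - V) + m *\<^sub>R (W3 - V)"
    unfolding l_def m_def by (rule frame_decomp[OF fr])
  also have "\<dots> = l *\<^sub>R (W2 - V) + m *\<^sub>R (W3 - V)" unfolding h1 by simp
  finally have w: "w = l *\<^sub>R (W2 - V) + m *\<^sub>R (W3 - V)" .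
  have ne: "nrm F2 \<bullet> w \<noteq> 0" "nrm F3 \<bullet> w \<noteq> 0"
    unfolding h using g frameD(2-4)[OF fr] frame_distinct(1,2)[OF fr] by (auto simp: generic_def)
  have 1: "l \<noteq> 0" "m \<noteq> 0" using ne frameD(12,16)[OF fr] by (auto simp: l_def m_def)
  have 2: "fpos (closed_segment V W2) F1 y \<longleftrightarrow> m > 0" "fpos (closed_segment V W3) F1 y \<longleftrightarrow> l > 0"
    unfolding frame_fpos(2)[OF fr2] frame_fpos(1)[OF fr3] h[symmetric] l_def m_def
    using frameD(12,16)[OF fr] by (simp_all add: zero_less_divide_iff)
  show ?thesis by (rule that[OF w[unfolded w_def] 1 2])
qed

text \<open>The vector from \<open>V\<close> to the foot has coordinates \<open>l\<close>,
  \<open>m\<close> along the two edges of \<open>F1\<close>, and the same products \<open>a\<close>,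
  \<open>b\<close> with them as \<open>y - V\<close>. Its squared length
  \<open>l * a + m * b\<close> is positive, as \<open>planar_flags\<close> requires.\<close>

lemma frame_planar:
  assumes fr: "frame V W1 W2 W3 F1 F2 F3" and g: "generic y"
  shows "av y V (closed_segment V W2) * av y V (closed_segment V W3)
      + bv y (closed_segment V W2) F1 * bv y (closed_segment V W3) F1
    = av y V (closed_segment V W2) * bv y (closed_segment V W2) F1
      + av y V (closed_segment V W3) * bv y (closed_segment V W3) F1"
proof -
  note fr2 = frame_rot[OF fr] and fr3 = frame_rot[OF frame_rot[OF fr]]
  obtain l m where w: "foot F1 y - V = l *\<^sub>R (W2 - V) + m *\<^sub>R (W3 - V)" "l \<noteq> 0" "m \<noteq> 0"
    and f: "fpos (closed_segment V W2) F1 y \<longleftrightarrow> m > 0" "fpos (closed_segment V W3) F1 y \<longleftrightarrow> l > 0"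
    by (rule frame_foot[OF fr g])
  define a b where "a = (y - V) \<bullet> (W2 - V)" and "b = (y - V) \<bullet> (W3 - V)"
  have ab: "a \<noteq> 0" "b \<noteq> 0"
  proof -
    have "(y - V) \<bullet> (oth V E - V) \<noteq> 0" if "E \<in> edges_at V" for E
      using g that frameD(1)[OF fr] by (simp add: generic_def)
    note n = this[unfolded frameD(17)[OF fr]]
    show "a \<noteq> 0" "b \<noteq> 0"
      using n[of "closed_segment V W2"] n[of "closed_segment V W3"]
      by (simp_all add: a_def b_def oth_segment[OF frame_distinct(8)[OF fr]] oth_segment[OF frame_distinct(9)[OF fr]])
  qed
  have wd: "(foot F1 y - V) \<bullet> (W2 - V) = a" "(foot F1 y - V) \<bullet> (W3 - V) = b"
    using frameD(9,10)[OF fr] by (simp_all add: foot_def a_def b_def inner_diff_left)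
  have "foot F1 y - V \<noteq> 0"
  proof
    assume z: "foot F1 y - V = 0"
    have "hgt F2 V = 0" using frame_hgt[OF fr2, of V] by simp
    then have "hgt F2 (foot F1 y) = 0" using z by simp
    then show False using g frameD(2,3)[OF fr] frame_distinct(1)[OF fr] by (simp add: generic_def)
  qed
  then have "(foot F1 y - V) \<bullet> (foot F1 y - V) > 0" by simp
  also have "(foot F1 y - V) \<bullet> (foot F1 y - V) = l * a + m * b"
    by (subst (2) w(1)) (simp only: inner_add_right inner_scaleR_right wd)
  finally have pos: "l * a + m * b > 0" .
  show ?thesis
    unfolding av_def bv_def f frame_vpos[OF fr2] frame_vpos[OF fr3] a_def[symmetric] b_def[symmetric]
    by (rule planar_flags[OF pos w(2,3) ab])
qed

text \<open>The linear terms cancel, and the quadratic ones form the three instances of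
  \<open>frame_planar\<close>, one for each facet at \<open>V\<close>.\<close>

lemma vertex_balance:
  assumes g: "generic y" and V: "V \<in> Vs"
  shows "((\<Sum>E\<in>edges_at V. av y V E)
      - (\<Sum>F\<in>facets_at V. \<Prod>E\<in>facet_edges_at F V. av y V E))
    - (\<Sum>E\<in>edges_at V. av y V E + (1 / 2 - av y V E) * (\<Sum>F\<in>facets_over E. bv y E F))
    + (\<Sum>F\<in>facets_at V. (\<Sum>E\<in>facet_edges_at F V. bv y E F) / 2
        - (\<Prod>E\<in>facet_edges_at F V. bv y E F)) = 0"
proof -
  obtain W1 W2 W3 F1 F2 F3 where fr: "frame V W1 W2 W3 F1 F2 F3" using frame_exists[OF V] by blast
  note fr2 = frame_rot[OF fr] and fr3 = frame_rot[OF frame_rot[OF fr]]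
  note p = frame_planar[OF fr g] frame_planar[OF fr2 g] frame_planar[OF fr3 g]
  show ?thesis
    unfolding sum_edges_at_vertex[OF fr] sum_facets_at_vertex[OF fr]
      sum_edges_of_facet_at_vertex[OF fr] sum_edges_of_facet_at_vertex[OF fr2] sum_edges_of_facet_at_vertex[OF fr3]
      sum_facets_of_edge[OF fr] sum_facets_of_edge[OF fr2] sum_facets_of_edge[OF fr3]
    using p by (simp add: field_simps)
qed

text \<open>Only the contact points of the two tangents from the foot to the polygon \<open>F\<close> contribute to the
  sum, each of them \<open>1/2\<close>. They are the highest and the lowest vertex for the slope \<open>\<theta>\<close> seen from the foot.\<close>

lemma tangent_vertices:
  assumes g: "generic y" and F: "F \<in> Fs" and out: "foot F y \<notin> F"
  shows "(\<Sum>V\<in>vertices_in F. (\<Sum>E\<in>facet_edges_at F V. bv y E F) / 2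
        - (\<Prod>E\<in>facet_edges_at F V. bv y E F)) = 1" (is "sum ?f _ = 1")
proof -
  define z where "z = foot F y"
  let ?X = "vertices_in F"
  note f = facet_face[OF F]
  have "convex F" "closed F"
    using face_of_imp_convex[OF f] compact_imp_closed[OF face_of_imp_compact[OF convex compact f]] by simp_all
  then obtain b k where bk: "b \<bullet> z < k" "\<And>p. p \<in> F \<Longrightarrow> b \<bullet> p > k"
    using separating_hyperplane_closed_point[of F z] out by (auto simp: z_def)
  have pos: "b \<bullet> (p - z) > 0" if "p \<in> F" for p using bk(1) bk(2)[OF that] by (simp add: inner_diff_right)
  \<comment> \<open>Here \<open>m\<close> is a direction in the plane of \<open>F\<close> orthogonal
    to the separating vector \<open>b\<close>. The slope \<open>\<theta>\<close> is finite on
    \<open>F\<close> because \<open>b\<close> is positive on \<open>p - z\<close>. Clearing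
    denominators turns a comparison with \<open>\<theta> V\<close> into the sign of the functional
    \<open>l V\<close>, which vanishes along the line from \<open>z\<close> to
    \<open>V\<close>.\<close>
  obtain m where m: "m \<noteq> 0" "m \<bullet> nrm F = 0" "m \<bullet> b = 0" using common_orthogonal_vector by blast
  define \<theta> where "\<theta> p = m \<bullet> (p - z) / (b \<bullet> (p - z))" for p
  define l where "l V = (b \<bullet> (V - z)) *\<^sub>R m - (m \<bullet> (V - z)) *\<^sub>R b" for V
  have lz: "l V \<bullet> (V - z) = 0" for V by (simp add: l_def inner_diff_left)
  have lm: "l V \<bullet> m > 0" if "V \<in> F" for V
  proof -
    have "l V \<bullet> m = (b \<bullet> (V - z)) * (m \<bullet> m)" using m(3) by (simp add: l_def inner_diff_left inner_commute[of b m])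
    then show ?thesis using pos[OF that] m by simp
  qed
  have sg: "sgn (\<theta> q - \<theta> V) = sgn (l V \<bullet> (q - V))" if "V \<in> F" "q \<in> F" for V q
  proof -
    have p: "b \<bullet> (q - z) > 0" "b \<bullet> (V - z) > 0" using pos[OF that(2)] pos[OF that(1)] by simp_all
    have "l V \<bullet> (q - V) = l V \<bullet> (q - z) - l V \<bullet> (V - z)" by (simp add: inner_diff_right)
    also have "\<dots> = (b \<bullet> (V - z)) * (m \<bullet> (q - z)) - (m \<bullet> (V - z)) * (b \<bullet> (q - z))"
      by (simp only: lz) (simp add: l_def inner_diff_left)
    also have "\<dots> = (\<theta> q - \<theta> V) * ((b \<bullet> (q - z)) * (b \<bullet> (V - z)))"
      using p by (simp add: \<theta>_def field_simps)
    finally show ?thesis using p by (simp add: sgn_mult)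
  qed
  \<comment> \<open>Since \<open>l V\<close> vanishes on the vector from \<open>V\<close> to the
    foot, the coordinates of the foot satisfy \<open>x * A + t * B = 0\<close>. So the two flags at
    \<open>V\<close> differ exactly when both neighbours lie on one side of the line of sight, that
    is, at a contact point.\<close>
  have key: "l V \<bullet> (W2 - V) \<noteq> 0 \<and> l V \<bullet> (W3 - V) \<noteq> 0 \<and>
     (bv y (closed_segment V W2) F \<noteq> bv y (closed_segment V W3) F \<longleftrightarrow>
      (l V \<bullet> (W2 - V) < 0 \<longleftrightarrow> l V \<bullet> (W3 - V) < 0))"
    if fr: "frame V W1 W2 W3 F F2 F3" for V W1 W2 W3 F2 F3
  proof -
    obtain x t where w: "foot F y - V = x *\<^sub>R (W2 - V) + t *\<^sub>R (W3 - V)" "x \<noteq> 0" "t \<noteq> 0"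
      and f: "fpos (closed_segment V W2) F y \<longleftrightarrow> t > 0" "fpos (closed_segment V W3) F y \<longleftrightarrow> x > 0"
      by (rule frame_foot[OF fr g])
    define A B where "A = l V \<bullet> (W2 - V)" and "B = l V \<bullet> (W3 - V)"
    have "l V \<bullet> (foot F y - V) = - (l V \<bullet> (V - z))" by (simp add: z_def inner_diff_right)
    then have s: "x * A + t * B = 0" unfolding w(1) lz by (simp add: A_def B_def inner_add_right)
    have "A \<noteq> 0"
    proof
      assume A0: "A = 0"
      then have B0: "B = 0" using s w(3) by simp
      have "l V = ((W1 - V) \<bullet> l V / ((W1 - V) \<bullet> nrm F)) *\<^sub>R nrm F +
         ((W2 - V) \<bullet> l V / ((W2 - V) \<bullet> nrm F2)) *\<^sub>R nrm F2 + ((W3 - V) \<bullet> l V / ((W3 - V) \<bullet> nrm F3)) *\<^sub>R nrm F3"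
        by (rule frame_decomp_nrm[OF fr])
      also have "\<dots> = ((W1 - V) \<bullet> l V / ((W1 - V) \<bullet> nrm F)) *\<^sub>R nrm F"
        using A0 B0 by (simp add: A_def B_def inner_commute)
      finally have "l V \<bullet> m = (((W1 - V) \<bullet> l V / ((W1 - V) \<bullet> nrm F)) *\<^sub>R nrm F) \<bullet> m"
        by (rule arg_cong[where f = "\<lambda>v. v \<bullet> m"])
      then have "l V \<bullet> m = 0" using m(2) by (simp add: inner_commute)
      then show False using lm[OF frameD(5)[OF fr]] by simp
    qed
    moreover from this have "B \<noteq> 0" using s w(2) by auto
    moreover have "(x > 0 \<longleftrightarrow> t > 0) \<longleftrightarrow> (A < 0 \<longleftrightarrow> \<not> B < 0)"
    proof -
      have e: "x * A = - (t * B)" using s by simp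
      have "x * A < 0 \<longleftrightarrow> t * B > 0" unfolding e by simp
      then show ?thesis using w(2,3) \<open>A \<noteq> 0\<close> \<open>B \<noteq> 0\<close> by (auto simp: mult_less_0_iff zero_less_mult_iff)
    qed
    ultimately show ?thesis unfolding bv_def f A_def[symmetric] B_def[symmetric] by auto
  qed
  have ne: "l V \<bullet> (p - V) \<noteq> 0" if V: "V \<in> Vs" "V \<in> F" "p \<in> fnbs F V" for V p
  proof -
    obtain W1 W2 W3 F2 F3 where fr: "frame V W1 W2 W3 F F2 F3" using facet_frame[OF F V(1,2)] by blast
    show ?thesis using V(3) key[OF fr] unfolding frame_nbs[OF fr] by auto
  qed
  have "\<exists>!V. V \<in> ?X \<and> (\<forall>p\<in>fnbs F V. l V \<bullet> (p - V) < 0)"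
    by (rule unique_top_facet[OF F, where \<theta> = \<theta>]) (use sg ne in auto)
  then obtain T where T: "T \<in> ?X" "\<And>V. V \<in> ?X \<Longrightarrow> (\<forall>p\<in>fnbs F V. l V \<bullet> (p - V) < 0) \<longleftrightarrow> V = T"
    by (elim ex1E) blast
  have sg': "sgn (- \<theta> q - - \<theta> V) = sgn (- l V \<bullet> (q - V))" if "V \<in> F" "q \<in> F" for V q
    using sg[OF that] sgn_minus[of "\<theta> q - \<theta> V"] sgn_minus[of "l V \<bullet> (q - V)"] by simp
  have "\<exists>!V. V \<in> ?X \<and> (\<forall>p\<in>fnbs F V. - l V \<bullet> (p - V) < 0)"
    by (rule unique_top_facet[OF F, where \<theta> = "\<lambda>p. - \<theta> p"]) (use sg' ne in auto)
  then obtain S where S: "S \<in> ?X" "\<And>V. V \<in> ?X \<Longrightarrow> (\<forall>p\<in>fnbs F V. - l V \<bullet> (p - V) < 0) \<longleftrightarrow> V = S"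
    by (elim ex1E) blast
  \<comment> \<open>Half the sum minus the product of two indicators is 1/2 if exactly one of them
    is 1, and 0 otherwise.\<close>
  have val: "(\<Sum>E\<in>facet_edges_at F V. bv y E F) / 2 - (\<Prod>E\<in>facet_edges_at F V. bv y E F)
      = (if V = T then 1/2 else 0) + (if V = S then 1/2 else 0)" if V: "V \<in> ?X" for V
  proof -
    obtain W1 W2 W3 F2 F3 where fr: "frame V W1 W2 W3 F F2 F3" using facet_frame[OF F] V by blast
    have 1: "V = T \<longleftrightarrow> l V \<bullet> (W2 - V) < 0 \<and> l V \<bullet> (W3 - V) < 0"
      using T(2)[OF V] unfolding frame_nbs[OF fr] by simp
    have 2: "V = S \<longleftrightarrow> l V \<bullet> (W2 - V) > 0 \<and> l V \<bullet> (W3 - V) > 0"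
      using S(2)[OF V] unfolding frame_nbs[OF fr] by simp
    have vals: "bv y E F = 0 \<or> bv y E F = 1" for E by (simp add: bv_def)
    show ?thesis unfolding sum_edges_of_facet_at_vertex[OF fr] 1 2
      using key[OF fr] vals[of "closed_segment V W2"] vals[of "closed_segment V W3"] by auto
  qed
  have "finite ?X" using finite_Vs by simp
  then have "(\<Sum>V\<in>?X. (if V = T then 1/2 else 0) + (if V = S then 1/2 else (0::real))) = 1"
    using T(1) S(1) by (simp add: sum.distrib)
  moreover have "sum ?f ?X = (\<Sum>V\<in>?X. (if V = T then 1/2 else 0) + (if V = S then 1/2 else (0::real)))"
    by (rule sum.cong) (use val in auto)
  ultimately show ?thesis by (rule trans[rotated])
qed

lemma facet_active_sum:
  assumes F: "F \<in> Fs" and act: "actF y F"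
  shows "(\<Sum>V\<in>vertices_in F. (\<Sum>E\<in>facet_edges_at F V. bv y E F) / 2
        - (\<Prod>E\<in>facet_edges_at F V. bv y E F)) = 0"
proof (rule sum.neutral, rule ballI)
  fix V assume V: "V \<in> vertices_in F"
  have b: "bv y E F = 0" if "E \<in> Es" "E \<subseteq> F" for E using act that by (simp add: actF_def bv_def)
  obtain W1 W2 W3 F2 F3 where fr: "frame V W1 W2 W3 F F2 F3" using facet_frame[OF F] V by blast
  have "closed_segment V W2 \<in> facet_edges_at F V" "closed_segment V W3 \<in> facet_edges_at F V"
    unfolding edges_of_facet_at_vertex[OF fr] by simp_all
  then show "(\<Sum>E\<in>facet_edges_at F V. bv y E F) / 2
        - (\<Prod>E\<in>facet_edges_at F V. bv y E F) = 0"
    unfolding sum_edges_of_facet_at_vertex[OF fr] using b by simp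
qed

lemma facet_active_foot:
  assumes g: "generic y" and F: "F \<in> Fs" and a: "actF y F"
  shows "foot F y \<in> F"
  using tangent_vertices[OF g F] facet_active_sum[OF F a] by fastforce

text \<open>A negative flag puts the foot outside \<open>F\<close>, where the two tangents make the
  sum 1.\<close>

lemma facet_inactive:
  assumes g: "generic y" and F: "F \<in> Fs"
  shows "1 - of_bool (actF y F) = (\<Sum>V\<in>vertices_in F. (\<Sum>E\<in>facet_edges_at F V. bv y E F) / 2
        - (\<Prod>E\<in>facet_edges_at F V. bv y E F))"
proof (cases "actF y F")
  case True
  then show ?thesis using facet_active_sum[OF F] by simp
next
  case False
  then obtain E where E: "E \<in> Es" "E \<subseteq> F" "\<not> fpos E F y" by (auto simp: actF_def)
  then obtain G where G: "G \<in> Fs" "G \<noteq> F" "\<not> hgt G (foot F y) > 0" by (auto simp: fpos_def)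
  have "foot F y \<notin> F"
  proof
    assume "foot F y \<in> F"
    then have "hgt G (foot F y) \<ge> 0" using facet_subset[OF F] hgt_nonneg[OF G(1)] by blast
    then show False using g G F by (auto simp: generic_def)
  qed
  from tangent_vertices[OF g F this] show ?thesis using False by simp
qed

section \<open>Double counting and Euler's relation\<close>

lemma swap_VE:
  fixes f :: "real^3 \<Rightarrow> (real^3) set \<Rightarrow> real"
  shows "(\<Sum>V\<in>Vs. \<Sum>E\<in>edges_at V. f V E) = (\<Sum>E\<in>Es. \<Sum>V\<in>vertices_in E. f V E)"
  by (rule sum.swap_restrict[OF finite_Vs finite_Es])

lemma swap_VF:
  fixes f :: "real^3 \<Rightarrow> (real^3) set \<Rightarrow> real"
  shows "(\<Sum>V\<in>Vs. \<Sum>F\<in>facets_at V. f V F) = (\<Sum>F\<in>Fs. \<Sum>V\<in>vertices_in F. f V F)"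
  by (rule sum.swap_restrict[OF finite_Vs finite_Fs])

text \<open>Sweep by a generic linear functional \<open>a\<close>: every edge, every facet and \<open>P\<close> have one top vertex.\<close>

lemma euler_relation: "real (card Vs) - real (card Es) + real (card Fs) = 2"
proof -
  let ?S = "(\<lambda>(V, W). W - V) ` (Vs \<times> Vs) - {0}"
  have "finite ?S" using finite_Vs by simp
  then obtain a where a: "\<And>q. q \<in> ?S \<Longrightarrow> q \<bullet> a \<noteq> 0"
    using open_avoids_hyperplanes[of "UNIV :: (real^3) set" ?S] by auto
  have ne: "a \<bullet> (W - V) \<noteq> 0" if "V \<in> Vs" "W \<in> Vs" "W \<noteq> V" for V W
  proof -
    have "W - V \<in> ?S" using that by force
    from a[OF this] show ?thesis by (simp add: inner_commute)
  qed
  define \<delta> where "\<delta> V E = (of_bool (a \<bullet> (oth V E - V) < 0) :: real)" for V E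
  have fd: "\<delta> V (closed_segment V W) = of_bool (a \<bullet> (W - V) < 0)" if "W \<noteq> V" for V W
    using oth_segment[OF that] by (simp add: \<delta>_def)
  have fne: "a \<bullet> (W1 - V) \<noteq> 0" if fr: "frame V W1 W2 W3 F1 F2 F3" for V W1 W2 W3 F1 F2 F3
    using ne[OF frameD(1)[OF fr] frame_edge(2)[OF fr] frame_distinct(7)[OF fr]] .
  have nbs_ne: "a \<bullet> (p - V) \<noteq> 0" if V: "V \<in> Vs" "p \<in> nbs V" for V p
  proof -
    obtain W1 W2 W3 F1 F2 F3 where fr: "frame V W1 W2 W3 F1 F2 F3" using frame_exists[OF V(1)] by blast
    show ?thesis using V(2) fne[OF fr] fne[OF frame_rot[OF fr]] fne[OF frame_rot[OF frame_rot[OF fr]]]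
      unfolding frame_nbs[OF fr] by auto
  qed
  have fnbs_ne: "a \<bullet> (p - V) \<noteq> 0" if "V \<in> Vs" "p \<in> fnbs F V" for V p F
  proof (rule nbs_ne[OF that(1)])
    show "p \<in> nbs V" using that(2) by (auto simp: fnbs_def nbs_def)
  qed
  have top: "(\<Sum>V\<in>Vs. \<Prod>E\<in>edges_at V. \<delta> V E) = 1"
  proof -
    have "(\<Prod>E\<in>edges_at V. \<delta> V E) = of_bool (\<forall>p\<in>nbs V. a \<bullet> (p - V) < 0)" if V: "V \<in> Vs" for V
    proof -
      obtain W1 W2 W3 F1 F2 F3 where fr: "frame V W1 W2 W3 F1 F2 F3" using frame_exists[OF V] by blast
      show ?thesis unfolding sum_edges_at_vertex[OF fr] frame_nbs[OF fr]
          fd[OF frame_distinct(7)[OF fr]] fd[OF frame_distinct(8)[OF fr]] fd[OF frame_distinct(9)[OF fr]] by simp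
    qed
    then have "(\<Sum>V\<in>Vs. \<Prod>E\<in>edges_at V. \<delta> V E) = (\<Sum>V\<in>Vs. of_bool (\<forall>p\<in>nbs V. a \<bullet> (p - V) < 0))"
      by (rule sum.cong[OF refl])
    also have "\<dots> = 1" by (rule sum_of_bool_ex1[OF finite_Vs unique_top_vertex[OF nbs_ne]])
    finally show ?thesis .
  qed
  have bot: "(\<Sum>V\<in>Vs. \<Prod>E\<in>edges_at V. 1 - \<delta> V E) = 1"
  proof -
    have "(\<Prod>E\<in>edges_at V. 1 - \<delta> V E) = of_bool (\<forall>p\<in>nbs V. (- a) \<bullet> (p - V) < 0)" if V: "V \<in> Vs" for V
    proof -
      obtain W1 W2 W3 F1 F2 F3 where fr: "frame V W1 W2 W3 F1 F2 F3" using frame_exists[OF V] by blast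
      show ?thesis unfolding sum_edges_at_vertex[OF fr] frame_nbs[OF fr]
          fd[OF frame_distinct(7)[OF fr]] fd[OF frame_distinct(8)[OF fr]] fd[OF frame_distinct(9)[OF fr]]
        using fne[OF fr] fne[OF frame_rot[OF fr]] fne[OF frame_rot[OF frame_rot[OF fr]]] by auto
    qed
    then have "(\<Sum>V\<in>Vs. \<Prod>E\<in>edges_at V. 1 - \<delta> V E) = (\<Sum>V\<in>Vs. of_bool (\<forall>p\<in>nbs V. (- a) \<bullet> (p - V) < 0))"
      by (rule sum.cong[OF refl])
    also have "\<dots> = 1"
      by (rule sum_of_bool_ex1[OF finite_Vs unique_top_vertex]) (use nbs_ne in simp)
    finally show ?thesis .
  qed
  have edge: "(\<Sum>V\<in>vertices_in E. \<delta> V E) = 1" if E: "E \<in> Es" for E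
  proof -
    obtain V where V: "V \<in> Vs" "V \<in> E" using edge_vertex[OF E] by blast
    obtain W1 W2 W3 F1 F2 F3 where fr: "frame V W1 W2 W3 F1 F2 F3" and Eq: "E = closed_segment V W1"
      using edge_frame[OF E V] by blast
    have ne: "W1 \<noteq> V" using frame_distinct(7)[OF fr] .
    have VE: "vertices_in E = {V, W1}" unfolding Eq by (rule vertices_of_edge[OF frame_edge(1)[OF fr]])
    have "\<delta> V E = of_bool (a \<bullet> (W1 - V) < 0)" "\<delta> W1 E = of_bool (a \<bullet> (V - W1) < 0)"
      unfolding Eq using fd[OF ne] fd[OF ne[symmetric]] by (simp_all add: closed_segment_commute)
    then show ?thesis unfolding VE using fne[OF fr] ne by (auto simp: inner_diff_right)
  qed
  have facet: "(\<Sum>V\<in>vertices_in F. \<Prod>E\<in>facet_edges_at F V. \<delta> V E) = 1" if F: "F \<in> Fs" for F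
  proof -
    have "(\<Prod>E\<in>facet_edges_at F V. \<delta> V E) = of_bool (\<forall>p\<in>fnbs F V. a \<bullet> (p - V) < 0)"
      if V: "V \<in> vertices_in F" for V
    proof -
      obtain W1 W2 W3 F2 F3 where fr: "frame V W1 W2 W3 F F2 F3" using facet_frame[OF F] V by blast
      show ?thesis unfolding sum_edges_of_facet_at_vertex[OF fr] frame_nbs[OF fr]
          fd[OF frame_distinct(8)[OF fr]] fd[OF frame_distinct(9)[OF fr]] by simp
    qed
    then have "(\<Sum>V\<in>vertices_in F. \<Prod>E\<in>facet_edges_at F V. \<delta> V E)
        = (\<Sum>V\<in>vertices_in F. of_bool (\<forall>p\<in>fnbs F V. a \<bullet> (p - V) < 0))"
      by (rule sum.cong[OF refl])
    also have "\<dots> = 1"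
    proof (rule sum_of_bool_ex1)
      show "finite (vertices_in F)" using finite_Vs by simp
      show "\<exists>!V. V \<in> vertices_in F \<and> (\<forall>p\<in>fnbs F V. a \<bullet> (p - V) < 0)"
        by (rule unique_top_facet[OF F, where \<theta> = "\<lambda>p. a \<bullet> p"]) (use fnbs_ne in \<open>simp_all add: inner_diff_right\<close>)
    qed
    finally show ?thesis .
  qed
  \<comment> \<open>Expansion of a product of three factors, where pairs of edges at
    \<open>V\<close> are again facets. Summed over all vertices the left side is 1, the count of
    lowest vertices; on the right every edge and every facet is counted once, at its top
    vertex.\<close>
  have vertex: "(\<Prod>E\<in>edges_at V. 1 - \<delta> V E) = 1 - (\<Sum>E\<in>edges_at V. \<delta> V E)
      + (\<Sum>F\<in>facets_at V. \<Prod>E\<in>facet_edges_at F V. \<delta> V E) - (\<Prod>E\<in>edges_at V. \<delta> V E)"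
    if V: "V \<in> Vs" for V
  proof -
    obtain W1 W2 W3 F1 F2 F3 where fr: "frame V W1 W2 W3 F1 F2 F3" using frame_exists[OF V] by blast
    show ?thesis
      unfolding sum_edges_at_vertex[OF fr] sum_facets_at_vertex[OF fr] sum_edges_of_facet_at_vertex[OF fr]
        sum_edges_of_facet_at_vertex[OF frame_rot[OF fr]]
        sum_edges_of_facet_at_vertex[OF frame_rot[OF frame_rot[OF fr]]]
      by (simp add: algebra_simps)
  qed
  have "(\<Sum>V\<in>Vs. \<Prod>E\<in>edges_at V. 1 - \<delta> V E) = (\<Sum>V\<in>Vs. 1 - (\<Sum>E\<in>edges_at V. \<delta> V E)
      + (\<Sum>F\<in>facets_at V. \<Prod>E\<in>facet_edges_at F V. \<delta> V E) - (\<Prod>E\<in>edges_at V. \<delta> V E))"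
    by (rule sum.cong[OF refl vertex])
  also have "\<dots> = real (card Vs) - (\<Sum>E\<in>Es. \<Sum>V\<in>vertices_in E. \<delta> V E)
      + (\<Sum>F\<in>Fs. \<Sum>V\<in>vertices_in F. \<Prod>E\<in>facet_edges_at F V. \<delta> V E) - 1"
    by (simp only: sum.distrib sum_subtractf swap_VE swap_VF top) simp
  also have "\<dots> = real (card Vs) - real (card Es) + real (card Fs) - 1"
    using edge facet by simp
  finally show ?thesis unfolding bot by simp
qed

text \<open>After the exchange of sums, the alternating number of inactive faces is a sum of the
  terms of \<open>vertex_balance\<close>, hence 0.\<close>

lemma active_alternating_sum:
  assumes g: "generic y"
  shows "(\<Sum>V\<in>Vs. of_bool (actV y V)) - (\<Sum>E\<in>Es. of_bool (actE y E)) + (\<Sum>F\<in>Fs. of_bool (actF y F)) = (2::real)"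
proof -
  define L where "L V = (\<Sum>E\<in>edges_at V. av y V E)
      - (\<Sum>F\<in>facets_at V. \<Prod>E\<in>facet_edges_at F V. av y V E)" for V
  define M where "M V E = av y V E + (1 / 2 - av y V E) * (\<Sum>F\<in>facets_over E. bv y E F)" for V E
  define N where "N V F = (\<Sum>E\<in>facet_edges_at F V. bv y E F) / 2
        - (\<Prod>E\<in>facet_edges_at F V. bv y E F)" for V F
  have 1: "(\<Sum>V\<in>Vs. 1 - of_bool (actV y V)) = (\<Sum>V\<in>Vs. L V)"
    unfolding L_def by (rule sum.cong[OF refl vertex_inactive[OF g]])
  have "(\<Sum>E\<in>Es. 1 - of_bool (actE y E)) = (\<Sum>E\<in>Es. \<Sum>V\<in>vertices_in E. M V E)"
    unfolding M_def by (rule sum.cong[OF refl edge_inactive[OF g]])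
  then have 2: "(\<Sum>E\<in>Es. 1 - of_bool (actE y E)) = (\<Sum>V\<in>Vs. \<Sum>E\<in>edges_at V. M V E)"
    unfolding swap_VE .
  have "(\<Sum>F\<in>Fs. 1 - of_bool (actF y F)) = (\<Sum>F\<in>Fs. \<Sum>V\<in>vertices_in F. N V F)"
    unfolding N_def by (rule sum.cong[OF refl facet_inactive[OF g]])
  then have 3: "(\<Sum>F\<in>Fs. 1 - of_bool (actF y F)) = (\<Sum>V\<in>Vs. \<Sum>F\<in>facets_at V. N V F)"
    unfolding swap_VF .
  have "(\<Sum>V\<in>Vs. L V) - (\<Sum>V\<in>Vs. \<Sum>E\<in>edges_at V. M V E) + (\<Sum>V\<in>Vs. \<Sum>F\<in>facets_at V. N V F)
    = (\<Sum>V\<in>Vs. L V - (\<Sum>E\<in>edges_at V. M V E) + (\<Sum>F\<in>facets_at V. N V F))"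
    by (simp add: sum.distrib sum_subtractf)
  also have "\<dots> = 0"
    unfolding L_def M_def N_def by (rule sum.neutral, rule ballI, rule vertex_balance[OF g])
  finally have "(\<Sum>V\<in>Vs. 1 - of_bool (actV y V)) - (\<Sum>E\<in>Es. 1 - of_bool (actE y E)) + (\<Sum>F\<in>Fs. 1 - of_bool (actF y F)) = (0::real)"
    unfolding 1 2 3 .
  then have "real (card Vs) - (\<Sum>V\<in>Vs. of_bool (actV y V)) - (real (card Es) - (\<Sum>E\<in>Es. of_bool (actE y E)))
    + (real (card Fs) - (\<Sum>F\<in>Fs. of_bool (actF y F))) = 0"
    by (simp only: sum_subtractf) simp
  then show ?thesis using euler_relation by linarith
qed

text \<open>Vertices enter as singletons, so that all active faces are sets of points and can be
  counted together.\<close>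

definition active :: "real^3 \<Rightarrow> (real^3) set set" where
  "active y = (\<lambda>V. {V}) ` {V \<in> Vs. actV y V} \<union> {E \<in> Es. actE y E} \<union> {F \<in> Fs. actF y F}"

lemma edge_dim: "E \<in> Es \<Longrightarrow> aff_dim E = 1"
  by (simp add: Es_def edge_of_def)

lemma singleton_not_edge: "{V} \<notin> Es" and singleton_not_facet: "{V} \<notin> Fs"
  and edge_not_facet: "E \<in> Es \<Longrightarrow> E \<notin> Fs"
  using edge_dim[of "{V}"] facet_dim[of "{V}"] edge_dim[of E] facet_dim[of E] by auto

lemma finite_active: "finite (active y)"
  unfolding active_def using finite_Vs finite_Es finite_Fs by simp

lemma card_active_even:
  assumes g: "generic y"
  shows "even (card (active y))"
proof -
  let ?v = "card {V \<in> Vs. actV y V}" and ?e = "card {E \<in> Es. actE y E}" and ?f = "card {F \<in> Fs. actF y F}"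
  have "real ?v - real ?e + real ?f = 2"
    using active_alternating_sum[OF g]
    unfolding sum_of_bool_card[OF finite_Vs] sum_of_bool_card[OF finite_Es] sum_of_bool_card[OF finite_Fs] .
  then have 1: "?v + ?f = ?e + 2" by linarith
  have "card (active y) = card ((\<lambda>V. {V}) ` {V \<in> Vs. actV y V} \<union> {E \<in> Es. actE y E}) + ?f"
    unfolding active_def using finite_Vs finite_Es finite_Fs
    by (intro card_Un_disjoint) (auto simp: singleton_not_facet edge_not_facet)
  also have "card ((\<lambda>V. {V}) ` {V \<in> Vs. actV y V} \<union> {E \<in> Es. actE y E}) = card ((\<lambda>V. {V}) ` {V \<in> Vs. actV y V}) + ?e"
    using finite_Vs finite_Es by (intro card_Un_disjoint) (auto simp: singleton_not_edge)
  also have "card ((\<lambda>V. {V}) ` {V \<in> Vs. actV y V}) = ?v" by (intro card_image) auto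
  finally have "card (active y) = 2 * (?e + 1)" using 1 by simp
  then show ?thesis by simp
qed

section \<open>From active faces to normals\<close>

lemma normal_feetI:
  assumes "z \<in> P" "z \<noteq> y" "\<And>p. p \<in> P \<Longrightarrow> (p - z) \<bullet> (y - z) \<ge> 0"
  shows "z \<in> normal_feet P y"
proof -
  let ?h = "hyperplane (z - y) ((z - y) \<bullet> z)"
  have "P \<subseteq> {x. (z - y) \<bullet> x \<le> (z - y) \<bullet> z}"
  proof
    fix p assume "p \<in> P"
    have "(z - y) \<bullet> z - (z - y) \<bullet> p = (p - z) \<bullet> (y - z)"
      by (simp add: inner_diff_left inner_diff_right inner_commute)
    then show "p \<in> {x. (z - y) \<bullet> x \<le> (z - y) \<bullet> z}" using assms(3)[OF \<open>p \<in> P\<close>] by simp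
  qed
  moreover have zh: "z \<in> ?h \<inter> P" using assms(1) by (simp add: hyperplane_def)
  ultimately have "?h support_plane_of P"
    unfolding support_plane_of_def using assms(2) by (intro exI[of _ "z - y"]) auto
  moreover have "\<forall>u\<in>?h. \<forall>v\<in>?h. (z - y) \<bullet> (u - v) = 0"
    by (simp add: hyperplane_def inner_diff_right)
  ultimately show ?thesis unfolding normal_feet_def using zh by blast
qed

text \<open>A foot is the point nearest to \<open>y\<close> in the affine hull of the face cut out
  by its support plane, so this face determines it. This gives the finiteness behind
  \<open>card\<close> and \<open>Max\<close>.\<close>

lemma normal_feet_subset: "normal_feet P y \<subseteq> (\<lambda>F. closest_point (affine hull F) y) ` {F. F face_of P}"
proof
  fix z assume "z \<in> normal_feet P y"
  then obtain h where h: "h support_plane_of P" "z \<in> h \<inter> P" "\<forall>u\<in>h. \<forall>v\<in>h. (z - y) \<bullet> (u - v) = 0"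
    unfolding normal_feet_def by blast
  then obtain a b where ab: "h = hyperplane a b" "P \<subseteq> {x. a \<bullet> x \<le> b}"
    unfolding support_plane_of_def by blast
  have face: "P \<inter> h face_of P"
    unfolding ab(1) hyperplane_def using ab(2) by (intro face_of_Int_supporting_hyperplane_le convex) auto
  have aff: "affine hull (P \<inter> h) \<subseteq> h"
    by (rule hull_minimal) (auto simp: ab(1) hyperplane_def affine_hyperplane)
  have "z = closest_point (affine hull (P \<inter> h)) y"
  proof (rule closest_point_unique)
    show "z \<in> affine hull (P \<inter> h)" using h(2) by (simp add: hull_inc)
    show "\<forall>w\<in>affine hull (P \<inter> h). dist y z \<le> dist y w"
    proof
      fix w assume "w \<in> affine hull (P \<inter> h)"
      then have o: "(z - y) \<bullet> (w - z) = 0" using aff h(2,3) by blast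
      have "(norm (w - y))\<^sup>2 = (norm (z - y))\<^sup>2 + (norm (w - z))\<^sup>2"
        using o unfolding power2_norm_eq_inner by (simp add: inner_diff_left inner_diff_right inner_commute)
      then have "(norm (z - y))\<^sup>2 \<le> (norm (w - y))\<^sup>2" by simp
      then have "norm (z - y) \<le> norm (w - y)" by (simp add: power2_le_iff_abs_le)
      then show "dist y z \<le> dist y w" by (simp add: dist_norm norm_minus_commute)
    qed
  qed (simp_all add: affine_imp_convex)
  then show "z \<in> (\<lambda>F. closest_point (affine hull F) y) ` {F. F face_of P}"
    by (rule image_eqI) (simp add: face)
qed

lemma finite_normal_feet: "finite (normal_feet P y)"
  by (rule finite_surj[OF finite_faces normal_feet_subset])

lemma num_normals_le_max:
  assumes "y \<in> interior P" shows "num_normals P y \<le> max_normals P"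
proof -
  have "num_normals P x \<le> card {F. F face_of P}" for x
    unfolding num_normals_def using surj_card_le[OF finite_faces normal_feet_subset] .
  then have "num_normals P ` interior P \<subseteq> {..card {F. F face_of P}}" by auto
  then have "finite (num_normals P ` interior P)" using finite_subset by blast
  then show ?thesis unfolding max_normals_def using assms by simp
qed

text \<open>Positive flags make the coefficients of \<open>y - V\<close> in the three inner normals
  at \<open>V\<close> positive, and each of these normals is non-negative on
  \<open>p - V\<close>.\<close>

lemma foot_of_active_vertex:
  assumes g: "generic y" and V: "V \<in> Vs" "actV y V"
  shows "V \<in> normal_feet P y"
proof (rule normal_feetI)
  show "V \<in> P" using V vertex_mem by blast
  show "V \<noteq> y" using generic_interior[OF g] vertex_not_interior[OF V(1)] by auto
  obtain W1 W2 W3 F1 F2 F3 where fr: "frame V W1 W2 W3 F1 F2 F3" using frame_exists[OF V(1)] by blast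
  note fr2 = frame_rot[OF fr] and fr3 = frame_rot[OF frame_rot[OF fr]]
  have "vpos V (closed_segment V W1) y" "vpos V (closed_segment V W2) y" "vpos V (closed_segment V W3) y"
    using V(2) unfolding actV_def frameD(17)[OF fr] by simp_all
  then have pos: "(W1 - V) \<bullet> (y - V) > 0" "(W2 - V) \<bullet> (y - V) > 0" "(W3 - V) \<bullet> (y - V) > 0"
    unfolding frame_vpos[OF fr] frame_vpos[OF fr2] frame_vpos[OF fr3] by (simp_all add: inner_commute)
  define a1 where "a1 = (W1 - V) \<bullet> (y - V) / ((W1 - V) \<bullet> nrm F1)"
  define a2 where "a2 = (W2 - V) \<bullet> (y - V) / ((W2 - V) \<bullet> nrm F2)"
  define a3 where "a3 = (W3 - V) \<bullet> (y - V) / ((W3 - V) \<bullet> nrm F3)"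
  have a: "a1 \<ge> 0" "a2 \<ge> 0" "a3 \<ge> 0"
    using pos frameD(8,12,16)[OF fr] by (simp_all add: a1_def a2_def a3_def inner_commute)
  have yV: "y - V = a1 *\<^sub>R nrm F1 + a2 *\<^sub>R nrm F2 + a3 *\<^sub>R nrm F3"
    unfolding a1_def a2_def a3_def by (rule frame_decomp_nrm[OF fr])
  fix p assume p: "p \<in> P"
  have "(p - V) \<bullet> (y - V) = a1 * hgt F1 p + a2 * hgt F2 p + a3 * hgt F3 p"
    unfolding yV frame_hgt[OF fr] frame_hgt[OF fr2] frame_hgt[OF fr3]
    by (simp only: inner_add_right inner_scaleR_right inner_commute[of "p - V"])
  also have "\<dots> \<ge> 0"
    using a hgt_nonneg[OF frameD(2)[OF fr] p] hgt_nonneg[OF frameD(3)[OF fr] p] hgt_nonneg[OF frameD(4)[OF fr] p]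
    by simp
  finally show "(p - V) \<bullet> (y - V) \<ge> 0" .
qed

text \<open>Solution of the Gram system of the two unit normals, which span the plane orthogonal to
  the edge. For \<open>r = y - z\<close> with \<open>z\<close> on the edge, the numerators are the
  facet flags of the edge.\<close>

lemma edge_normal_expand:
  assumes fr: "frame V W1 W2 W3 F1 F2 F3" and r: "r \<bullet> (W1 - V) = 0"
  shows "r = ((nrm F2 \<bullet> r - (nrm F3 \<bullet> r) * (nrm F2 \<bullet> nrm F3)) / (1 - (nrm F2 \<bullet> nrm F3)\<^sup>2)) *\<^sub>R nrm F2
    + ((nrm F3 \<bullet> r - (nrm F2 \<bullet> r) * (nrm F2 \<bullet> nrm F3)) / (1 - (nrm F2 \<bullet> nrm F3)\<^sup>2)) *\<^sub>R nrm F3"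
proof -
  define c where "c = nrm F2 \<bullet> nrm F3"
  have c: "1 - c\<^sup>2 > 0" using frame_cos[OF frame_rot[OF fr]] by (simp add: c_def)
  define p q where "p = nrm F2 \<bullet> r" and "q = nrm F3 \<bullet> r"
  define \<alpha> \<beta> where "\<alpha> = (p - q * c) / (1 - c\<^sup>2)" and "\<beta> = (q - p * c) / (1 - c\<^sup>2)"
  have n: "nrm F2 \<bullet> nrm F2 = 1" "nrm F3 \<bullet> nrm F3 = 1" using nrm_sq frameD(3,4)[OF fr] by simp_all
  have "r - \<alpha> *\<^sub>R nrm F2 - \<beta> *\<^sub>R nrm F3 = 0"
  proof (rule inner_eq_zero_frame[OF fr])
    show "(r - \<alpha> *\<^sub>R nrm F2 - \<beta> *\<^sub>R nrm F3) \<bullet> (W1 - V) = 0"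
      using r frameD(11,14)[OF fr] by (simp add: inner_diff_left)
    have "\<alpha> + \<beta> * c = ((p - q * c) + (q - p * c) * c) / (1 - c\<^sup>2)"
      by (simp add: \<alpha>_def \<beta>_def add_divide_distrib)
    also have "(p - q * c) + (q - p * c) * c = p * (1 - c\<^sup>2)"
      by (simp add: algebra_simps power2_eq_square)
    finally have 1: "\<alpha> + \<beta> * c = p" using c by simp
    have "\<beta> + \<alpha> * c = ((q - p * c) + (p - q * c) * c) / (1 - c\<^sup>2)"
      by (simp add: \<alpha>_def \<beta>_def add_divide_distrib)
    also have "(q - p * c) + (p - q * c) * c = q * (1 - c\<^sup>2)"
      by (simp add: algebra_simps power2_eq_square)
    finally have 2: "\<beta> + \<alpha> * c = q" using c by simp
    show "nrm F2 \<bullet> (r - \<alpha> *\<^sub>R nrm F2 - \<beta> *\<^sub>R nrm F3) = 0"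
      using 1 n by (simp add: inner_diff_right c_def p_def)
    show "nrm F3 \<bullet> (r - \<alpha> *\<^sub>R nrm F2 - \<beta> *\<^sub>R nrm F3) = 0"
      using 2 n by (simp add: inner_diff_right c_def q_def inner_commute[of "nrm F3" "nrm F2"])
  qed
  then have "r = \<alpha> *\<^sub>R nrm F2 + \<beta> *\<^sub>R nrm F3" by (simp add: algebra_simps)
  then show ?thesis unfolding \<alpha>_def \<beta>_def p_def q_def c_def .
qed

text \<open>The vertex flags place the projection of \<open>y\<close> to the line of
  \<open>E\<close> strictly between its ends; the facet flags make both coefficients in
  \<open>edge_normal_expand\<close> positive.\<close>

lemma foot_of_active_edge:
  assumes g: "generic y" and E: "E \<in> Es" "actE y E"
  obtains z where "z \<in> rel_interior E" "z \<in> normal_feet P y"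
proof -
  obtain V where V: "V \<in> Vs" "V \<in> E" using edge_vertex[OF E(1)] by blast
  obtain W1 W2 W3 F1 F2 F3 where fr: "frame V W1 W2 W3 F1 F2 F3" and Eq: "E = closed_segment V W1"
    using edge_frame[OF E(1) V] by blast
  have ne: "W1 \<noteq> V" using frame_distinct(7)[OF fr] .
  have VE: "vertices_in E = {V, W1}" unfolding Eq by (rule vertices_of_edge[OF frame_edge(1)[OF fr]])
  have FE: "facets_over E = {F2, F3}" unfolding Eq by (rule facets_of_edge[OF fr])
  have o: "oth V E = W1" "oth W1 E = V"
    using oth_segment[OF ne] oth_segment[OF ne[symmetric]] by (simp_all add: Eq closed_segment_commute)
  define d where "d = W1 - V"
  have dd: "d \<bullet> d > 0" using ne by (simp add: d_def)
  have s: "(y - V) \<bullet> d > 0" "(y - W1) \<bullet> (V - W1) > 0" and "fpos E F2 y" "fpos E F3 y"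
    using E(2) unfolding actE_def VE FE vpos_def by (simp_all add: o d_def)
  then have t: "hgt F3 (foot F2 y) > 0" "hgt F2 (foot F3 y) > 0" unfolding Eq frame_fpos[OF fr] by simp_all
  have "(y - W1) \<bullet> (V - W1) = d \<bullet> d - (y - V) \<bullet> d"
    by (simp add: d_def inner_diff_left inner_diff_right inner_commute)
  then have s2: "(y - V) \<bullet> d < d \<bullet> d" using s(2) by simp
  define k where "k = (y - V) \<bullet> d / (d \<bullet> d)"
  have k: "0 < k" "k < 1" using s s2 dd by (simp_all add: k_def)
  define z where "z = V + k *\<^sub>R d"
  have z': "z = (1 - k) *\<^sub>R V + k *\<^sub>R W1" by (simp add: z_def d_def algebra_simps)
  have zopen: "z \<in> open_segment V W1" unfolding in_segment using k z' ne by auto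
  have zr: "z \<in> rel_interior E" unfolding Eq using zopen ne by (simp add: rel_interior_closed_segment)
  have zP: "z \<in> P" using zr rel_interior_subset edge_subset[OF E(1)] by blast
  have zE: "z \<in> E" using zr rel_interior_subset by blast
  have zF: "z \<in> F2" "z \<in> F3"
    using zE arg_cong[OF FE, of "\<lambda>A. F2 \<in> A"] arg_cong[OF FE, of "\<lambda>A. F3 \<in> A"] by auto
  have h: "hgt F2 p = nrm F2 \<bullet> (p - z)" "hgt F3 p = nrm F3 \<bullet> (p - z)" for p
    using hgt_eq[OF frameD(3)[OF fr] zF(1)] hgt_eq[OF frameD(4)[OF fr] zF(2)] by simp_all
  define c where "c = nrm F2 \<bullet> nrm F3"
  have c: "1 - c\<^sup>2 > 0" using frame_cos[OF frame_rot[OF fr]] by (simp add: c_def)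
  define \<alpha> where "\<alpha> = (hgt F2 y - hgt F3 y * c) / (1 - c\<^sup>2)"
  define \<beta> where "\<beta> = (hgt F3 y - hgt F2 y * c) / (1 - c\<^sup>2)"
  have pos: "\<alpha> > 0" "\<beta> > 0"
    using t c unfolding hgt_foot by (simp_all add: \<alpha>_def \<beta>_def c_def inner_commute)
  have "(y - z) \<bullet> d = (y - V) \<bullet> d - k * (d \<bullet> d)" by (simp add: z_def inner_diff_left inner_add_left)
  also have "\<dots> = 0" using dd by (simp add: k_def)
  finally have "(y - z) \<bullet> (W1 - V) = 0" by (simp add: d_def)
  from edge_normal_expand[OF fr this] have yz': "y - z = \<alpha> *\<^sub>R nrm F2 + \<beta> *\<^sub>R nrm F3"
    by (simp only: h[symmetric] \<alpha>_def \<beta>_def c_def)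
  have "z \<in> normal_feet P y"
  proof (rule normal_feetI[OF zP])
    show "z \<noteq> y" using zF(1) facet_subset hgt_pos[OF frameD(3)[OF fr] generic_interior[OF g]]
        mem_facet_iff[OF frameD(3)[OF fr], of z] by auto
    fix p assume p: "p \<in> P"
    have "(p - z) \<bullet> (y - z) = \<alpha> * hgt F2 p + \<beta> * hgt F3 p"
      unfolding yz' h by (simp only: inner_add_right inner_scaleR_right inner_commute[of "p - z"])
    also have "\<dots> \<ge> 0"
      using pos hgt_nonneg[OF frameD(3)[OF fr] p] hgt_nonneg[OF frameD(4)[OF fr] p] by simp
    finally show "(p - z) \<bullet> (y - z) \<ge> 0" .
  qed
  then show ?thesis using that zr by blast
qed

lemma facet_boundary_edge:
  assumes F: "F \<in> Fs" and z: "z \<in> F" "z \<notin> rel_interior F"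
  obtains E where "E \<in> Es" "E \<subseteq> F" "z \<in> E"
proof -
  have "polyhedron F"
    using face_of_polytope_polytope[OF polytope facet_face[OF F]] polytope_imp_polyhedron by blast
  then obtain E where E: "E facet_of F" "z \<in> E"
    using rel_interior_of_polyhedron z by blast
  have "E face_of P" using face_of_trans[OF facet_of_imp_face_of[OF E(1)] facet_face[OF F]] .
  moreover have "aff_dim E = 1" using E(1) facet_dim[OF F] by (simp add: facet_of_def)
  ultimately have "E \<in> Es" by (simp add: Es_def edge_of_def)
  then show ?thesis using that E facet_of_imp_subset by blast
qed

lemma facet_rel_interiorI:
  assumes F: "F \<in> Fs" and z: "z \<in> F" and ne: "\<And>G. G \<in> Fs \<Longrightarrow> G \<noteq> F \<Longrightarrow> hgt G z \<noteq> 0"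
  shows "z \<in> rel_interior F"
proof (rule ccontr)
  assume "z \<notin> rel_interior F"
  then obtain E where E: "E \<in> Es" "E \<subseteq> F" "z \<in> E" using facet_boundary_edge[OF F z] by blast
  obtain V W W2 W3 F3 G where fr: "frame V W W2 W3 F3 F G" "E = closed_segment V W"
    using facet_edge_other[OF F E(1,2)] by blast
  have "z \<in> G" using frame_facet_Int[OF fr(1)] fr(2) E(3) by blast
  then show False using ne[OF frameD(4)[OF fr(1)]] mem_facet_iff[OF frameD(4)[OF fr(1)], of z]
      frame_distinct(3)[OF fr(1)] by auto
qed

lemma foot_of_active_facet:
  assumes g: "generic y" and F: "F \<in> Fs" "actF y F"
  shows "foot F y \<in> rel_interior F" "foot F y \<in> normal_feet P y"
proof -
  have z: "foot F y \<in> F" by (rule facet_active_foot[OF g F])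
  show "foot F y \<in> rel_interior F"
    by (rule facet_rel_interiorI[OF F(1) z]) (use g F in \<open>auto simp: generic_def\<close>)
  have u: "hgt F y > 0" using hgt_pos[OF F(1) generic_interior[OF g]] .
  have yz: "y - foot F y = hgt F y *\<^sub>R nrm F" by (simp add: foot_def)
  show "foot F y \<in> normal_feet P y"
  proof (rule normal_feetI)
    show "foot F y \<in> P" using z facet_subset[OF F(1)] by blast
    show "foot F y \<noteq> y" using u nrm_ne[OF F(1)] by (simp add: foot_def)
    fix p assume p: "p \<in> P"
    have "(p - foot F y) \<bullet> (y - foot F y) = hgt F y * hgt F p"
      unfolding yz hgt_eq[OF F(1) z, of p] by (simp add: inner_commute)
    then show "(p - foot F y) \<bullet> (y - foot F y) \<ge> 0" using u hgt_nonneg[OF F(1) p] by simp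
  qed
qed

text \<open>Each active face has its foot in its relative interior, and relative interiors of
  different faces are disjoint.\<close>

lemma card_active_le:
  assumes g: "generic y" shows "card (active y) \<le> num_normals P y"
proof -
  have ex: "\<exists>z. z \<in> rel_interior X \<and> z \<in> normal_feet P y" if X: "X \<in> active y" for X
  proof -
    consider V where "X = {V}" "V \<in> Vs" "actV y V" | "X \<in> Es" "actE y X" | "X \<in> Fs" "actF y X"
      using X unfolding active_def by blast
    then show ?thesis
    proof cases
      case 1 then show ?thesis using foot_of_active_vertex[OF g] by auto
    next
      case 2 then show ?thesis using foot_of_active_edge[OF g] by metis
    next
      case 3 then show ?thesis using foot_of_active_facet[OF g] by blast
    qed
  qed
  define z where "z X = (SOME z. z \<in> rel_interior X \<and> z \<in> normal_feet P y)" for X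
  have z: "z X \<in> rel_interior X" "z X \<in> normal_feet P y" if "X \<in> active y" for X
    using someI_ex[OF ex[OF that]] by (auto simp: z_def)
  have face: "X face_of P" if "X \<in> active y" for X
    using that edge_face facet_face unfolding active_def by (auto simp: Vs_def face_of_singleton)
  have "inj_on z (active y)"
  proof (rule inj_onI)
    fix X Y assume XY: "X \<in> active y" "Y \<in> active y" "z X = z Y"
    then have "rel_interior X \<inter> rel_interior Y \<noteq> {}" using z by (metis IntI empty_iff)
    then show "X = Y" using face_of_eq[OF face[OF XY(1)] face[OF XY(2)]] by blast
  qed
  then show ?thesis unfolding num_normals_def
    using z(2) finite_normal_feet by (intro card_inj_on_le[of z]) auto
qed

lemma card_active_bound:
  assumes "max_normals P < 10" "generic y" shows "card (active y) \<le> 8"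
proof -
  have "card (active y) \<le> 9"
    using card_active_le[OF assms(2)] num_normals_le_max[OF generic_interior[OF assms(2)]] assms(1) by linarith
  moreover have "card (active y) \<noteq> 9" using card_active_even[OF assms(2)] by auto
  ultimately show ?thesis by simp
qed

section \<open>Points on the plane of a red sheet\<close>

lemma edge_plane_expand:
  assumes fr: "frame A W1 W2 W3 F1 F2 F3" and r: "(y - A) \<bullet> (W1 - A) = 0"
  shows "y - A = (hgt F2 (foot F3 y) / (1 - (nrm F2 \<bullet> nrm F3)\<^sup>2)) *\<^sub>R nrm F2
    + (hgt F3 (foot F2 y) / (1 - (nrm F2 \<bullet> nrm F3)\<^sup>2)) *\<^sub>R nrm F3"
proof -
  have "hgt F2 (foot F3 y) = nrm F2 \<bullet> (y - A) - (nrm F3 \<bullet> (y - A)) * (nrm F2 \<bullet> nrm F3)"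
    "hgt F3 (foot F2 y) = nrm F3 \<bullet> (y - A) - (nrm F2 \<bullet> (y - A)) * (nrm F2 \<bullet> nrm F3)"
    unfolding hgt_foot frame_hgt[OF frame_rot[OF fr]] frame_hgt[OF frame_rot[OF frame_rot[OF fr]]]
    by (simp_all add: inner_commute[of "nrm F3" "nrm F2"])
  then show ?thesis using edge_normal_expand[OF fr r] by (simp only:)
qed

text \<open>On the plane through \<open>A\<close> orthogonal to the edge, the two remaining vertex
  flags at \<open>A\<close> have the signs of the two facet flags of the edge. So the vertex and the
  edge gain or lose activity together when this plane is crossed.\<close>

lemma edge_plane_inner:
  assumes fr: "frame A W1 W2 W3 F1 F2 F3" and r: "(y - A) \<bullet> (W1 - A) = 0"
  shows "(y - A) \<bullet> (W2 - A) > 0 \<longleftrightarrow> hgt F2 (foot F3 y) > 0"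
    "(y - A) \<bullet> (W3 - A) > 0 \<longleftrightarrow> hgt F3 (foot F2 y) > 0"
    "(y - A) \<bullet> (W2 - A) = 0 \<longleftrightarrow> hgt F2 (foot F3 y) = 0"
    "(y - A) \<bullet> (W3 - A) = 0 \<longleftrightarrow> hgt F3 (foot F2 y) = 0"
proof -
  have c: "1 - (nrm F2 \<bullet> nrm F3)\<^sup>2 > 0" using frame_cos[OF frame_rot[OF fr]] by simp
  note f = frameD(12,13,15,16)[OF fr]
  have "(y - A) \<bullet> (W2 - A) = hgt F2 (foot F3 y) / (1 - (nrm F2 \<bullet> nrm F3)\<^sup>2) * (nrm F2 \<bullet> (W2 - A))"
    "(y - A) \<bullet> (W3 - A) = hgt F3 (foot F2 y) / (1 - (nrm F2 \<bullet> nrm F3)\<^sup>2) * (nrm F3 \<bullet> (W3 - A))"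
    unfolding edge_plane_expand[OF fr r] inner_add_left inner_scaleR_left f(2,3) by simp_all
  then show "(y - A) \<bullet> (W2 - A) > 0 \<longleftrightarrow> hgt F2 (foot F3 y) > 0"
    "(y - A) \<bullet> (W3 - A) > 0 \<longleftrightarrow> hgt F3 (foot F2 y) > 0"
    "(y - A) \<bullet> (W2 - A) = 0 \<longleftrightarrow> hgt F2 (foot F3 y) = 0"
    "(y - A) \<bullet> (W3 - A) = 0 \<longleftrightarrow> hgt F3 (foot F2 y) = 0"
    using c f(1,4) by (simp_all add: zero_less_mult_iff zero_less_divide_iff)
qed

end

section \<open>A ray from a vertex at which seven faces are active\<close>

text \<open>\<open>gen_plane\<close> keeps the ray off the edges and off the lines in which sheets meet; \<open>gen_edge\<close> and
  \<open>gen_foot\<close> prevent the sign of a flag from vanishing along the whole ray.\<close>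

locale ray = simple3 +
  fixes V x :: "real^3"
  assumes V: "V \<in> Vs"
    and local_facet: "\<And>F. F \<in> Fs \<Longrightarrow> V \<in> F \<Longrightarrow> nrm F \<bullet> x > 0"
    and local_edge: "\<And>E. E \<in> Es \<Longrightarrow> V \<in> E \<Longrightarrow> x \<bullet> (oth V E - V) > 0"
    and local_foot: "\<And>F G. F \<in> Fs \<Longrightarrow> V \<in> F \<Longrightarrow> G \<in> Fs \<Longrightarrow> V \<in> G \<Longrightarrow> F \<noteq> G \<Longrightarrow>
      nrm G \<bullet> x - (nrm F \<bullet> x) * (nrm G \<bullet> nrm F) > 0"
    and gen_plane: "\<And>a b k l. a \<in> {W - V |W. W \<in> Vs} \<union> nrm ` Fs \<Longrightarrow> b \<in> {W - V |W. W \<in> Vs} \<union> nrm ` Fs \<Longrightarrow>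
      x \<noteq> k *\<^sub>R a + l *\<^sub>R b"
    and gen_edge: "\<And>U W. U \<in> Vs \<Longrightarrow> W \<in> Vs \<Longrightarrow> U \<noteq> W \<Longrightarrow> x \<bullet> (W - U) \<noteq> 0"
    and gen_foot: "\<And>F G. F \<in> Fs \<Longrightarrow> G \<in> Fs \<Longrightarrow> nrm G \<noteq> (nrm G \<bullet> nrm F) *\<^sub>R nrm F \<Longrightarrow>
      nrm G \<bullet> x - (nrm F \<bullet> x) * (nrm G \<bullet> nrm F) \<noteq> 0"
    and few: "max_normals P < 10"
begin

definition Y :: "real \<Rightarrow> real^3" where "Y t = V + t *\<^sub>R x"

lemma Y_inner: "(Y t - U) \<bullet> d = (V - U) \<bullet> d + t * (x \<bullet> d)"
  by (simp add: Y_def inner_diff_left inner_add_left)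

lemma Y_hgt: "hgt G (Y t) = hgt G V + t * (nrm G \<bullet> x)"
  by (simp add: Y_def hgt_add)

lemma Y_foot: "hgt G (foot F (Y t)) =
    (hgt G V - hgt F V * (nrm G \<bullet> nrm F)) + t * (nrm G \<bullet> x - (nrm F \<bullet> x) * (nrm G \<bullet> nrm F))"
  unfolding hgt_foot Y_hgt by (simp add: algebra_simps)

lemma V_on: "F \<in> Fs \<Longrightarrow> V \<in> F \<Longrightarrow> hgt F V = 0"
  using mem_facet_iff by blast

lemma V_off: "F \<in> Fs \<Longrightarrow> V \<notin> F \<Longrightarrow> hgt F V > 0"
  using mem_facet_iff[of F V] hgt_nonneg[of F V] vertex_mem[OF V] by fastforce

lemma Y_not_in_plane:
  assumes "a \<in> {W - V |W. W \<in> Vs} \<union> nrm ` Fs" "b \<in> {W - V |W. W \<in> Vs} \<union> nrm ` Fs" "t > 0"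
  shows "Y t \<noteq> V + k *\<^sub>R a + l *\<^sub>R b"
proof
  assume "Y t = V + k *\<^sub>R a + l *\<^sub>R b"
  then have "t *\<^sub>R x = k *\<^sub>R a + l *\<^sub>R b" by (simp add: Y_def)
  then have "(1 / t) *\<^sub>R (t *\<^sub>R x) = (1 / t) *\<^sub>R (k *\<^sub>R a + l *\<^sub>R b)" by simp
  then have "x = (k / t) *\<^sub>R a + (l / t) *\<^sub>R b" using assms(3) by (simp add: scaleR_add_right)
  then show False using gen_plane[OF assms(1,2)] by blast
qed

lemma Y_not_above_vertex:
  assumes "U \<in> Vs" "F \<in> Fs" "t > 0"
  shows "Y t \<noteq> U + l *\<^sub>R nrm F"
  using Y_not_in_plane[of "U - V" "nrm F" t 1 l] assms by auto

lemma Y_not_vertex: "U \<in> Vs \<Longrightarrow> t > 0 \<Longrightarrow> Y t \<noteq> U"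
  using Y_not_in_plane[of "U - V" "U - V" t 1 0] by auto

lemma Y_not_on_edge_line:
  assumes "A \<in> Vs" "B \<in> Vs" "t > 0"
  shows "Y t \<noteq> (1 - k) *\<^sub>R A + k *\<^sub>R B"
proof -
  have "V + (1 - k) *\<^sub>R (A - V) + k *\<^sub>R (B - V) = (1 - k) *\<^sub>R A + k *\<^sub>R B" by (simp add: algebra_simps)
  then show ?thesis using Y_not_in_plane[of "A - V" "B - V" t "1 - k" k] assms by auto
qed

text \<open>This is the case exempted in \<open>gen_foot\<close>, where the flag is constant along
  the ray. A zero would force equal normals and equal heights, hence equal facets.\<close>

lemma facets_not_parallel:
  assumes "F \<in> Fs" "G \<in> Fs" "F \<noteq> G" "nrm G = (nrm G \<bullet> nrm F) *\<^sub>R nrm F" "y \<in> interior P"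
  shows "hgt G (foot F y) \<noteq> 0"
proof
  define c where "c = nrm G \<bullet> nrm F"
  assume "hgt G (foot F y) = 0"
  then have e: "hgt G y = hgt F y * c" by (simp add: hgt_foot c_def)
  have p: "hgt G y > 0" "hgt F y > 0" using hgt_pos assms by auto
  then have "c > 0" using e by (simp add: zero_less_mult_iff)
  have "norm (nrm G) = \<bar>c\<bar> * norm (nrm F)" using arg_cong[OF assms(4), of norm] by (simp add: c_def)
  then have c1: "c = 1" using nrm_aux(1) assms(1,2) \<open>c > 0\<close> by simp
  then have n: "nrm G = nrm F" using assms(4) c_def by simp
  have h: "hgt G p = hgt F p" for p
    using hgt_diff[of G p y] hgt_diff[of F p y] e c1 n by simp
  have "F = G"
    using mem_facet_iff[OF assms(1)] mem_facet_iff[OF assms(2)] by (intro set_eqI) (simp add: h)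
  then show False using assms(3) by simp
qed

lemma generic_eventually:
  assumes int: "eventually (\<lambda>t. Y t \<in> interior P) (at_left T)"
  shows "eventually (\<lambda>t. generic (Y t)) (at_left T)"
proof -
  have 1: "eventually (\<lambda>t. U \<in> E \<longrightarrow> (Y t - U) \<bullet> (oth U E - U) \<noteq> 0) (at_left T)"
    if U: "U \<in> Vs" and E: "E \<in> Es" for U E
  proof (cases "U \<in> E")
    case True
    obtain W where W: "W \<noteq> U" "E = closed_segment U W" "W \<in> Vs" using edge_segment[OF E U True] by blast
    have "x \<bullet> (oth U E - U) \<noteq> 0" using gen_edge[OF U W(3)] W(1) oth_segment[OF W(1)] W(2) by simp
    from eventually_at_left_affine_nonzero[OF this, of "(V - U) \<bullet> (oth U E - U)" T]
    show ?thesis unfolding Y_inner by (rule eventually_mono) simp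
  qed simp
  have 2: "eventually (\<lambda>t. F \<noteq> G \<longrightarrow> hgt G (foot F (Y t)) \<noteq> 0) (at_left T)"
    if F: "F \<in> Fs" and G: "G \<in> Fs" for F G
  proof (cases "F \<noteq> G \<and> nrm G = (nrm G \<bullet> nrm F) *\<^sub>R nrm F")
    case True
    then show ?thesis using facets_not_parallel[OF F G] by (intro eventually_mono[OF int]) blast
  next
    case False
    show ?thesis
    proof (cases "F = G")
      case neq: False
      then have "nrm G \<bullet> x - (nrm F \<bullet> x) * (nrm G \<bullet> nrm F) \<noteq> 0" using gen_foot[OF F G] False by blast
      from eventually_at_left_affine_nonzero[OF this, of "hgt G V - hgt F V * (nrm G \<bullet> nrm F)" T]
      show ?thesis unfolding Y_foot by (rule eventually_mono) simp
    qed simp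
  qed
  have "eventually (\<lambda>t. \<forall>U\<in>Vs. \<forall>E\<in>Es. U \<in> E \<longrightarrow> (Y t - U) \<bullet> (oth U E - U) \<noteq> 0) (at_left T)"
    using 1 by (intro eventually_ball_finite finite_Vs finite_Es ballI)
  moreover have "eventually (\<lambda>t. \<forall>F\<in>Fs. \<forall>G\<in>Fs. F \<noteq> G \<longrightarrow> hgt G (foot F (Y t)) \<noteq> 0) (at_left T)"
    using 2 by (intro eventually_ball_finite finite_Fs ballI)
  ultimately show ?thesis unfolding generic_def using int by (intro eventually_conj)
qed

text \<open>At a good time the ray has left neither \<open>P\<close> nor the active region of a face at \<open>V\<close>.\<close>

definition good :: "real \<Rightarrow> bool" where
  "good t \<longleftrightarrow> 0 < t \<and> (\<forall>G\<in>Fs. V \<notin> G \<longrightarrow> hgt G (Y t) > 0) \<and>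
     (\<forall>E\<in>Es. V \<in> E \<longrightarrow> (Y t - oth V E) \<bullet> (V - oth V E) > 0) \<and>
     (\<forall>F\<in>Fs. \<forall>G\<in>Fs. V \<in> F \<longrightarrow> V \<notin> G \<longrightarrow> hgt G (foot F (Y t)) > 0)"

text \<open>Heights over facets through \<open>V\<close> vanish at \<open>V\<close>, so their signs
  never change along the ray. This is why \<open>good\<close> asks only about the other
  facets.\<close>

lemma local_hgt_pos: "t > 0 \<Longrightarrow> F \<in> Fs \<Longrightarrow> V \<in> F \<Longrightarrow> hgt F (Y t) > 0"
  unfolding Y_hgt using V_on local_facet by simp

lemma local_foot_pos:
  "t > 0 \<Longrightarrow> F \<in> Fs \<Longrightarrow> V \<in> F \<Longrightarrow> G \<in> Fs \<Longrightarrow> V \<in> G \<Longrightarrow> F \<noteq> G \<Longrightarrow> hgt G (foot F (Y t)) > 0"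
  unfolding Y_foot using V_on local_foot by simp

lemma good_interior: "good t \<Longrightarrow> Y t \<in> interior P"
  unfolding mem_interior_iff good_def using local_hgt_pos by blast

lemma good_foot_pos: "good t \<Longrightarrow> F \<in> Fs \<Longrightarrow> V \<in> F \<Longrightarrow> G \<in> Fs \<Longrightarrow> F \<noteq> G \<Longrightarrow> hgt G (foot F (Y t)) > 0"
  using local_foot_pos[of t F G] unfolding good_def by blast

lemma good_local_active:
  assumes g: "good t"
  shows "insert {V} ((edges_at V) \<union> (facets_at V)) \<subseteq> active (Y t)"
proof -
  have t: "t > 0" using g by (simp add: good_def)
  have vV: "vpos V E (Y t)" if E: "E \<in> Es" "V \<in> E" for E
    unfolding vpos_def Y_inner using local_edge[OF E] t by simp
  have fF: "fpos E F (Y t)" if "F \<in> Fs" "V \<in> F" for E F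
    unfolding fpos_def using good_foot_pos[OF g that] by auto
  have "actV (Y t) V" unfolding actV_def using vV by simp
  moreover have "actE (Y t) E" if E: "E \<in> Es" "V \<in> E" for E
  proof -
    obtain W where W: "W \<noteq> V" "E = closed_segment V W" using edge_segment[OF E(1) V E(2)] by blast
    have VE: "vertices_in E = {V, W}" unfolding W(2) by (rule vertices_of_edge[OF E(1)[unfolded W(2)]])
    have o: "oth V E = W" "oth W E = V"
      using oth_segment[OF W(1)] oth_segment[OF W(1)[symmetric]] by (simp_all add: W(2) closed_segment_commute)
    have "(Y t - oth V E) \<bullet> (V - oth V E) > 0" using g E by (simp add: good_def)
    then have "vpos W E (Y t)" unfolding vpos_def o .
    moreover have "\<forall>F\<in>facets_over E. fpos E F (Y t)" using fF E(2) by blast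
    ultimately show ?thesis unfolding actE_def VE using vV[OF E] by simp
  qed
  moreover have "actF (Y t) F" if "F \<in> Fs" "V \<in> F" for F
    unfolding actF_def using fF[OF that] by simp
  ultimately show ?thesis unfolding active_def using V by blast
qed

lemma card_local: "card (insert {V} ((edges_at V) \<union> (facets_at V))) = 7"
proof -
  obtain W1 W2 W3 F1 F2 F3 where fr: "frame V W1 W2 W3 F1 F2 F3" using frame_exists[OF V] by blast
  have "card (edges_at V) = 3" unfolding frameD(17)[OF fr] using frame_edges_distinct[OF fr] by simp
  moreover have "card (facets_at V) = 3" unfolding frameD(18)[OF fr] using frame_distinct[OF fr] by simp
  moreover have "card ((edges_at V) \<union> (facets_at V)) = card (edges_at V) + card (facets_at V)"
    using finite_Es finite_Fs edge_not_facet by (intro card_Un_disjoint) auto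
  moreover have "{V} \<notin> (edges_at V) \<union> facets_at V"
    using singleton_not_edge singleton_not_facet by simp
  moreover have "finite ((edges_at V) \<union> (facets_at V))" using finite_Es finite_Fs by simp
  ultimately show ?thesis by simp
qed

text \<open>Genericity may fail at \<open>T\<close> but holds shortly before; one such time shows
  nine active faces, against \<open>card_active_bound\<close>.\<close>

lemma no_two_far_active:
  assumes good: "eventually good (at_left T)"
    and act: "eventually (\<lambda>t. X \<in> active (Y t)) (at_left T)" "eventually (\<lambda>t. X' \<in> active (Y t)) (at_left T)"
    and far: "V \<notin> X" "V \<notin> X'" "X \<noteq> X'"
  shows False
proof -
  have "eventually (\<lambda>t. Y t \<in> interior P) (at_left T)"
    using good by (rule eventually_mono) (rule good_interior)
  then have "eventually (\<lambda>t. generic (Y t)) (at_left T)" by (rule generic_eventually)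
  then have "eventually (\<lambda>t. (generic (Y t) \<and> good t) \<and> X \<in> active (Y t) \<and> X' \<in> active (Y t)) (at_left T)"
    using good act by (intro eventually_conj)
  then obtain t where t: "generic (Y t)" "good t" "X \<in> active (Y t)" "X' \<in> active (Y t)"
    using eventually_happens trivial_limit_at_left_real by blast
  let ?L = "insert {V} ((edges_at V) \<union> (facets_at V))"
  have "X \<notin> insert X' ?L" "X' \<notin> ?L" using far by auto
  moreover have "finite ?L" using finite_Es finite_Fs by simp
  ultimately have "card (insert X (insert X' ?L)) = card ?L + 2" by simp
  moreover have "card (insert X (insert X' ?L)) \<le> card (active (Y t))"
    using t(3,4) good_local_active[OF t(2)] by (intro card_mono finite_active) simp
  ultimately show False using card_active_bound[OF few t(1)] card_local by linarith
qed

lemma farthest_vertex: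
  obtains W where "W \<in> Vs" "W \<noteq> V" "\<forall>p\<in>P. norm (p - V) \<le> norm (W - V)"
proof -
  let ?m = "Max ((\<lambda>U. norm (U - V)) ` Vs)"
  have "?m \<in> (\<lambda>U. norm (U - V)) ` Vs" using finite_Vs Vs_ne by (intro Max_in) auto
  then obtain W where W: "W \<in> Vs" "norm (W - V) = ?m" by auto
  have le: "norm (U - V) \<le> norm (W - V)" if "U \<in> Vs" for U
    unfolding W(2) using finite_Vs that by (intro Max_ge) auto
  have "P = convex hull Vs"
    unfolding Vs_def by (rule Krein_Milman_Minkowski[OF compact convex])
  also have "\<dots> \<subseteq> cball V (norm (W - V))"
    using le by (intro hull_minimal) (auto simp: dist_norm norm_minus_commute)
  finally have far: "norm (p - V) \<le> norm (W - V)" if "p \<in> P" for p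
    using that by (auto simp: dist_norm norm_minus_commute)
  obtain W1 W2 W3 F1 F2 F3 where fr: "frame V W1 W2 W3 F1 F2 F3" using frame_exists[OF V] by blast
  have "W \<noteq> V" using far[OF frame_edge(3)[OF fr]] frame_distinct(7)[OF fr] by auto
  then show ?thesis using that[OF W(1)] far by blast
qed

text \<open>The set \<open>Z\<close> collects the affine functions in \<open>good\<close>, all
  positive at time 0. Some height decreases, since otherwise the ray would stay in the bounded set
  \<open>P\<close> forever.\<close>

lemma exit_time:
  obtains T where "T > 0" "\<forall>t. 0 < t \<longrightarrow> t < T \<longrightarrow> good t"
    "(\<exists>G\<in>Fs. V \<notin> G \<and> hgt G (Y T) = 0) \<or>
     (\<exists>E\<in>Es. V \<in> E \<and> (Y T - oth V E) \<bullet> (V - oth V E) = 0) \<or>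
     (\<exists>F\<in>Fs. \<exists>G\<in>Fs. V \<in> F \<and> V \<notin> G \<and> hgt G (foot F (Y T)) = 0)"
proof -
  let ?GO = "{G \<in> Fs. V \<notin> G}" and ?EV = "edges_at V" and ?FV = "facets_at V"
  let ?g = "\<lambda>G. (hgt G V, nrm G \<bullet> x)"
  let ?e = "\<lambda>E. ((V - oth V E) \<bullet> (V - oth V E), x \<bullet> (V - oth V E))"
  let ?f = "\<lambda>(F, G). (hgt G V - hgt F V * (nrm G \<bullet> nrm F), nrm G \<bullet> x - (nrm F \<bullet> x) * (nrm G \<bullet> nrm F))"
  define Z where "Z = ?g ` ?GO \<union> ?e ` ?EV \<union> ?f ` (?FV \<times> ?GO)"
  have fin: "finite Z" unfolding Z_def using finite_Fs finite_Es by simp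
  have pos: "fst z > 0" if "z \<in> Z" for z
  proof -
    consider G where "G \<in> ?GO" "z = ?g G" | E where "E \<in> ?EV" "z = ?e E"
      | F G where "F \<in> ?FV" "G \<in> ?GO" "z = ?f (F, G)"
      using \<open>z \<in> Z\<close> unfolding Z_def by blast
    then show ?thesis
    proof cases
      case 1 then show ?thesis using V_off by simp
    next
      case 2
      have E: "E \<in> Es" "V \<in> E" using 2 by auto
      obtain W where "W \<noteq> V" "E = closed_segment V W" using edge_segment[OF E(1) V E(2)] by blast
      then show ?thesis using 2 oth_segment by simp
    next
      case 3 then show ?thesis using V_off V_on by simp
    qed
  qed
  have "\<exists>G\<in>?GO. nrm G \<bullet> x < 0"
  proof (rule ccontr)
    assume n: "\<not> ?thesis"
    have inP: "Y t \<in> P" if t: "t \<ge> 0" for t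
      unfolding mem_P_iff
    proof
      fix F assume F: "F \<in> Fs"
      have "hgt F V \<ge> 0" using hgt_nonneg[OF F vertex_mem[OF V]] .
      moreover have "nrm F \<bullet> x \<ge> 0" using n F local_facet[OF F] by (cases "V \<in> F") auto
      ultimately show "hgt F (Y t) \<ge> 0" unfolding Y_hgt using t by simp
    qed
    obtain B where B: "\<And>p. p \<in> P \<Longrightarrow> norm p \<le> B"
      using compact_imp_bounded[OF compact] unfolding bounded_iff by blast
    have x0: "norm x > 0"
      using gen_plane[of "V - V" "V - V" 0 0] V by force
    define t where "t = (B + norm V + 1) / norm x"
    have "B \<ge> 0" using B[OF vertex_mem[OF V]] norm_ge_zero[of V] by linarith
    then have t: "t \<ge> 0" using x0 by (simp add: t_def)
    have "norm (t *\<^sub>R x) \<le> norm (Y t) + norm V"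
      using norm_triangle_ineq4[of "Y t" V] by (simp add: Y_def)
    also have "\<dots> \<le> B + norm V" using B[OF inP[OF t]] by simp
    finally have "t * norm x \<le> B + norm V" using t by simp
    then show False using x0 by (simp add: t_def)
  qed
  then obtain G where G: "G \<in> ?GO" "nrm G \<bullet> x < 0" by blast
  have "?g G \<in> Z" "snd (?g G) < 0" using G unfolding Z_def by auto
  then obtain T z where T: "T > 0" "\<And>z t. z \<in> Z \<Longrightarrow> 0 \<le> t \<Longrightarrow> t < T \<Longrightarrow> fst z + t * snd z > 0"
    "z \<in> Z" "fst z + T * snd z = 0"
    using first_exit[OF fin pos] by blast
  have vg: "fst (?g G) + t * snd (?g G) = hgt G (Y t)" for G t by (simp add: Y_hgt)
  have ve: "fst (?e E) + t * snd (?e E) = (Y t - oth V E) \<bullet> (V - oth V E)" for E t by (simp add: Y_inner)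
  have vf: "fst (?f (F, G)) + t * snd (?f (F, G)) = hgt G (foot F (Y t))" for F G t by (simp add: Y_foot)
  have good: "good t" if t: "0 < t" "t < T" for t
  proof -
    have p: "fst z + t * snd z > 0" if "z \<in> Z" for z using T(2)[OF that] t by simp
    have "hgt G (Y t) > 0" if "G \<in> ?GO" for G
    proof -
      have "?g G \<in> Z" using that unfolding Z_def by blast
      from p[OF this] show ?thesis unfolding vg .
    qed
    moreover have "(Y t - oth V E) \<bullet> (V - oth V E) > 0" if "E \<in> ?EV" for E
    proof -
      have "?e E \<in> Z" using that unfolding Z_def by blast
      from p[OF this] show ?thesis unfolding ve .
    qed
    moreover have "hgt G (foot F (Y t)) > 0" if "F \<in> ?FV" "G \<in> ?GO" for F G
    proof -
      have "?f (F, G) \<in> Z" using that unfolding Z_def by blast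
      from p[OF this] show ?thesis unfolding vf .
    qed
    ultimately show ?thesis unfolding good_def using t by simp
  qed
  consider G where "G \<in> ?GO" "z = ?g G" | E where "E \<in> ?EV" "z = ?e E"
    | F G where "F \<in> ?FV" "G \<in> ?GO" "z = ?f (F, G)"
    using \<open>z \<in> Z\<close> unfolding Z_def by blast
  then have "(\<exists>G\<in>Fs. V \<notin> G \<and> hgt G (Y T) = 0) \<or>
     (\<exists>E\<in>Es. V \<in> E \<and> (Y T - oth V E) \<bullet> (V - oth V E) = 0) \<or>
     (\<exists>F\<in>Fs. \<exists>G\<in>Fs. V \<in> F \<and> V \<notin> G \<and> hgt G (foot F (Y T)) = 0)"
  proof cases
    case 1
    then have "hgt G (Y T) = 0" using T(4) unfolding vg[symmetric] by simp
    then show ?thesis using 1(1) by blast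
  next
    case 2
    then have "(Y T - oth V E) \<bullet> (V - oth V E) = 0" using T(4) unfolding ve[symmetric] by simp
    then show ?thesis using 2(1) by blast
  next
    case 3
    then have "hgt G (foot F (Y T)) = 0" using T(4) unfolding vf[symmetric] by simp
    then show ?thesis using 3(1,2) by blast
  qed
  moreover have "\<forall>t. 0 < t \<longrightarrow> t < T \<longrightarrow> good t" using good by blast
  ultimately show ?thesis using that[OF T(1)] by blast
qed

section \<open>Faces active shortly before a given time\<close>

lemma ev_inner_pos:
  assumes "(Y T - U) \<bullet> d > 0" shows "eventually (\<lambda>t. (Y t - U) \<bullet> d > 0) (at_left T)"
  using assms unfolding Y_inner by (rule eventually_at_left_affine_pos)

lemma ev_foot_pos:
  assumes "hgt G (foot F (Y T)) > 0" shows "eventually (\<lambda>t. hgt G (foot F (Y t)) > 0) (at_left T)"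
  using assms unfolding Y_foot by (rule eventually_at_left_affine_pos)

lemma edge_eventually_active:
  assumes fr: "frame A B W2 W3 F1 F2 F3"
    and "eventually (\<lambda>t. (Y t - A) \<bullet> (B - A) > 0) (at_left T)"
    and "eventually (\<lambda>t. (Y t - B) \<bullet> (A - B) > 0) (at_left T)"
    and "eventually (\<lambda>t. hgt F3 (foot F2 (Y t)) > 0) (at_left T)"
    and "eventually (\<lambda>t. hgt F2 (foot F3 (Y t)) > 0) (at_left T)"
  shows "eventually (\<lambda>t. closed_segment A B \<in> active (Y t)) (at_left T)"
proof -
  let ?E = "closed_segment A B"
  have ne: "B \<noteq> A" using frame_distinct(7)[OF fr] .
  have VE: "vertices_in ?E = {A, B}" by (rule vertices_of_edge[OF frame_edge(1)[OF fr]])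
  have FE: "facets_over ?E = {F2, F3}" by (rule facets_of_edge[OF fr])
  have o: "oth A ?E = B" "oth B ?E = A"
    using oth_segment[OF ne] oth_segment[OF ne[symmetric]] by (simp_all add: closed_segment_commute)
  have act: "?E \<in> active (Y t)" if "((Y t - A) \<bullet> (B - A) > 0 \<and> (Y t - B) \<bullet> (A - B) > 0) \<and>
    hgt F3 (foot F2 (Y t)) > 0 \<and> hgt F2 (foot F3 (Y t)) > 0" for t
  proof -
    have "actE (Y t) ?E" unfolding actE_def VE FE vpos_def
      using that by (simp add: o frame_fpos[OF fr])
    then show ?thesis unfolding active_def using frame_edge(1)[OF fr] by blast
  qed
  have "eventually (\<lambda>t. ((Y t - A) \<bullet> (B - A) > 0 \<and> (Y t - B) \<bullet> (A - B) > 0) \<and>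
    hgt F3 (foot F2 (Y t)) > 0 \<and> hgt F2 (foot F3 (Y t)) > 0) (at_left T)"
    using assms(2-) by (intro eventually_conj)
  then show ?thesis by (rule eventually_mono) (rule act)
qed

lemma vertex_eventually_active:
  assumes fr: "frame A W1 W2 W3 F1 F2 F3"
    and "eventually (\<lambda>t. (Y t - A) \<bullet> (W1 - A) > 0) (at_left T)"
    and "eventually (\<lambda>t. (Y t - A) \<bullet> (W2 - A) > 0) (at_left T)"
    and "eventually (\<lambda>t. (Y t - A) \<bullet> (W3 - A) > 0) (at_left T)"
  shows "eventually (\<lambda>t. {A} \<in> active (Y t)) (at_left T)"
proof -
  have act: "{A} \<in> active (Y t)" if "(Y t - A) \<bullet> (W1 - A) > 0 \<and> (Y t - A) \<bullet> (W2 - A) > 0 \<and> (Y t - A) \<bullet> (W3 - A) > 0" for t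
  proof -
    have "actV (Y t) A" unfolding actV_def frameD(17)[OF fr]
      using that frame_vpos[OF fr] frame_vpos[OF frame_rot[OF fr]] frame_vpos[OF frame_rot[OF frame_rot[OF fr]]]
      by simp
    then show ?thesis unfolding active_def using frameD(1)[OF fr] by blast
  qed
  have "eventually (\<lambda>t. (Y t - A) \<bullet> (W1 - A) > 0 \<and> (Y t - A) \<bullet> (W2 - A) > 0 \<and> (Y t - A) \<bullet> (W3 - A) > 0) (at_left T)"
    using assms(2-) by (intro eventually_conj)
  then show ?thesis by (rule eventually_mono) (rule act)
qed

text \<open>A point of \<open>G\<close> is its own foot on \<open>G\<close>. The ray meets no edge,
  so the heights over the neighbouring facets, which are the flags of \<open>G\<close>, are positive
  at \<open>T\<close>.\<close>

lemma facet_eventually_active: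
  assumes G: "G \<in> Fs" and zero: "hgt G (Y T) = 0" and YP: "Y T \<in> P" and T: "T > 0"
  shows "eventually (\<lambda>t. G \<in> active (Y t)) (at_left T)"
proof -
  have foot: "foot G (Y T) = Y T" using zero by (simp add: foot_def)
  have "eventually (\<lambda>t. E \<subseteq> G \<longrightarrow> fpos E G (Y t)) (at_left T)" if E: "E \<in> Es" for E
  proof (cases "E \<subseteq> G")
    case True
    obtain A B W2 W3 F3 H where fr: "frame A B W2 W3 F3 G H" and Eq: "E = closed_segment A B"
      using facet_edge_other[OF G E True] by blast
    have "hgt H (Y T) \<noteq> 0"
    proof
      assume "hgt H (Y T) = 0"
      then have "Y T \<in> G \<inter> H" using YP zero mem_facet_iff[OF G] mem_facet_iff[OF frameD(4)[OF fr]] by simp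
      then have "Y T \<in> closed_segment A B" unfolding frame_facet_Int[OF fr] .
      then obtain k where "Y T = (1 - k) *\<^sub>R A + k *\<^sub>R B" by (auto simp: in_segment)
      then show False using Y_not_on_edge_line[OF frameD(1)[OF fr] frame_edge(2)[OF fr] T] by blast
    qed
    then have "hgt H (foot G (Y T)) > 0" unfolding foot
      using hgt_nonneg[OF frameD(4)[OF fr] YP] by simp
    from ev_foot_pos[OF this] show ?thesis
      by (rule eventually_mono) (simp add: Eq frame_fpos[OF fr])
  qed simp
  then have "eventually (\<lambda>t. \<forall>E\<in>Es. E \<subseteq> G \<longrightarrow> fpos E G (Y t)) (at_left T)"
    by (intro eventually_ball_finite finite_Es ballI)
  then show ?thesis
    by (rule eventually_mono) (use G in \<open>auto simp: active_def actF_def\<close>)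
qed

lemma far_vertex_active:
  assumes W: "W \<in> Vs" "W \<noteq> V" "\<And>p. p \<in> P \<Longrightarrow> norm (p - V) \<le> norm (W - V)"
    and T: "T > 0" "\<And>t. 0 < t \<Longrightarrow> t < T \<Longrightarrow> good t"
    and t: "0 < t" "t < T"
  shows "{W} \<in> active (Y t)"
proof (rule ccontr)
  assume "{W} \<notin> active (Y t)"
  then have "\<not> actV (Y t) W" using W(1) unfolding active_def by blast
  then obtain E0 where E0: "E0 \<in> Es" "W \<in> E0" "(Y t - W) \<bullet> (oth W E0 - W) \<le> 0"
    unfolding actV_def vpos_def by (auto simp: not_less)
  let ?z = "\<lambda>E. ((V - W) \<bullet> (oth W E - W), x \<bullet> (oth W E - W))"
  let ?Z = "?z ` (edges_at W)"
  have val: "fst (?z E) + s * snd (?z E) = (Y s - W) \<bullet> (oth W E - W)" for E s by (simp add: Y_inner)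
  have fin: "finite ?Z" using finite_Es by simp
  \<comment> \<open>For a neighbour \<open>U\<close> of the farthest vertex,
    \<open>norm (U - V) \<le> norm (W - V)\<close> forces \<open>2 * ((V - W) \<bullet> (U - W))
    \<ge> (U - W) \<bullet> (U - W)\<close>, so all flags at \<open>W\<close> are positive at time
    0.\<close>
  have pos: "fst z > 0" if "z \<in> ?Z" for z
  proof -
    obtain E where E: "E \<in> Es" "W \<in> E" "z = ?z E" using \<open>z \<in> ?Z\<close> by blast
    obtain U where U: "U \<noteq> W" "E = closed_segment W U" "U \<in> Vs" using edge_segment[OF E(1) W(1) E(2)] by blast
    have "(norm (U - V))\<^sup>2 \<le> (norm (W - V))\<^sup>2" using W(3)[OF vertex_mem[OF U(3)]] by (simp add: power_mono)
    then have "(U - V) \<bullet> (U - V) \<le> (W - V) \<bullet> (W - V)" by (simp add: power2_norm_eq_inner)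
    moreover have "(U - V) \<bullet> (U - V) - (W - V) \<bullet> (W - V) = (U - W) \<bullet> (U - W) - 2 * ((V - W) \<bullet> (U - W))"
      by (simp add: inner_diff_left inner_diff_right inner_commute)
    moreover have "(U - W) \<bullet> (U - W) > 0" using U(1) by simp
    ultimately have "(V - W) \<bullet> (U - W) > 0" by linarith
    then show ?thesis using E(3) U(2) oth_segment[OF U(1)] by simp
  qed
  have z0: "?z E0 \<in> ?Z" using E0 by simp
  have "snd (?z E0) < 0"
  proof (rule ccontr)
    assume "\<not> ?thesis"
    then have "t * snd (?z E0) \<ge> 0" using t by simp
    moreover have "fst (?z E0) > 0" using pos[OF z0] .
    ultimately have "fst (?z E0) + t * snd (?z E0) > 0" by linarith
    then show False using E0(3) unfolding val by simp
  qed
  \<comment> \<open>The first time at which a flag at \<open>W\<close> vanishes. It precedes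
    \<open>T\<close>, so the seven faces at \<open>V\<close> are still active; together with
    \<open>W\<close> and the edge of that flag they will be nine.\<close>
  then obtain S z where S: "S > 0" "\<And>z s. z \<in> ?Z \<Longrightarrow> 0 \<le> s \<Longrightarrow> s < S \<Longrightarrow> fst z + s * snd z > 0"
    "z \<in> ?Z" "fst z + S * snd z = 0"
    using first_exit[OF fin pos z0] by blast
  have "S \<le> t"
  proof (rule ccontr)
    assume "\<not> S \<le> t"
    then have "fst (?z E0) + t * snd (?z E0) > 0" using S(2)[OF z0, of t] t by simp
    then show False using E0(3) unfolding val by simp
  qed
  then have ST: "S < T" using t by simp
  have before: "(Y s - W) \<bullet> (oth W E - W) > 0" if "E \<in> Es" "W \<in> E" "0 < s" "s < S" for E s
    using S(2)[of "?z E" s] that unfolding val by simp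
  have at: "(Y S - W) \<bullet> (oth W E - W) \<ge> 0" if "E \<in> Es" "W \<in> E" for E
    unfolding Y_inner by (rule affine_nonneg_at_end[OF S(1)]) (use before that in \<open>simp add: Y_inner\<close>)
  obtain E where E: "E \<in> Es" "W \<in> E" "z = ?z E" using S(3) by blast
  obtain U1 U2 U3 G1 G2 G3 where fr: "frame W U1 U2 U3 G1 G2 G3" and Eq: "E = closed_segment W U1"
    using edge_frame[OF E(1) W(1) E(2)] by blast
  note fr2 = frame_rot[OF fr] and fr3 = frame_rot[OF frame_rot[OF fr]]
  note fd = frame_distinct(7-9)[OF fr]
  have o: "oth W (closed_segment W U1) = U1" "oth W (closed_segment W U2) = U2" "oth W (closed_segment W U3) = U3"
    using oth_segment fd by simp_all
  have zero: "(Y S - W) \<bullet> (U1 - W) = 0" using S(4) unfolding E(3) val unfolding Eq o .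
  have ge: "(Y S - W) \<bullet> (U2 - W) \<ge> 0" "(Y S - W) \<bullet> (U3 - W) \<ge> 0"
    using at[OF frame_edge(1)[OF fr2]] at[OF frame_edge(1)[OF fr3]] o by simp_all
  note ex = edge_plane_expand[OF fr zero] and inn = edge_plane_inner[OF fr zero]
  \<comment> \<open>A vanishing facet flag would put \<open>Y S\<close> on a line through
    \<open>W\<close> orthogonal to a facet, and the ray avoids these lines.\<close>
  have "hgt G2 (foot G3 (Y S)) \<noteq> 0"
  proof
    assume "hgt G2 (foot G3 (Y S)) = 0"
    then have "Y S = W + (hgt G3 (foot G2 (Y S)) / (1 - (nrm G2 \<bullet> nrm G3)\<^sup>2)) *\<^sub>R nrm G3"
      using ex by (simp add: algebra_simps)
    then show False using Y_not_above_vertex[OF W(1) frameD(4)[OF fr] S(1)] by blast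
  qed
  then have p2: "hgt G2 (foot G3 (Y S)) > 0" using ge(1) inn(1,3) by linarith
  have "hgt G3 (foot G2 (Y S)) \<noteq> 0"
  proof
    assume "hgt G3 (foot G2 (Y S)) = 0"
    then have "Y S = W + (hgt G2 (foot G3 (Y S)) / (1 - (nrm G2 \<bullet> nrm G3)\<^sup>2)) *\<^sub>R nrm G2"
      using ex by (simp add: algebra_simps)
    then show False using Y_not_above_vertex[OF W(1) frameD(3)[OF fr] S(1)] by blast
  qed
  then have p3: "hgt G3 (foot G2 (Y S)) > 0" using ge(2) inn(2,4) by linarith
  have "(Y S - U1) \<bullet> (W - U1) = (U1 - W) \<bullet> (U1 - W) - (Y S - W) \<bullet> (U1 - W)"
    by (simp add: inner_diff_left inner_diff_right inner_commute)
  also have "\<dots> > 0" unfolding zero using fd(1) by simp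
  finally have p1: "(Y S - U1) \<bullet> (W - U1) > 0" .
  have bW: "eventually (\<lambda>s. (Y s - W) \<bullet> (oth W D - W) > 0) (at_left S)" if "D \<in> Es" "W \<in> D" for D
    by (rule eventually_at_left_range[OF S(1)]) (rule before[OF that])
  have actE: "eventually (\<lambda>s. closed_segment W U1 \<in> active (Y s)) (at_left S)"
    by (rule edge_eventually_active[OF fr _ ev_inner_pos[OF p1] ev_foot_pos[OF p3] ev_foot_pos[OF p2]])
      (use bW[OF frame_edge(1)[OF fr]] o in simp)
  have actW: "eventually (\<lambda>s. {W} \<in> active (Y s)) (at_left S)"
    by (rule vertex_eventually_active[OF fr])
      (use bW[OF frame_edge(1)[OF fr]] bW[OF frame_edge(1)[OF fr2]] bW[OF frame_edge(1)[OF fr3]] o in simp_all)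
  have good: "eventually good (at_left S)"
    by (rule eventually_at_left_range[OF S(1)]) (use T(2) ST in simp)
  \<comment> \<open>If the edge ended in \<open>V\<close>, its vanishing flag would violate a
    condition of \<open>good\<close>, which still holds at \<open>S\<close>.\<close>
  have "V \<notin> closed_segment W U1"
  proof
    assume VE: "V \<in> closed_segment W U1"
    have "V \<in> vertices_in (closed_segment W U1)" using VE V by simp
    then have "V = U1" unfolding vertices_of_edge[OF frame_edge(1)[OF fr]] using W(2) by simp
    then have "oth V (closed_segment W U1) = W"
      using oth_segment[OF W(2)] by (simp add: closed_segment_commute)
    moreover have "good S" using T(2)[OF S(1) ST] .
    ultimately have "(Y S - W) \<bullet> (V - W) > 0"
      using frame_edge(1)[OF fr] VE unfolding good_def by fastforce
    then show False using zero \<open>V = U1\<close> by simp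
  qed
  moreover have "closed_segment W U1 \<noteq> {W}" using frame_edge(1)[OF fr] singleton_not_edge by auto
  ultimately show False using no_two_far_active[OF good actE actW] W(2) by simp
qed

lemma no_such_ray: False
proof -
  obtain W where W12: "W \<in> Vs" "W \<noteq> V" and W3: "\<forall>p\<in>P. norm (p - V) \<le> norm (W - V)"
    by (rule farthest_vertex)
  note W = W12 bspec[OF W3]
  obtain T where T1: "T > 0" and T2: "\<forall>t. 0 < t \<longrightarrow> t < T \<longrightarrow> good t"
    and exit: "(\<exists>G\<in>Fs. V \<notin> G \<and> hgt G (Y T) = 0) \<or>
     (\<exists>E\<in>Es. V \<in> E \<and> (Y T - oth V E) \<bullet> (V - oth V E) = 0) \<or>
     (\<exists>F\<in>Fs. \<exists>G\<in>Fs. V \<in> F \<and> V \<notin> G \<and> hgt G (foot F (Y T)) = 0)"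
    by (rule exit_time)
  note T = T1 T2[rule_format]
  have good: "eventually good (at_left T)" by (rule eventually_at_left_range[OF T])
  have actW: "eventually (\<lambda>t. {W} \<in> active (Y t)) (at_left T)"
    by (rule eventually_at_left_range[OF T(1)]) (rule far_vertex_active[OF W T])
  have nofar: False if "V \<notin> X" "X \<noteq> {W}" "eventually (\<lambda>t. X \<in> active (Y t)) (at_left T)" for X
    using no_two_far_active[OF good actW that(3)] that W(2) by simp
  have hge: "hgt G (Y T) \<ge> 0" if G: "G \<in> Fs" for G
    unfolding Y_hgt
    by (rule affine_nonneg_at_end[OF T(1)])
      (use hgt_pos[OF G good_interior[OF T(2)]] in \<open>simp add: Y_hgt\<close>)
  have YP: "Y T \<in> P" using hge by (simp add: mem_P_iff)
  have fge: "hgt G (foot F (Y T)) \<ge> 0" if F: "F \<in> Fs" "V \<in> F" and G: "G \<in> Fs" "G \<noteq> F" for F G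
    unfolding Y_foot
    by (rule affine_nonneg_at_end[OF T(1)])
      (use good_foot_pos[OF T(2) F G(1)] G(2) in \<open>simp add: Y_foot\<close>)
  from exit show False
  proof (elim disjE)
    assume "\<exists>G\<in>Fs. V \<notin> G \<and> hgt G (Y T) = 0"
    then obtain G where G: "G \<in> Fs" "V \<notin> G" "hgt G (Y T) = 0" by blast
    have "G \<noteq> {W}" using G(1) singleton_not_facet by auto
    then show False by (rule nofar[OF G(2) _ facet_eventually_active[OF G(1,3) YP T(1)]])
  next
    assume "\<exists>E\<in>Es. V \<in> E \<and> (Y T - oth V E) \<bullet> (V - oth V E) = 0"
    then obtain E where E: "E \<in> Es" "V \<in> E" "(Y T - oth V E) \<bullet> (V - oth V E) = 0" by blast
    obtain U where U: "U \<noteq> V" "E = closed_segment V U" "U \<in> Vs" using edge_segment[OF E(1) V E(2)] by blast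
    have o: "oth V E = U" "oth U E = V"
      using oth_segment[OF U(1)] oth_segment[OF U(1)[symmetric]] by (simp_all add: U(2) closed_segment_commute)
    have zero: "(Y T - U) \<bullet> (V - U) = 0" using E(3) unfolding o .
    show False
    proof (cases "U = W")
      case True
      have "(norm (Y T - V))\<^sup>2 \<le> (norm (W - V))\<^sup>2" using W(3)[OF YP] by (simp add: power_mono)
      then have "(Y T - V) \<bullet> (Y T - V) \<le> (W - V) \<bullet> (W - V)" by (simp add: power2_norm_eq_inner)
      moreover have "(Y T - V) \<bullet> (Y T - V) = (Y T - W) \<bullet> (Y T - W) + (W - V) \<bullet> (W - V) - 2 * ((Y T - W) \<bullet> (V - W))"
        by (simp add: inner_diff_left inner_diff_right inner_commute)
      ultimately have "(Y T - W) \<bullet> (Y T - W) \<le> 0" using zero True by simp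
      then have "Y T = W" by (simp add: dot_square_norm)
      then show False using Y_not_vertex[OF W(1) T(1)] by simp
    next
      case False
      have UE: "U \<in> E" using U(2) by simp
      obtain U1 U2 U3 G1 G2 G3 where fr: "frame U U1 U2 U3 G1 G2 G3" and Eq: "E = closed_segment U U1"
        using edge_frame[OF E(1) U(3) UE] by blast
      have U1: "U1 = V" using o(2) oth_segment[OF frame_distinct(7)[OF fr]] unfolding Eq by simp
      have VG: "V \<in> G2" "V \<in> G3" using frame_incidence[OF fr] U1 by simp_all
      have zero': "(Y T - U) \<bullet> (U1 - U) = 0" using zero U1 by simp
      note G = frameD(3,4)[OF fr] and ne = frame_distinct(3)[OF fr]
      \<comment> \<open>Both facets over the edge contain \<open>V\<close>, so their mutual flags
        are positive at all positive times; \<open>edge_plane_inner\<close> transfers this to the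
        other two edges at \<open>U\<close>.\<close>
      have "hgt G2 (foot G3 (Y T)) > 0" "hgt G3 (foot G2 (Y T)) > 0"
        using local_foot_pos[OF T(1) G(2) VG(2) G(1) VG(1)] local_foot_pos[OF T(1) G(1) VG(1) G(2) VG(2)] ne
        by simp_all
      then have p: "(Y T - U) \<bullet> (U2 - U) > 0" "(Y T - U) \<bullet> (U3 - U) > 0"
        using edge_plane_inner[OF fr zero'] by simp_all
      have "eventually (\<lambda>t. (Y t - U) \<bullet> (U1 - U) > 0) (at_left T)"
        using good by (rule eventually_mono) (use E(1,2) U1 o in \<open>auto simp: good_def\<close>)
      then have "eventually (\<lambda>t. {U} \<in> active (Y t)) (at_left T)"
        by (rule vertex_eventually_active[OF fr _ ev_inner_pos[OF p(1)] ev_inner_pos[OF p(2)]])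
      then show False using nofar[of "{U}"] U(1) False by simp
    qed
  next
    assume "\<exists>F\<in>Fs. \<exists>G\<in>Fs. V \<in> F \<and> V \<notin> G \<and> hgt G (foot F (Y T)) = 0"
    then obtain F G where F: "F \<in> Fs" "V \<in> F" and G: "G \<in> Fs" "V \<notin> G" and zero: "hgt G (foot F (Y T)) = 0"
      by blast
    define z where "z = foot F (Y T)"
    have GF: "G \<noteq> F" using F G by auto
    have "hgt H z \<ge> 0" if "H \<in> Fs" for H
      using fge[OF F that] foot_on_plane[OF F(1), of "Y T"] by (cases "H = F") (simp_all add: z_def)
    then have zP: "z \<in> P" by (simp add: mem_P_iff)
    have zF: "z \<in> F" using zP mem_facet_iff[OF F(1)] foot_on_plane[OF F(1)] by (simp add: z_def)
    have zG: "z \<in> G" using zP mem_facet_iff[OF G(1)] zero by (simp add: z_def)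
    have "F \<inter> G face_of F"
      by (rule face_of_subset[OF face_of_Int[OF facet_face[OF F(1)] facet_face[OF G(1)]] Int_lower1 facet_subset[OF F(1)]])
    moreover have "F \<inter> G \<noteq> F" using F(2) G(2) by blast
    ultimately have "z \<notin> rel_interior F" using face_of_disjoint_rel_interior zF zG by blast
    then obtain E where E: "E \<in> Es" "E \<subseteq> F" "z \<in> E" using facet_boundary_edge[OF F(1) zF] by blast
    \<comment> \<open>The facet \<open>H\<close> across the edge need not be \<open>G\<close>; from
      here on only the fact that the foot lies on this edge matters.\<close>
    obtain A B W2 W3 F3 H where fr: "frame A B W2 W3 F3 F H" and Eq: "E = closed_segment A B"
      using facet_edge_other[OF F(1) E(1,2)] by blast
    note H = frameD(4)[OF fr] and HF = frame_distinct(3)[OF fr]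
    have AB: "A \<in> Vs" "B \<in> Vs" "A \<noteq> B" using frameD(1)[OF fr] frame_edge(2)[OF fr] frame_distinct(7)[OF fr] by auto
    have zH: "z \<in> H" using frame_facet_Int[OF fr] E(3) unfolding Eq by blast
    then have hz: "hgt H (foot F (Y T)) = 0" using mem_facet_iff[OF H] by (simp add: z_def)
    have VE: "V \<notin> E"
    proof
      assume "V \<in> E"
      then have "V \<in> H" using frame_facet_Int[OF fr] unfolding Eq by blast
      then show False using local_foot_pos[OF T(1) F H] HF hz by simp
    qed
    obtain k where k: "0 \<le> k" "k \<le> 1" "z = (1 - k) *\<^sub>R A + k *\<^sub>R B"
      using E(3) unfolding Eq by (auto simp: in_segment)
    have Yz: "Y T = z + hgt F (Y T) *\<^sub>R nrm F" by (simp add: z_def foot_def)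
    \<comment> \<open>At an end of the edge, \<open>Y T\<close> would lie on a line through a vertex
      orthogonal to \<open>F\<close>, which the ray avoids.\<close>
    have "k \<noteq> 0"
    proof
      assume "k = 0"
      then show False using Yz k(3) Y_not_above_vertex[OF AB(1) F(1) T(1)] by simp
    qed
    have "k \<noteq> 1"
    proof
      assume "k = 1"
      then show False using Yz k(3) Y_not_above_vertex[OF AB(2) F(1) T(1)] by simp
    qed
    have nB: "nrm F \<bullet> (B - A) = 0" using frameD(11)[OF fr] .
    have zA: "z - A = k *\<^sub>R (B - A)" and zB: "z - B = (1 - k) *\<^sub>R (A - B)"
      by (simp_all add: k(3) algebra_simps)
    have "(Y T - A) \<bullet> (B - A) = (z - A) \<bullet> (B - A)"
      using nB by (subst Yz) (simp add: inner_diff_left inner_add_left)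
    also have "\<dots> > 0" unfolding zA using AB(3) k \<open>k \<noteq> 0\<close> by simp
    finally have pA: "(Y T - A) \<bullet> (B - A) > 0" .
    have "nrm F \<bullet> (A - B) = 0" using nB by (simp add: inner_diff_right)
    then have "(Y T - B) \<bullet> (A - B) = (z - B) \<bullet> (A - B)"
      by (subst Yz) (simp add: inner_diff_left inner_add_left)
    also have "\<dots> > 0" unfolding zB using AB(3) k \<open>k \<noteq> 1\<close> by simp
    finally have pB: "(Y T - B) \<bullet> (A - B) > 0" .
    have evH: "eventually (\<lambda>t. hgt H (foot F (Y t)) > 0) (at_left T)"
      by (rule eventually_at_left_range[OF T(1)]) (rule good_foot_pos[OF T(2) F H HF])
    \<comment> \<open>The flag of the edge with \<open>F\<close> vanishes at \<open>T\<close> but is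
      positive before, by \<open>evH\<close>. Its vanishing turns the flag with \<open>H\<close>
      into the height over \<open>F\<close> times the squared sine of the angle between the
      normals.\<close>
    have "hgt H (Y T) = hgt F (Y T) * (nrm H \<bullet> nrm F)" using hz by (simp add: hgt_foot)
    then have "hgt F (foot H (Y T)) = hgt F (Y T) * (1 - (nrm F \<bullet> nrm H)\<^sup>2)"
      by (simp add: hgt_foot inner_commute algebra_simps power2_eq_square)
    moreover have "1 - (nrm F \<bullet> nrm H)\<^sup>2 > 0" using frame_cos[OF frame_rot[OF fr]] by simp
    moreover have "hgt F (Y T) > 0" by (rule local_hgt_pos[OF T(1) F])
    ultimately have pF: "hgt F (foot H (Y T)) > 0" by simp
    have "E \<noteq> {W}" using E(1) singleton_not_edge by auto
    then show False
      using nofar[OF VE] edge_eventually_active[OF fr ev_inner_pos[OF pA] ev_inner_pos[OF pB] evH ev_foot_pos[OF pF]]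
      unfolding Eq by simp
  qed
qed

end

section \<open>Acute angles at a vertex\<close>

context simple3
begin

text \<open>Such directions form an open set, so one of them avoids the finitely many planes that
  the locale \<open>ray\<close> has to exclude.\<close>

lemma not_all_active:
  assumes fr: "frame V W1 W2 W3 F1 F2 F3" and few: "max_normals P < 10"
  shows "\<not> all_active (nrm F1) (nrm F2) (nrm F3) (W1 - V) (W2 - V) (W3 - V) x"
proof
  assume x0: "all_active (nrm F1) (nrm F2) (nrm F3) (W1 - V) (W2 - V) (W3 - V) x"
  let ?D = "{x. all_active (nrm F1) (nrm F2) (nrm F3) (W1 - V) (W2 - V) (W3 - V) x}"
  let ?A = "{W - V |W. W \<in> Vs} \<union> nrm ` Fs"
  \<comment> \<open>A normal of some plane containing \<open>a\<close> and \<open>b\<close>: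
    avoiding this one plane keeps \<open>x\<close> from every combination of \<open>a\<close> and
    \<open>b\<close>.\<close>
  define q where "q a b = (SOME n. n \<noteq> 0 \<and> n \<bullet> a = 0 \<and> n \<bullet> b = 0)" for a b :: "real^3"
  have q: "q a b \<noteq> 0 \<and> q a b \<bullet> a = 0 \<and> q a b \<bullet> b = 0" for a b
  proof -
    have "\<exists>n. n \<noteq> 0 \<and> n \<bullet> a = 0 \<and> n \<bullet> b = 0" using common_orthogonal_vector[of a b] by metis
    then show ?thesis unfolding q_def by (rule someI_ex)
  qed
  let ?S1 = "(\<lambda>(a, b). q a b) ` (?A \<times> ?A)"
  let ?S2 = "(\<lambda>(U, W). W - U) ` (Vs \<times> Vs) - {0}"
  let ?S3 = "(\<lambda>(F, G). nrm G - (nrm G \<bullet> nrm F) *\<^sub>R nrm F) ` (Fs \<times> Fs) - {0}"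
  have "finite ?A" using finite_Vs finite_Fs by simp
  then have fin: "finite (?S1 \<union> ?S2 \<union> ?S3)" using finite_Vs finite_Fs by simp
  have "0 \<notin> ?S1" using q by force
  then have z: "0 \<notin> ?S1 \<union> ?S2 \<union> ?S3" by blast
  have ne: "?D \<noteq> {}" using x0 by blast
  obtain x where xD: "x \<in> ?D" and xS: "\<And>p. p \<in> ?S1 \<union> ?S2 \<union> ?S3 \<Longrightarrow> p \<bullet> x \<noteq> 0"
    using open_avoids_hyperplanes[OF open_all_active ne fin z] by blast
  have act: "all_active (nrm F1) (nrm F2) (nrm F3) (W1 - V) (W2 - V) (W3 - V) x" using xD by simp
  note act' = act[unfolded all_active_def]
  have Fcases: "F = F1 \<or> F = F2 \<or> F = F3" if "F \<in> Fs" "V \<in> F" for F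
    using arg_cong[OF frameD(18)[OF fr], of "\<lambda>A. F \<in> A"] that by simp
  have Ecases: "E = closed_segment V W1 \<or> E = closed_segment V W2 \<or> E = closed_segment V W3" if "E \<in> Es" "V \<in> E" for E
    using arg_cong[OF frameD(17)[OF fr], of "\<lambda>A. E \<in> A"] that by simp
  have "ray P V x"
  proof unfold_locales
    show "V \<in> Vs" using frameD(1)[OF fr] .
    show "nrm F \<bullet> x > 0" if "F \<in> Fs" "V \<in> F" for F using Fcases[OF that] act' by blast
    show "x \<bullet> (oth V E - V) > 0" if "E \<in> Es" "V \<in> E" for E
      using Ecases[OF that] act' oth_segment[OF frame_distinct(7)[OF fr]]
        oth_segment[OF frame_distinct(8)[OF fr]] oth_segment[OF frame_distinct(9)[OF fr]] by auto
    show "nrm G \<bullet> x - (nrm F \<bullet> x) * (nrm G \<bullet> nrm F) > 0"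
      if "F \<in> Fs" "V \<in> F" "G \<in> Fs" "V \<in> G" "F \<noteq> G" for F G
      using Fcases[OF that(1,2)] Fcases[OF that(3,4)] that(5) act' by blast
    show "x \<noteq> k *\<^sub>R a + l *\<^sub>R b" if ab: "a \<in> ?A" "b \<in> ?A" for a b k l
    proof
      assume x: "x = k *\<^sub>R a + l *\<^sub>R b"
      have "q a b \<in> ?S1" using ab by blast
      then have "q a b \<bullet> x \<noteq> 0" using xS by blast
      moreover have "q a b \<bullet> x = 0" unfolding x using q[of a b] by (simp add: inner_add_right)
      ultimately show False by simp
    qed
    show "x \<bullet> (W - U) \<noteq> 0" if UW: "U \<in> Vs" "W \<in> Vs" "U \<noteq> W" for U W
    proof -
      have "W - U \<in> ?S2" using UW by force
      then have "(W - U) \<bullet> x \<noteq> 0" using xS by blast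
      then show ?thesis by (simp add: inner_commute)
    qed
    show "nrm G \<bullet> x - (nrm F \<bullet> x) * (nrm G \<bullet> nrm F) \<noteq> 0"
      if FG: "F \<in> Fs" "G \<in> Fs" "nrm G \<noteq> (nrm G \<bullet> nrm F) *\<^sub>R nrm F" for F G
    proof -
      have "nrm G - (nrm G \<bullet> nrm F) *\<^sub>R nrm F \<in> ?S3" using FG by force
      then have "(nrm G - (nrm G \<bullet> nrm F) *\<^sub>R nrm F) \<bullet> x \<noteq> 0" using xS by blast
      then show ?thesis by (simp add: inner_diff_left mult.commute)
    qed
    show "max_normals P < 10" by (rule few)
  qed
  then show False by (rule ray.no_such_ray)
qed

section \<open>Dihedral and planar angles in terms of a frame\<close>

lemma orth_to_edge_facet:
  assumes fr: "frame V W1 W2 W3 F1 F2 F3" and p: "p \<in> F2" "p \<notin> closed_segment V W1"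
  obtains h where "h > 0"
    "orth_to_edge (closed_segment V W1) p = h *\<^sub>R (nrm F3 - (nrm F2 \<bullet> nrm F3) *\<^sub>R nrm F2)"
proof -
  define d where "d = W1 - V"
  define c where "c = nrm F2 \<bullet> nrm F3"
  have d0: "d \<noteq> 0" using frame_distinct(7)[OF fr] by (simp add: d_def)
  \<comment> \<open>This vector is orthogonal to the edge and to \<open>nrm F2\<close>, so
    \<open>edge_normal_expand\<close> leaves a multiple of
    \<open>nrm F3 - c *\<^sub>R nrm F2\<close>; the factor is positive because \<open>p\<close> is
    off \<open>F3\<close>.\<close>
  define r where "r = (p - V) - ((p - V) \<bullet> d / (d \<bullet> d)) *\<^sub>R d"
  have r: "orth_to_edge (closed_segment V W1) p = r"
    using orth_to_edge_segment[OF d0, of V p] by (simp add: d_def r_def)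
  have rd: "r \<bullet> (W1 - V) = 0" unfolding d_def[symmetric] using d0 by (simp add: r_def inner_diff_left)
  have nd: "nrm F2 \<bullet> d = 0" "nrm F3 \<bullet> d = 0" using frameD(11,14)[OF fr] by (simp_all add: d_def)
  have pP: "p \<in> P" using p(1) facet_subset[OF frameD(3)[OF fr]] by blast
  have n2: "nrm F2 \<bullet> r = 0"
    using frame_hgt[OF frame_rot[OF fr], of p] mem_facet_iff[OF frameD(3)[OF fr], of p] p(1) nd
    by (simp add: r_def inner_diff_right)
  have n3: "nrm F3 \<bullet> r = hgt F3 p"
    using frame_hgt[OF frame_rot[OF frame_rot[OF fr]], of p] nd by (simp add: r_def inner_diff_right)
  have "p \<notin> F3" using frame_facet_Int[OF fr] p by blast
  then have h: "hgt F3 p > 0"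
    using hgt_nonneg[OF frameD(4)[OF fr] pP] mem_facet_iff[OF frameD(4)[OF fr], of p] pP by simp
  have c1: "1 - c\<^sup>2 > 0" using frame_cos[OF frame_rot[OF fr]] by (simp add: c_def)
  have "r = ((nrm F2 \<bullet> r - (nrm F3 \<bullet> r) * c) / (1 - c\<^sup>2)) *\<^sub>R nrm F2
    + ((nrm F3 \<bullet> r - (nrm F2 \<bullet> r) * c) / (1 - c\<^sup>2)) *\<^sub>R nrm F3"
    unfolding c_def by (rule edge_normal_expand[OF fr rd])
  also have "\<dots> = (hgt F3 p / (1 - c\<^sup>2)) *\<^sub>R (nrm F3 - c *\<^sub>R nrm F2)"
    unfolding n2 n3 by (simp add: algebra_simps)
  finally have "orth_to_edge (closed_segment V W1) p = (hgt F3 p / (1 - c\<^sup>2)) *\<^sub>R (nrm F3 - c *\<^sub>R nrm F2)"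
    unfolding r .
  moreover have "hgt F3 p / (1 - c\<^sup>2) > 0" using h c1 by simp
  ultimately show ?thesis using that unfolding c_def by blast
qed

lemma dihedral_angle_frame:
  assumes fr: "frame V W1 W2 W3 F1 F2 F3"
  shows "dihedral_angle P (closed_segment V W1) =
    vec_angle (nrm F3 - (nrm F2 \<bullet> nrm F3) *\<^sub>R nrm F2) (nrm F2 - (nrm F2 \<bullet> nrm F3) *\<^sub>R nrm F3)"
    (is "_ = vec_angle ?m2 ?m3")
proof -
  let ?E = "closed_segment V W1"
  note sw = frame_swap[OF fr] and fr2 = frame_rot[OF fr] and fr3 = frame_rot[OF frame_rot[OF fr]]
  have val: "vec_angle (orth_to_edge ?E p) (orth_to_edge ?E q) = vec_angle ?m2 ?m3"
    if p: "p \<in> F2 - ?E" and q: "q \<in> F3 - ?E" for p q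
  proof -
    obtain h where h: "h > 0" "orth_to_edge ?E p = h *\<^sub>R ?m2"
      using orth_to_edge_facet[OF fr] p by blast
    obtain k where k: "k > 0" "orth_to_edge ?E q = k *\<^sub>R ?m3"
      using orth_to_edge_facet[OF sw, of q] q unfolding inner_commute[of "nrm F3" "nrm F2"] by blast
    show ?thesis unfolding h(2) k(2) by (rule vec_angle_scale[OF h(1) k(1)])
  qed
  have sub: "?E \<subseteq> F2" "?E \<subseteq> F3" using frame_facet_Int[OF fr] by blast+
  have W3: "W3 \<in> F2 - ?E" using frame_incidence[OF fr3] sub by blast
  have W2: "W2 \<in> F3 - ?E" using frame_incidence[OF fr2] sub by blast
  show ?thesis unfolding dihedral_angle_def
  proof (rule the_equality)
    show "\<exists>F G p q. F facet_of P \<and> G facet_of P \<and> F \<noteq> G \<and> ?E \<subseteq> F \<and> ?E \<subseteq> G \<and> p \<in> F - ?E \<and> q \<in> G - ?E \<and>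
        vec_angle ?m2 ?m3 = vec_angle (orth_to_edge ?E p) (orth_to_edge ?E q)"
      using frameD(3,4)[OF fr] frame_distinct(3)[OF fr] sub W2 W3 val[OF W3 W2]
      by (intro exI[of _ F2] exI[of _ F3] exI[of _ W3] exI[of _ W2]) (simp add: Fs_def)
    fix \<theta> assume "\<exists>F G p q. F facet_of P \<and> G facet_of P \<and> F \<noteq> G \<and> ?E \<subseteq> F \<and> ?E \<subseteq> G \<and> p \<in> F - ?E \<and> q \<in> G - ?E \<and>
        \<theta> = vec_angle (orth_to_edge ?E p) (orth_to_edge ?E q)"
    then obtain F G p q where FG: "F \<in> Fs" "G \<in> Fs" "F \<noteq> G" "?E \<subseteq> F" "?E \<subseteq> G" "p \<in> F - ?E" "q \<in> G - ?E"
      and th: "\<theta> = vec_angle (orth_to_edge ?E p) (orth_to_edge ?E q)"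
      unfolding Fs_def by blast
    have "F = F2 \<or> F = F3" "G = F2 \<or> G = F3"
      using arg_cong[OF facets_of_edge[OF fr], of "\<lambda>A. F \<in> A"] arg_cong[OF facets_of_edge[OF fr], of "\<lambda>A. G \<in> A"]
        FG by simp_all
    then consider "F = F2" "G = F3" | "F = F3" "G = F2" using FG(3) by blast
    then show "\<theta> = vec_angle ?m2 ?m3"
    proof cases
      case 1
      then show ?thesis using FG th val by simp
    next
      case 2
      then show ?thesis using FG th val vec_angle_commute by metis
    qed
  qed
qed

text \<open>The dihedral angle is the supplement of the angle between the inner normals: with
  \<open>c\<close> their cosine, the two directions inside the facets have product
  \<open>- (c * (1 - c\<^sup>2))\<close>.\<close>

lemma dihedral_angle_acute_iff:
  assumes fr: "frame V W1 W2 W3 F1 F2 F3"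
  shows "dihedral_angle P (closed_segment V W1) < pi / 2 \<longleftrightarrow> nrm F2 \<bullet> nrm F3 < 0"
    "dihedral_angle P (closed_segment V W1) = pi / 2 \<longleftrightarrow> nrm F2 \<bullet> nrm F3 = 0"
proof -
  define c where "c = nrm F2 \<bullet> nrm F3"
  let ?m2 = "nrm F3 - c *\<^sub>R nrm F2" and ?m3 = "nrm F2 - c *\<^sub>R nrm F3"
  have c1: "1 - c\<^sup>2 > 0" using frame_cos[OF frame_rot[OF fr]] by (simp add: c_def)
  have n: "nrm F2 \<bullet> nrm F2 = 1" "nrm F3 \<bullet> nrm F3 = 1" "nrm F3 \<bullet> nrm F2 = c"
    using nrm_sq frameD(3,4)[OF fr] by (simp_all add: c_def inner_commute)
  have "?m2 \<bullet> ?m2 = 1 - c\<^sup>2" "?m3 \<bullet> ?m3 = 1 - c\<^sup>2"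
    using n c_def by (simp_all add: inner_diff_left inner_diff_right power2_eq_square)
  then have ne: "?m2 \<noteq> 0" "?m3 \<noteq> 0" using c1 by auto
  have "?m2 \<bullet> ?m3 = - (c * (1 - c\<^sup>2))"
    using n c_def by (simp add: inner_diff_left inner_diff_right power2_eq_square algebra_simps)
  then have "?m2 \<bullet> ?m3 > 0 \<longleftrightarrow> c < 0" "?m2 \<bullet> ?m3 = 0 \<longleftrightarrow> c = 0"
    using c1 by (auto simp: mult_less_0_iff)
  then show "dihedral_angle P (closed_segment V W1) < pi / 2 \<longleftrightarrow> nrm F2 \<bullet> nrm F3 < 0"
    "dihedral_angle P (closed_segment V W1) = pi / 2 \<longleftrightarrow> nrm F2 \<bullet> nrm F3 = 0"
    unfolding dihedral_angle_frame[OF fr] c_def[symmetric] vec_angle_right[OF ne] by simp_all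
qed

lemma edge_of_facet_iff: "F \<in> Fs \<Longrightarrow> E edge_of F \<longleftrightarrow> E \<in> Es \<and> E \<subseteq> F"
  using face_of_face[OF facet_face] by (auto simp: edge_of_def Es_def)

lemma edges_of_facet:
  assumes fr: "frame V W1 W2 W3 F1 F2 F3"
  shows "{E. E edge_of F1 \<and> V \<in> E} = {closed_segment V W2, closed_segment V W3}"
  unfolding edges_of_facet_at_vertex[OF fr, symmetric] edge_of_facet_iff[OF frameD(2)[OF fr]] by blast

lemma planar_angle_frame:
  assumes fr: "frame V W1 W2 W3 F1 F2 F3"
  shows "planar_angle F1 V = vec_angle (W2 - V) (W3 - V)"
  unfolding planar_angle_def
proof (rule the_equality)
  note ne = frame_distinct[OF fr]
  have iff: "W \<noteq> V \<and> closed_segment V W edge_of F1 \<longleftrightarrow> W = W2 \<or> W = W3" for W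
  proof -
    have "closed_segment V W edge_of F1 \<longleftrightarrow> closed_segment V W = closed_segment V W2 \<or> closed_segment V W = closed_segment V W3"
      using arg_cong[OF edges_of_facet[OF fr], of "\<lambda>A. closed_segment V W \<in> A"] by simp
    then show ?thesis using ne by (auto simp: doubleton_eq_iff)
  qed
  have i2: "W2 \<noteq> V \<and> closed_segment V W2 edge_of F1" and i3: "W3 \<noteq> V \<and> closed_segment V W3 edge_of F1"
    using iff by blast+
  show "\<exists>Wa Wb. Wa \<noteq> V \<and> Wb \<noteq> V \<and> closed_segment V Wa edge_of F1 \<and> closed_segment V Wb edge_of F1 \<and>
     closed_segment V Wa \<noteq> closed_segment V Wb \<and> vec_angle (W2 - V) (W3 - V) = vec_angle (Wa - V) (Wb - V)"
    using i2 i3 frame_edges_distinct(3)[OF fr] by blast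
  fix \<theta> assume "\<exists>Wa Wb. Wa \<noteq> V \<and> Wb \<noteq> V \<and> closed_segment V Wa edge_of F1 \<and> closed_segment V Wb edge_of F1 \<and>
     closed_segment V Wa \<noteq> closed_segment V Wb \<and> \<theta> = vec_angle (Wa - V) (Wb - V)"
  then obtain Wa Wb where W: "Wa = W2 \<or> Wa = W3" "Wb = W2 \<or> Wb = W3" "closed_segment V Wa \<noteq> closed_segment V Wb"
    and th: "\<theta> = vec_angle (Wa - V) (Wb - V)"
    using iff by blast
  then show "\<theta> = vec_angle (W2 - V) (W3 - V)" using vec_angle_commute by metis
qed

lemma planar_angle_acute_iff:
  assumes fr: "frame V W1 W2 W3 F1 F2 F3"
  shows "planar_angle F1 V < pi / 2 \<longleftrightarrow> (W2 - V) \<bullet> (W3 - V) > 0"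
    "planar_angle F1 V = pi / 2 \<longleftrightarrow> (W2 - V) \<bullet> (W3 - V) = 0"
proof -
  have "W2 - V \<noteq> 0" "W3 - V \<noteq> 0" using frame_distinct(8,9)[OF fr] by simp_all
  from vec_angle_right[OF this] show "planar_angle F1 V < pi / 2 \<longleftrightarrow> (W2 - V) \<bullet> (W3 - V) > 0"
    "planar_angle F1 V = pi / 2 \<longleftrightarrow> (W2 - V) \<bullet> (W3 - V) = 0"
    unfolding planar_angle_frame[OF fr] by simp_all
qed

lemma acute_edges_frame:
  assumes fr: "frame V W1 W2 W3 F1 F2 F3"
  shows "acute_edges P V = {E \<in> {closed_segment V W1, closed_segment V W2, closed_segment V W3}. dihedral_angle P E < pi / 2}"
  unfolding acute_edges_def frameD(17)[OF fr, symmetric] by (auto simp: Es_def)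

lemma acute_facets_frame:
  assumes fr: "frame V W1 W2 W3 F1 F2 F3"
  shows "acute_facets P V = {F \<in> {F1, F2, F3}. planar_angle F V < pi / 2}"
  unfolding acute_facets_def frameD(18)[OF fr, symmetric] by (auto simp: Fs_def)

text \<open>The edge to \<open>W1\<close> is the one with the obtuse dihedral angle, and the two
  acute edges span \<open>F1\<close>, whose planar angle is not acute. The acute facet is
  \<open>F2\<close> or \<open>F3\<close>, and both contain the edge to \<open>W1\<close>.\<close>

lemma tame_vertex:
  assumes fr: "frame V W1 W2 W3 F1 F2 F3"
    and t: "tame_type (nrm F1) (nrm F2) (nrm F3) (W1 - V) (W2 - V) (W3 - V)"
  shows "card (acute_edges P V) = 2 \<and>
    (\<exists>F. acute_facets P V = {F} \<and> {E. E edge_of F \<and> V \<in> E} \<noteq> acute_edges P V)"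
proof -
  note fr2 = frame_rot[OF fr] and fr3 = frame_rot[OF frame_rot[OF fr]]
  let ?E1 = "closed_segment V W1" and ?E2 = "closed_segment V W2" and ?E3 = "closed_segment V W3"
  note ed = frame_edges_distinct[OF fr] and fd = frame_distinct(1-3)[OF fr]
  note t' = t[unfolded tame_type_def]
  have "\<not> dihedral_angle P ?E1 < pi / 2" "dihedral_angle P ?E2 < pi / 2" "dihedral_angle P ?E3 < pi / 2"
    unfolding dihedral_angle_acute_iff[OF fr] dihedral_angle_acute_iff[OF fr2] dihedral_angle_acute_iff[OF fr3]
      inner_commute[of "nrm F3" "nrm F1"] using t' by simp_all
  then have ae: "acute_edges P V = {?E2, ?E3}" unfolding acute_edges_frame[OF fr] by auto
  have p: "planar_angle F1 V < pi / 2 \<longleftrightarrow> (W2 - V) \<bullet> (W3 - V) > 0"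
    "planar_angle F2 V < pi / 2 \<longleftrightarrow> (W1 - V) \<bullet> (W3 - V) > 0"
    "planar_angle F3 V < pi / 2 \<longleftrightarrow> (W1 - V) \<bullet> (W2 - V) > 0"
    unfolding planar_angle_acute_iff[OF fr] planar_angle_acute_iff[OF fr2] planar_angle_acute_iff[OF fr3]
      inner_commute[of "W3 - V" "W1 - V"] by simp_all
  have n1: "\<not> planar_angle F1 V < pi / 2" unfolding p using t' by simp
  have e2: "{E. E edge_of F2 \<and> V \<in> E} = {?E3, ?E1}" and e3: "{E. E edge_of F3 \<and> V \<in> E} = {?E1, ?E2}"
    using edges_of_facet[OF fr2] edges_of_facet[OF fr3] by simp_all
  have "\<exists>F. acute_facets P V = {F} \<and> {E. E edge_of F \<and> V \<in> E} \<noteq> acute_edges P V"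
  proof (cases "(W1 - V) \<bullet> (W3 - V) > 0")
    case True
    then have "planar_angle F2 V < pi / 2" "\<not> planar_angle F3 V < pi / 2" unfolding p using t' by auto
    then have "acute_facets P V = {F2}" unfolding acute_facets_frame[OF fr] using n1 by auto
    moreover have "{?E3, ?E1} \<noteq> {?E2, ?E3}" using ed by (simp add: doubleton_eq_iff)
    ultimately show ?thesis using e2 ae by auto
  next
    case False
    then have "\<not> planar_angle F2 V < pi / 2" "planar_angle F3 V < pi / 2" unfolding p using t' by auto
    then have "acute_facets P V = {F3}" unfolding acute_facets_frame[OF fr] using n1 by auto
    moreover have "{?E1, ?E2} \<noteq> {?E2, ?E3}" using ed by (simp add: doubleton_eq_iff)
    ultimately show ?thesis using e3 ae by auto
  qed
  moreover have "card {?E2, ?E3} = 2" using ed(3) by simp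
  ultimately show ?thesis unfolding ae by blast
qed

lemma vertex_tame:
  assumes gen: "generic_polytope P" and few: "max_normals P < 10" and V: "V \<in> Vs"
  shows "card (acute_edges P V) = 2 \<and>
    (\<exists>F. acute_facets P V = {F} \<and> {E. E edge_of F \<and> V \<in> E} \<noteq> acute_edges P V)"
proof -
  have dih: "dihedral_angle P E \<noteq> pi / 2" if "E \<in> Es" for E
    using gen that by (simp add: generic_polytope_def Es_def)
  have pla: "planar_angle F V \<noteq> pi / 2" if "F \<in> Fs" "V \<in> F" for F
  proof -
    have "V extreme_point_of F" using extreme_point_of_face[OF facet_face[OF that(1)]] V that(2) by (simp add: Vs_def)
    then show ?thesis using gen that(1) by (simp add: generic_polytope_def Fs_def)
  qed
  have nz: "nrm F2 \<bullet> nrm F3 \<noteq> 0" "(W2 - V) \<bullet> (W3 - V) \<noteq> 0" if fr: "frame V W1 W2 W3 F1 F2 F3" for W1 W2 W3 F1 F2 F3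
    using dih[OF frame_edge(1)[OF fr]] dihedral_angle_acute_iff(2)[OF fr]
      pla[OF frameD(2)[OF fr] frameD(5)[OF fr]] planar_angle_acute_iff(2)[OF fr] by simp_all
  obtain W1 W2 W3 F1 F2 F3 where fr: "frame V W1 W2 W3 F1 F2 F3" using frame_exists[OF V] by blast
  note fr2 = frame_rot[OF fr] and fr3 = frame_rot[OF frame_rot[OF fr]]
  have "tame_type (nrm F1) (nrm F2) (nrm F3) (W1 - V) (W2 - V) (W3 - V) \<or>
    tame_type (nrm F2) (nrm F3) (nrm F1) (W2 - V) (W3 - V) (W1 - V) \<or>
    tame_type (nrm F3) (nrm F1) (nrm F2) (W3 - V) (W1 - V) (W2 - V)"
  proof (rule tame_type_or_active[OF frame_dual[OF fr]])
    show "nrm F1 \<bullet> nrm F2 \<noteq> 0" "nrm F2 \<bullet> nrm F3 \<noteq> 0" "(W1 - V) \<bullet> (W2 - V) \<noteq> 0" "(W2 - V) \<bullet> (W3 - V) \<noteq> 0"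
      using nz[OF fr] nz[OF fr3] by simp_all
    show "nrm F1 \<bullet> nrm F3 \<noteq> 0" "(W1 - V) \<bullet> (W3 - V) \<noteq> 0"
      using nz[OF fr2] by (simp_all add: inner_commute)
    show "\<not> all_active (nrm F1) (nrm F2) (nrm F3) (W1 - V) (W2 - V) (W3 - V) x" for x
      by (rule not_all_active[OF fr few])
  qed
  then show ?thesis using tame_vertex[OF fr] tame_vertex[OF fr2] tame_vertex[OF fr3] by blast
qed

end

theorem corollary1:
  fixes P :: "(real^3) set"
  assumes "simple_polytope P"
    and "generic_polytope P"
    and "max_normals P < 10"
  shows "(\<forall>V. V extreme_point_of P \<longrightarrow> card (acute_edges P V) = 2) \<and>
    (\<forall>V. V extreme_point_of P \<longrightarrow>
      (\<exists>F. acute_facets P V = {F} \<and> {E. E edge_of F \<and> V \<in> E} \<noteq> acute_edges P V))"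
proof -
  interpret simple3 P by unfold_locales (rule assms(1))
  show ?thesis using vertex_tame[OF assms(2,3)] by (simp add: Vs_def)
qed

end
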